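(* Let $\varphi$ be a non-constant function in $H^\infty_1(\mathbb{D})$ such that $\varphi\in\mathcal{M}_1(\mathcal{H}(B))$, where $B(z,w)=\frac{1}{(1-z\overline{w})^2}$ $(z,w\in\mathbb{D})$ is the kernel of the Bergman space over $\mathbb{D}$. Then the de Branges-Rovnyak subspace $\mathcal{H}(B^\varphi)$ of the Bergman space over $\mathbb{D}$ is a CNP space if and only if there exist $\lambda\in\mathbb{T}$ and $\mu\in\mathbb{D}$ such that $\varphi(z)=\lambda\, b_\mu(z)$ for all $z\in\mathbb{D}$.
   Context: $\mathbb{D}$ is the open unit disc in $\mathbb{C}$, $\mathbb{T}=\{z\in\mathbb{C}:|z|=1\}$, and for $\mu\in\mathbb{D}$, $b_\mu(z)=\frac{z-\mu}{1-\bar\mu z}$ is the corresponding automorphism of $\mathbb{D}$. $H^\infty_1(\mathbb{D})$ is the set of holomorphic functions $\varphi:\mathbb{D}\to\mathbb{C}$ with $\sup|\varphi|\le1$. For a kernel (positive semi-definite function) $K$ on a set $\Omega$, $\mathcal{H}(K)$ is the associated reproducing kernel Hilbert space. A multiplier of $\mathcal{H}(K)$ is a function $\varphi:\Omega\to\mathbb{C}$ with $\varphi f\in\mathcal{H}(K)$ for all $f\in\mathcal{H}(K)$; it is contractive if the multiplication operator $M_\varphi f=\varphi f$ satisfies $\|M_\varphi\|\le1$, equivalently if $(1-\varphi(x)\overline{\varphi(y)})K(x,y)$ is a kernel. $\mathcal{M}_1(\mathcal{H}(K))$ is the set of contractive multipliers. For $\varphi\in\mathcal{M}_1(\mathcal{H}(K))$,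 $K^\varphi(x,y)=(1-\varphi(x)\overline{\varphi(y)})K(x,y)$, and $\mathcal{H}(K^\varphi)$ is the de Branges-Rovnyak space associated to $\varphi$. A kernel $K$ on $\Omega$ is a complete Nevanlinna-Pick (CNP) kernel, and $\mathcal{H}(K)$ a CNP space, if for all $m,n\in\mathbb{N}$, every finite set of distinct points $x_1,\dots,x_k\in\Omega$ and all complex $m\times n$ matrices $W_1,\dots,W_k$ for which the block matrix $[(I-W_iW_j^* )K(x_i,x_j)]_{i,j=1}^k$ is positive semi-definite, there is a function $\Phi$ from $\Omega$ to the $m\times n$ matrices, multiplying $\mathcal{H}(K)\otimes\mathbb{C}^n$ into $\mathcal{H}(K)\otimes\mathbb{C}^m$, with $\Phi(x_i)=W_i$ for all $i$ and $\|M_\Phi\|\le1$. *)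

theory Defs
  imports
    "HOL-Analysis.Analysis"
    "Jordan_Normal_Form.Schur_Decomposition"
begin

section \<open>Kernels\<close>

definition psd_mat :: "complex mat \<Rightarrow> bool" where
  "psd_mat A \<longleftrightarrow> square_mat A \<and> (\<forall>v \<in> carrier_vec (dim_row A). 0 \<le> (A *\<^sub>v v) \<bullet>c v)"

text \<open>The order on the complex numbers is that of \<^theory>\<open>HOL-Library.Complex_Order\<close>, so a
  nonnegative number is in particular real, and a positive semi-definite matrix is Hermitian.\<close>

definition kernel_on :: "'a set \<Rightarrow> ('a \<Rightarrow> 'a \<Rightarrow> complex) \<Rightarrow> bool" where
  "kernel_on \<Omega> K \<longleftrightarrow>
     (\<forall>k (x :: nat \<Rightarrow> 'a). x ` {..<k} \<subseteq> \<Omega> \<longrightarrow> psd_mat (mat k k (\<lambda>(i, j). K (x i) (x j))))"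


section \<open>Reproducing kernel Hilbert spaces\<close>

definition inner_product_on ::
    "('a \<Rightarrow> complex) set \<Rightarrow> (('a \<Rightarrow> complex) \<Rightarrow> ('a \<Rightarrow> complex) \<Rightarrow> complex) \<Rightarrow> bool" where
  "inner_product_on H ip \<longleftrightarrow>
     (\<lambda>_. 0) \<in> H \<and>
     (\<forall>f\<in>H. \<forall>g\<in>H. \<forall>c. (\<lambda>x. c * f x + g x) \<in> H) \<and>
     (\<forall>f\<in>H. \<forall>g\<in>H. \<forall>h\<in>H. \<forall>c. ip (\<lambda>x. c * f x + g x) h = c * ip f h + ip g h) \<and>
     (\<forall>f\<in>H. \<forall>g\<in>H. ip g f = cnj (ip f g)) \<and>
     (\<forall>f\<in>H. 0 \<le> ip f f \<and> (ip f f = 0 \<longrightarrow> f = (\<lambda>_. 0)))"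

definition norm_of ::
    "(('a \<Rightarrow> complex) \<Rightarrow> ('a \<Rightarrow> complex) \<Rightarrow> complex) \<Rightarrow> ('a \<Rightarrow> complex) \<Rightarrow> real" where
  "norm_of ip f = sqrt (Re (ip f f))"

text \<open>A function on \<open>\<Omega>\<close> is represented by its extension by \<open>0\<close> to the whole type, so that
  equality of functions on \<open>\<Omega>\<close> is equality in HOL. Similarly the inner product is extended by \<open>0\<close>
  outside of \<open>H\<close>; this makes the pair \<open>(H, ip)\<close> below unique for a given kernel.\<close>

definition is_rkhs ::
    "'a set \<Rightarrow> ('a \<Rightarrow> 'a \<Rightarrow> complex) \<Rightarrow> ('a \<Rightarrow> complex) set \<Rightarrow>
     (('a \<Rightarrow> complex) \<Rightarrow> ('a \<Rightarrow> complex) \<Rightarrow> complex) \<Rightarrow> bool" where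
  "is_rkhs \<Omega> K H ip \<longleftrightarrow>
     (\<forall>f\<in>H. \<forall>x. x \<notin> \<Omega> \<longrightarrow> f x = 0) \<and>
     (\<forall>f g. f \<notin> H \<or> g \<notin> H \<longrightarrow> ip f g = 0) \<and>
     inner_product_on H ip \<and>
     Metric_space.mcomplete H (\<lambda>f g. norm_of ip (\<lambda>x. f x - g x)) \<and>
     (\<forall>y\<in>\<Omega>. (\<lambda>x. if x \<in> \<Omega> then K x y else 0) \<in> H \<and>
        (\<forall>f\<in>H. ip f (\<lambda>x. if x \<in> \<Omega> then K x y else 0) = f y))"

text \<open>By the Moore--Aronszajn theorem, a kernel has exactly one reproducing kernel Hilbert space,
  so the description below is proper whenever \<^term>\<open>kernel_on \<Omega> K\<close>.\<close>

definition rkhs ::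
    "'a set \<Rightarrow> ('a \<Rightarrow> 'a \<Rightarrow> complex) \<Rightarrow>
     ('a \<Rightarrow> complex) set \<times> (('a \<Rightarrow> complex) \<Rightarrow> ('a \<Rightarrow> complex) \<Rightarrow> complex)" where
  "rkhs \<Omega> K = (THE (H, ip). is_rkhs \<Omega> K H ip)"

definition rkhs_space :: "'a set \<Rightarrow> ('a \<Rightarrow> 'a \<Rightarrow> complex) \<Rightarrow> ('a \<Rightarrow> complex) set" where
  "rkhs_space \<Omega> K = fst (rkhs \<Omega> K)"

definition rkhs_norm :: "'a set \<Rightarrow> ('a \<Rightarrow> 'a \<Rightarrow> complex) \<Rightarrow> ('a \<Rightarrow> complex) \<Rightarrow> real" where
  "rkhs_norm \<Omega> K = norm_of (snd (rkhs \<Omega> K))"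


section \<open>Multipliers\<close>

definition contractive_multipliers ::
    "'a set \<Rightarrow> ('a \<Rightarrow> 'a \<Rightarrow> complex) \<Rightarrow> ('a \<Rightarrow> complex) set" where
  "contractive_multipliers \<Omega> K =
     {\<phi>. \<forall>f \<in> rkhs_space \<Omega> K.
        (\<lambda>x. \<phi> x * f x) \<in> rkhs_space \<Omega> K \<and>
        rkhs_norm \<Omega> K (\<lambda>x. \<phi> x * f x) \<le> rkhs_norm \<Omega> K f}"

text \<open>The elements of the tensor product of \<open>H(K)\<close> with the \<open>n\<close>-dimensional Euclidean space are
  identified with \<open>n\<close>-tuples of elements of \<open>H(K)\<close>; the square of the norm is the sum of the
  squares of the norms of the components.\<close>

definition contractive_matrix_multiplier ::
    "'a set \<Rightarrow> ('a \<Rightarrow> 'a \<Rightarrow> complex) \<Rightarrow> nat \<Rightarrow> nat \<Rightarrow> ('a \<Rightarrow> complex mat) \<Rightarrow> bool" where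
  "contractive_matrix_multiplier \<Omega> K m n \<Phi> \<longleftrightarrow>
     (\<forall>x\<in>\<Omega>. \<Phi> x \<in> carrier_mat m n) \<and>
     (\<forall>F :: nat \<Rightarrow> 'a \<Rightarrow> complex. (\<forall>j<n. F j \<in> rkhs_space \<Omega> K) \<longrightarrow>
        (\<forall>i<m. (\<lambda>x. \<Sum>j<n. \<Phi> x $$ (i, j) * F j x) \<in> rkhs_space \<Omega> K) \<and>
        (\<Sum>i<m. (rkhs_norm \<Omega> K (\<lambda>x. \<Sum>j<n. \<Phi> x $$ (i, j) * F j x))\<^sup>2)
          \<le> (\<Sum>j<n. (rkhs_norm \<Omega> K (F j))\<^sup>2))"


section \<open>Complete Nevanlinna--Pick kernels\<close>

text \<open>The block matrix with the \<open>m \<times> m\<close> blocks \<open>(I - W\<^sub>i W\<^sub>j\<^sup>*) K(x\<^sub>i, x\<^sub>j)\<close> for \<open>i, j < k\<close>.\<close>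

definition pick_matrix ::
    "('a \<Rightarrow> 'a \<Rightarrow> complex) \<Rightarrow> nat \<Rightarrow> nat \<Rightarrow> (nat \<Rightarrow> 'a) \<Rightarrow> (nat \<Rightarrow> complex mat) \<Rightarrow> complex mat" where
  "pick_matrix K m k x W = mat (k * m) (k * m) (\<lambda>(p, q).
     let i = p div m; j = q div m
     in (1\<^sub>m m - W i * mat_adjoint (W j)) $$ (p mod m, q mod m) * K (x i) (x j))"

definition cnp_kernel :: "'a set \<Rightarrow> ('a \<Rightarrow> 'a \<Rightarrow> complex) \<Rightarrow> bool" where
  "cnp_kernel \<Omega> K \<longleftrightarrow> kernel_on \<Omega> K \<and>
     (\<forall>m n k. \<forall>(x :: nat \<Rightarrow> 'a) (W :: nat \<Rightarrow> complex mat).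
        0 < m \<longrightarrow> 0 < n \<longrightarrow> inj_on x {..<k} \<longrightarrow> x ` {..<k} \<subseteq> \<Omega> \<longrightarrow>
        (\<forall>i<k. W i \<in> carrier_mat m n) \<longrightarrow>
        psd_mat (pick_matrix K m k x W) \<longrightarrow>
        (\<exists>\<Phi>. contractive_matrix_multiplier \<Omega> K m n \<Phi> \<and> (\<forall>i<k. \<Phi> (x i) = W i)))"


section \<open>The unit disc\<close>

abbreviation unit_disc :: "complex set" where
  "unit_disc \<equiv> ball 0 1"

definition H_inf_1 :: "(complex \<Rightarrow> complex) set" where
  "H_inf_1 = {\<phi>. \<phi> holomorphic_on unit_disc \<and> (\<forall>z\<in>unit_disc. norm (\<phi> z) \<le> 1)}"

definition disc_aut :: "complex \<Rightarrow> complex \<Rightarrow> complex" where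
  "disc_aut \<mu> z = (z - \<mu>) / (1 - cnj \<mu> * z)"

definition bergman_kernel :: "complex \<Rightarrow> complex \<Rightarrow> complex" where
  "bergman_kernel z w = 1 / (1 - z * cnj w)\<^sup>2"

text \<open>The kernel of the de Branges--Rovnyak space associated to \<open>\<phi>\<close>.\<close>

definition dbr_kernel ::
    "('a \<Rightarrow> 'a \<Rightarrow> complex) \<Rightarrow> ('a \<Rightarrow> complex) \<Rightarrow> 'a \<Rightarrow> 'a \<Rightarrow> complex" where
  "dbr_kernel K \<phi> x y = (1 - \<phi> x * cnj (\<phi> y)) * K x y"

end

theory Submission
  imports Defs "HOL-Complex_Analysis.Conformal_Mappings"
begin

text \<open>Every kernel has a unique reproducing kernel Hilbert space, and the norm in it is a supremum over
  finite families of point evaluations; so contractivity of a multiplier is a positivity condition.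

  If \<open>\<phi> = c b\<^sub>\<mu>\<close>, the kernel is a rescaling of the Szegoe kernel, and an interpolant for it
  is obtained as the transfer function of a contraction extending the isometry given by a
  factorization of the Pick matrix.

  Conversely, put \<open>\<psi> = b\<^bsub>\<phi>(0)\<^esub> \<circ> \<phi>\<close> and \<open>\<psi>(z) = z g(z)\<close>. Extending the solution of an extremal
  two-point problem to the point \<open>0\<close> shows that
  \<open>L(z,w) = (2 - z w\<^sup>* - g(z) g(w)\<^sup>*) / (1 - \<psi>(z) \<psi>(w)\<^sup>*)\<close> is positive semi-definite at any two
  points. For \<open>w \<rightarrow> 0\<close> and the vector \<open>(1, -1)\<close> this says
  \<open>0 \<le> - |z|\<^sup>2 (1 - |g(z)|\<^sup>2)\<^sup>2 / (1 - |\<psi>(z)|\<^sup>2) - |g(z) - g(0)|\<^sup>2\<close>, so \<open>g\<close> is a unimodular constant.\<close>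

section \<open>Finitely supported coefficient functions\<close>

text \<open>The spaces are given by \<open>THE\<close>, so nothing about \<open>rkhs_space\<close>
  or \<open>rkhs_norm\<close> is available before existence and uniqueness. The dictionary used
  throughout: a finitely supported \<open>c\<close> stands for the combination of kernel functions
  with these coefficients. The adjoint of multiplication by \<Phi> multiplies the coefficients by
  conjugates of the values of \<Phi>, so contractivity becomes an inequality between finite
  quadratic forms, and no operator theory is needed.

  The function L comes from normalizing the kernel at 0. In K(x,0) K(0,y) / (K(x,y) K(0,0)) all
  factors that depend on x alone or on y alone cancel, and what remains is (1 - x cnj y)^2 / (1 -
  \<psi>(x) cnj \<psi>(y)). For a complete Pick kernel, 1 minus this function is positive
  semi-definite on every finite set; positivity at two points suffices here, and scalar
  interpolation at two nodes already yields it. The square, inherited from the Bergman kernel,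
  leaves the 2 in the numerator of L once x cnj y is split off. As w tends to 0 the denominators of
  L(w,w) and L(z,w) tend to 1, so that the inequality becomes explicit.\<close>

definition finsupp :: "'a set \<Rightarrow> ('a \<Rightarrow> complex) set" where
  "finsupp \<Omega> = {c. finite {x. c x \<noteq> 0} \<and> {x. c x \<noteq> 0} \<subseteq> \<Omega>}"

text \<open>By the reproducing property this is the inner product of \<open>f\<close> with the
  combination \<open>comb \<Omega> K c\<close>, whence the conjugate. It uses only values of
  \<open>f\<close>, so it makes sense before there is an inner product.\<close>

definition pairing :: "('a \<Rightarrow> complex) \<Rightarrow> ('a \<Rightarrow> complex) \<Rightarrow> complex" where
  "pairing f c = (\<Sum>x | c x \<noteq> 0. cnj (c x) * f x)"

definition comb :: "'a set \<Rightarrow> ('a \<Rightarrow> 'a \<Rightarrow> complex) \<Rightarrow> ('a \<Rightarrow> complex) \<Rightarrow> 'a \<Rightarrow> complex" where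
  "comb \<Omega> K c x = (if x \<in> \<Omega> then \<Sum>y | c y \<noteq> 0. c y * K x y else 0)"

lemma finsuppI:
  assumes "finite S" "S \<subseteq> \<Omega>" "\<And>x. x \<notin> S \<Longrightarrow> c x = 0"
  shows "c \<in> finsupp \<Omega>"
proof -
  have "{x. c x \<noteq> 0} \<subseteq> S" using assms(3) by blast
  then show ?thesis using assms(1,2) finite_subset unfolding finsupp_def by auto
qed

lemma finsupp_finite: "c \<in> finsupp \<Omega> \<Longrightarrow> finite {x. c x \<noteq> 0}"
  and finsupp_subset: "c \<in> finsupp \<Omega> \<Longrightarrow> {x. c x \<noteq> 0} \<subseteq> \<Omega>"
  by (auto simp: finsupp_def)

lemma finsupp_common:
  assumes "c \<in> finsupp \<Omega>" "d \<in> finsupp \<Omega>"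
  shows "\<exists>S. finite S \<and> S \<subseteq> \<Omega> \<and> (\<forall>x. x \<notin> S \<longrightarrow> c x = 0) \<and> (\<forall>x. x \<notin> S \<longrightarrow> d x = 0)"
  using assms by (intro exI[of _ "{x. c x \<noteq> 0} \<union> {x. d x \<noteq> 0}"]) (auto simp: finsupp_def)

lemma finsupp_lin:
  assumes "c \<in> finsupp \<Omega>" "d \<in> finsupp \<Omega>"
  shows "(\<lambda>x. a * c x + d x) \<in> finsupp \<Omega>"
proof -
  obtain S where "finite S" "S \<subseteq> \<Omega>" "\<And>x. x \<notin> S \<Longrightarrow> c x = 0" "\<And>x. x \<notin> S \<Longrightarrow> d x = 0"
    using finsupp_common[OF assms] by blast
  then show ?thesis by (intro finsuppI[of S]) auto
qed

lemma finsupp_zero: "(\<lambda>_. 0) \<in> finsupp \<Omega>"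
  by (simp add: finsupp_def)

lemma finsupp_add: "c \<in> finsupp \<Omega> \<Longrightarrow> d \<in> finsupp \<Omega> \<Longrightarrow> (\<lambda>x. c x + d x) \<in> finsupp \<Omega>"
  using finsupp_lin[of c \<Omega> d 1] by simp

lemma finsupp_diff: "c \<in> finsupp \<Omega> \<Longrightarrow> d \<in> finsupp \<Omega> \<Longrightarrow> (\<lambda>x. c x - d x) \<in> finsupp \<Omega>"
  using finsupp_lin[of d \<Omega> c "-1"] by simp

lemma finsupp_mult: "c \<in> finsupp \<Omega> \<Longrightarrow> (\<lambda>x. a x * c x) \<in> finsupp \<Omega>"
  by (rule finsuppI[of "{x. c x \<noteq> 0}"]) (auto simp: finsupp_def)

lemma finsupp_sum:
  assumes "\<And>i. i \<in> I \<Longrightarrow> c i \<in> finsupp \<Omega>"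
  shows "(\<lambda>x. \<Sum>i\<in>I. c i x) \<in> finsupp \<Omega>"
  using assms by (induction I rule: infinite_finite_induct) (auto simp: finsupp_zero finsupp_add)

lemma pairing_eq:
  assumes "finite S" "\<And>x. x \<notin> S \<Longrightarrow> c x = 0"
  shows "pairing f c = (\<Sum>x\<in>S. cnj (c x) * f x)"
  unfolding pairing_def using assms by (intro sum.mono_neutral_left) auto

lemma comb_eq:
  assumes "finite S" "\<And>x. x \<notin> S \<Longrightarrow> c x = 0" "x \<in> \<Omega>"
  shows "comb \<Omega> K c x = (\<Sum>y\<in>S. c y * K x y)"
  unfolding comb_def using assms by (simp, intro sum.mono_neutral_left) auto

lemma pairing_lin_left: "pairing (\<lambda>x. a * f x + h x) c = a * pairing f c + pairing h c"
  unfolding pairing_def by (simp add: sum.distrib sum_distrib_left algebra_simps)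

lemma pairing_zero_right: "pairing f (\<lambda>_. 0) = 0"
  by (simp add: pairing_def)

lemma pairing_diff_left: "pairing (\<lambda>x. f x - h x) c = pairing f c - pairing h c"
  using pairing_lin_left[of "-1" h f c] by simp

lemma pairing_lin_right:
  assumes "c \<in> finsupp \<Omega>" "d \<in> finsupp \<Omega>"
  shows "pairing f (\<lambda>x. a * c x + d x) = cnj a * pairing f c + pairing f d"
proof -
  obtain S where S: "finite S" "S \<subseteq> \<Omega>" "\<And>x. x \<notin> S \<Longrightarrow> c x = 0" "\<And>x. x \<notin> S \<Longrightarrow> d x = 0"
    using finsupp_common[OF assms] by blast
  then show ?thesis
    using pairing_eq[of S c f] pairing_eq[of S d f] pairing_eq[of S "\<lambda>x. a * c x + d x" f]
    by (simp add: sum.distrib sum_distrib_left algebra_simps)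
qed

lemma pairing_scale_right:
  assumes "c \<in> finsupp \<Omega>"
  shows "pairing f (\<lambda>x. a * c x) = cnj a * pairing f c"
  using pairing_lin_right[OF assms finsupp_zero] by (simp add: pairing_zero_right)

lemma comb_lin:
  assumes "c \<in> finsupp \<Omega>" "d \<in> finsupp \<Omega>"
  shows "comb \<Omega> K (\<lambda>x. a * c x + d x) = (\<lambda>x. a * comb \<Omega> K c x + comb \<Omega> K d x)"
proof
  fix x
  obtain S where S: "finite S" "S \<subseteq> \<Omega>" "\<And>x. x \<notin> S \<Longrightarrow> c x = 0" "\<And>x. x \<notin> S \<Longrightarrow> d x = 0"
    using finsupp_common[OF assms] by blast
  show "comb \<Omega> K (\<lambda>x. a * c x + d x) x = a * comb \<Omega> K c x + comb \<Omega> K d x"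
  proof (cases "x \<in> \<Omega>")
    case True
    then show ?thesis
      using S comb_eq[of S c x \<Omega> K] comb_eq[of S d x \<Omega> K] comb_eq[of S "\<lambda>x. a * c x + d x" x \<Omega> K]
      by (simp add: sum.distrib sum_distrib_left algebra_simps)
  qed (simp add: comb_def)
qed

lemma comb_zero: "comb \<Omega> K (\<lambda>_. 0) = (\<lambda>_. 0)"
  by (simp add: comb_def fun_eq_iff)

lemma comb_diff:
  assumes "c \<in> finsupp \<Omega>" "d \<in> finsupp \<Omega>"
  shows "comb \<Omega> K (\<lambda>x. c x - d x) = (\<lambda>x. comb \<Omega> K c x - comb \<Omega> K d x)"
  using comb_lin[OF assms(2,1), of K "-1"] by simp

lemma pairing_comb:
  assumes "finite S" "S \<subseteq> \<Omega>" "\<And>x. x \<notin> S \<Longrightarrow> c x = 0" "\<And>x. x \<notin> S \<Longrightarrow> d x = 0"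
  shows "pairing (comb \<Omega> K d) c = (\<Sum>x\<in>S. \<Sum>y\<in>S. cnj (c x) * d y * K x y)"
proof -
  have "pairing (comb \<Omega> K d) c = (\<Sum>x\<in>S. cnj (c x) * comb \<Omega> K d x)"
    using assms by (intro pairing_eq) auto
  also have "\<dots> = (\<Sum>x\<in>S. cnj (c x) * (\<Sum>y\<in>S. d y * K x y))"
    using assms by (intro sum.cong refl arg_cong2[where f="(*)"] comb_eq) auto
  finally show ?thesis by (simp add: sum_distrib_left mult.assoc)
qed

definition single :: "'a \<Rightarrow> 'a \<Rightarrow> complex" where
  "single y x = (if x = y then 1 else 0)"

lemma single_finsupp: "y \<in> \<Omega> \<Longrightarrow> single y \<in> finsupp \<Omega>"
  by (rule finsuppI[of "{y}"]) (auto simp: single_def)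

lemma pairing_single: "pairing f (single y) = f y"
  using pairing_eq[of "{y}" "single y" f] by (simp add: single_def)

lemma comb_single: "comb \<Omega> K (single y) = (\<lambda>x. if x \<in> \<Omega> then K x y else 0)"
proof
  fix x show "comb \<Omega> K (single y) x = (if x \<in> \<Omega> then K x y else 0)"
    using comb_eq[of "{y}" "single y" x \<Omega> K] by (auto simp: single_def comb_def)
qed

section \<open>Kernels as positive quadratic forms\<close>

lemma psd_mat_iff:
  "psd_mat (mat k k A) \<longleftrightarrow> (\<forall>v. 0 \<le> (\<Sum>i<k. \<Sum>j<k. cnj (v i) * v j * A (i, j)))"
proof -
  have eq: "(mat k k A *\<^sub>v v) \<bullet>c v = (\<Sum>i<k. \<Sum>j<k. cnj (v $ i) * v $ j * A (i, j))"
    if "v \<in> carrier_vec k" for v :: "complex vec"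
    using that
    by (auto simp: scalar_prod_def conjugate_complex_def sum_distrib_left atLeast0LessThan mult_ac
        intro!: sum.cong)
  show ?thesis
  proof (intro iffI allI)
    fix v :: "nat \<Rightarrow> complex"
    assume "psd_mat (mat k k A)"
    then have "0 \<le> (mat k k A *\<^sub>v vec k v) \<bullet>c vec k v"
      unfolding psd_mat_def by (auto simp del: mult_mat_vec_def)
    then show "0 \<le> (\<Sum>i<k. \<Sum>j<k. cnj (v i) * v j * A (i, j))"
      using eq[of "vec k v"] by simp
  next
    assume *: "\<forall>v. 0 \<le> (\<Sum>i<k. \<Sum>j<k. cnj (v i) * v j * A (i, j))"
    show "psd_mat (mat k k A)"
      unfolding psd_mat_def using * eq by (auto simp: square_mat.simps)
  qed
qed

text \<open>Kernels are defined through tuples of points, which may repeat, whereas a coefficient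
  function sees each point once. From tuples to functions the support is enumerated; in the other
  direction the coefficients at equal points are added up.\<close>

lemma kernel_on_iff:
  "kernel_on \<Omega> K \<longleftrightarrow> (\<forall>c\<in>finsupp \<Omega>. 0 \<le> pairing (comb \<Omega> K c) c)" (is "?l = ?r")
proof
  assume K: ?l
  show ?r
  proof
    fix c assume c: "c \<in> finsupp \<Omega>"
    let ?S = "{x. c x \<noteq> 0}"
    obtain h where h: "bij_betw h {..<card ?S} ?S"
      using ex_bij_betw_nat_finite[OF finsupp_finite[OF c]] by (auto simp: atLeast0LessThan)
    have "h ` {..<card ?S} \<subseteq> \<Omega>"
      using h finsupp_subset[OF c] by (simp add: bij_betw_def)
    then have "0 \<le> (\<Sum>i<card ?S. \<Sum>j<card ?S. cnj (c (h i)) * c (h j) * K (h i) (h j))"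
      using K unfolding kernel_on_def psd_mat_iff by auto
    also have "\<dots> = (\<Sum>x\<in>?S. \<Sum>y\<in>?S. cnj (c x) * c y * K x y)"
      by (simp add: sum.reindex_bij_betw[OF h, symmetric])
    also have "\<dots> = pairing (comb \<Omega> K c) c"
      using finsupp_finite[OF c] finsupp_subset[OF c] by (intro pairing_comb[symmetric]) auto
    finally show "0 \<le> pairing (comb \<Omega> K c) c" .
  qed
next
  assume r: ?r
  show ?l
    unfolding kernel_on_def psd_mat_iff
  proof (intro allI impI)
    fix k :: nat and x :: "nat \<Rightarrow> 'a" and v :: "nat \<Rightarrow> complex"
    assume x: "x ` {..<k} \<subseteq> \<Omega>"
    define c where "c y = (\<Sum>i | i < k \<and> x i = y. v i)" for y
    have c0: "c y = 0" if "y \<notin> x ` {..<k}" for y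
      unfolding c_def using that by (intro sum.neutral) auto
    have "c \<in> finsupp \<Omega>"
      using x c0 by (intro finsuppI[of "x ` {..<k}"]) auto
    then have "0 \<le> pairing (comb \<Omega> K c) c" using r by blast
    also have "\<dots> = (\<Sum>y\<in>x ` {..<k}. \<Sum>z\<in>x ` {..<k}. cnj (c y) * c z * K y z)"
      using x c0 by (intro pairing_comb) auto
    also have "\<dots> = (\<Sum>y\<in>x ` {..<k}. cnj (c y) * (\<Sum>z\<in>x ` {..<k}. c z * K y z))"
      by (simp only: sum_distrib_left mult.assoc)
    also have "\<dots> = (\<Sum>y\<in>x ` {..<k}. cnj (c y) * (\<Sum>j<k. v j * K y (x j)))"
    proof -
      have "(\<Sum>z\<in>x ` {..<k}. c z * K y z) = (\<Sum>j<k. v j * K y (x j))" for y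
      proof -
        have "(\<Sum>z\<in>x ` {..<k}. c z * K y z)
            = (\<Sum>z\<in>x ` {..<k}. \<Sum>j | j \<in> {..<k} \<and> x j = z. v j * K y (x j))"
          unfolding c_def sum_distrib_right by (intro sum.cong) auto
        also have "\<dots> = (\<Sum>j<k. v j * K y (x j))"
          by (rule sum.image_gen[symmetric]) simp
        finally show ?thesis .
      qed
      then show ?thesis by simp
    qed
    also have "\<dots> = (\<Sum>y\<in>x ` {..<k}. \<Sum>i | i \<in> {..<k} \<and> x i = y.
        cnj (v i) * (\<Sum>j<k. v j * K (x i) (x j)))"
      unfolding c_def cnj_sum sum_distrib_right by (intro sum.cong) auto
    also have "\<dots> = (\<Sum>i<k. cnj (v i) * (\<Sum>j<k. v j * K (x i) (x j)))"
      by (rule sum.image_gen[symmetric]) simp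
    finally show "0 \<le> (\<Sum>i<k. \<Sum>j<k. cnj (v i) * v j * (case (i, j) of (i, j) \<Rightarrow> K (x i) (x j)))"
      by (simp only: sum_distrib_left mult.assoc prod.case)
  qed
qed

section \<open>Inner products\<close>

lemma discriminant_le:
  fixes A B p :: real
  assumes "\<And>t. 0 \<le> t\<^sup>2 * B - 2 * t * p + A" "0 \<le> B"
  shows "p\<^sup>2 \<le> A * B"
proof (cases "B = 0")
  case True
  have "p = 0"
  proof (rule ccontr)
    assume "p \<noteq> 0"
    \<comment> \<open>At this argument the polynomial, which is linear for B = 0, takes the value
      -1.\<close>
    then show False using assms(1)[of "(A + 1) / (2 * p)"] True by simp
  qed
  then show ?thesis using True by simp
next
  case False
  then have "0 < B" using assms(2) by simp
  then have "0 \<le> A - p\<^sup>2 / B"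
    using assms(1)[of "p / B"] by (simp add: power2_eq_square field_simps)
  then show ?thesis using \<open>0 < B\<close> by (simp add: field_simps)
qed

lemma cnj_sgn_mult: "cnj (sgn z) * z = complex_of_real (cmod z)"
proof (cases "z = 0")
  case False
  have "cnj (sgn z) * z = (z * cnj z) / cmod z"
    by (simp add: sgn_eq mult.commute)
  also have "\<dots> = cmod z"
    using False by (simp flip: complex_norm_square add: power2_eq_square)
  finally show ?thesis .
qed simp

context
  fixes H :: "('a \<Rightarrow> complex) set" and ip
  assumes ip: "inner_product_on H ip"
begin

lemma ip_zero: "(\<lambda>_. 0) \<in> H"
  using ip unfolding inner_product_on_def by blast

lemma ip_closed: "f \<in> H \<Longrightarrow> g \<in> H \<Longrightarrow> (\<lambda>x. c * f x + g x) \<in> H"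
  using ip unfolding inner_product_on_def by blast

lemma ip_lin: "f \<in> H \<Longrightarrow> g \<in> H \<Longrightarrow> h \<in> H \<Longrightarrow> ip (\<lambda>x. c * f x + g x) h = c * ip f h + ip g h"
  using ip unfolding inner_product_on_def by blast

lemma ip_sym: "f \<in> H \<Longrightarrow> g \<in> H \<Longrightarrow> ip g f = cnj (ip f g)"
  using ip unfolding inner_product_on_def by blast

lemma ip_nonneg: "f \<in> H \<Longrightarrow> 0 \<le> ip f f" and ip_eq_0D: "f \<in> H \<Longrightarrow> ip f f = 0 \<Longrightarrow> f = (\<lambda>_. 0)"
  using ip unfolding inner_product_on_def by blast+

lemma ip_pos: "f \<in> H \<Longrightarrow> 0 \<le> Re (ip f f)"
  using ip_nonneg[of f] by (simp add: less_eq_complex_def)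

lemma ip_definite: "f \<in> H \<Longrightarrow> Re (ip f f) = 0 \<Longrightarrow> f = (\<lambda>_. 0)"
  using ip_nonneg[of f] ip_eq_0D[of f] by (simp add: less_eq_complex_def complex_eq_iff)

lemma ip_scale_closed: "f \<in> H \<Longrightarrow> (\<lambda>x. c * f x) \<in> H"
  using ip_closed[of f "\<lambda>_. 0" c] ip_zero by simp

lemma ip_diff_closed: "f \<in> H \<Longrightarrow> g \<in> H \<Longrightarrow> (\<lambda>x. f x - g x) \<in> H"
  using ip_closed[of g f "-1"] by simp

lemma ip_zero_left: "f \<in> H \<Longrightarrow> ip (\<lambda>_. 0) f = 0"
  using ip_lin[of "\<lambda>_. 0" "\<lambda>_. 0" f 1] ip_zero by simp

lemma ip_lin_right:
  assumes "f \<in> H" "g \<in> H" "h \<in> H"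
  shows "ip h (\<lambda>x. c * f x + g x) = cnj c * ip h f + ip h g"
  using ip_sym[OF ip_closed[OF assms(1,2), of c] assms(3)] ip_lin[OF assms, of c]
    ip_sym[OF assms(1,3)] ip_sym[OF assms(2,3)] by simp

lemma ip_quad:
  assumes "f \<in> H" "g \<in> H"
  shows "Re (ip (\<lambda>x. c * f x + g x) (\<lambda>x. c * f x + g x))
       = (cmod c)\<^sup>2 * Re (ip f f) + 2 * Re (c * ip f g) + Re (ip g g)"
proof -
  have "ip (\<lambda>x. c * f x + g x) (\<lambda>x. c * f x + g x)
      = c * (cnj c * ip f f + ip f g) + (cnj c * ip g f + ip g g)"
    using ip_lin[OF assms ip_closed[OF assms, of c], of c]
      ip_lin_right[OF assms assms(1), of c] ip_lin_right[OF assms assms(2), of c] by simp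
  also have "\<dots> = (cmod c)\<^sup>2 * ip f f + (c * ip f g + cnj (c * ip f g)) + ip g g"
    using ip_sym[OF assms] by (simp add: complex_norm_square algebra_simps del: of_real_power)
  finally show ?thesis by simp
qed

lemma ip_diff_quad:
  assumes "f \<in> H" "g \<in> H"
  shows "Re (ip (\<lambda>x. f x - g x) (\<lambda>x. f x - g x))
       = Re (ip f f) - 2 * Re (ip f g) + Re (ip g g)"
proof -
  have "Re (ip g f) = Re (ip f g)" using ip_sym[OF assms] by simp
  then show ?thesis using ip_quad[OF assms(2,1), of "-1"] by simp
qed

lemma ip_Cauchy_Schwarz:
  assumes "f \<in> H" "g \<in> H"
  shows "cmod (ip f g) \<le> norm_of ip f * norm_of ip g"
proof -
  have "(cmod (ip f g))\<^sup>2 \<le> Re (ip g g) * Re (ip f f)"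
  proof (cases "ip f g = 0")
    case False
    show ?thesis
    proof (rule discriminant_le)
      fix t :: real
      define c where "c = - t * cnj (sgn (ip f g))"
      have "c * ip f g = complex_of_real (- t) * (cnj (sgn (ip f g)) * ip f g)"
        by (simp add: c_def)
      also have "\<dots> = complex_of_real (- t * cmod (ip f g))"
        by (simp only: cnj_sgn_mult of_real_mult)
      finally have "Re (c * ip f g) = - t * cmod (ip f g)" by simp
      moreover have "cmod c = \<bar>t\<bar>"
        using False by (simp add: c_def norm_mult norm_sgn)
      ultimately show "0 \<le> t\<^sup>2 * Re (ip f f) - 2 * t * cmod (ip f g) + Re (ip g g)"
        using ip_quad[OF assms, of c] ip_pos[OF ip_closed[OF assms, of c]] by simp
    qed (simp_all add: assms ip_pos)
  qed (simp_all add: assms ip_pos)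
  then have "cmod (ip f g) \<le> sqrt (Re (ip g g) * Re (ip f f))"
    by (intro real_le_rsqrt)
  then show ?thesis by (simp add: norm_of_def real_sqrt_mult mult.commute)
qed

lemma norm_of_nonneg: "f \<in> H \<Longrightarrow> 0 \<le> norm_of ip f"
  by (simp add: norm_of_def ip_pos)

lemma norm_of_sq: "f \<in> H \<Longrightarrow> (norm_of ip f)\<^sup>2 = Re (ip f f)"
  by (simp add: norm_of_def ip_pos)

lemma norm_of_triangle:
  assumes "f \<in> H" "g \<in> H"
  shows "norm_of ip (\<lambda>x. f x + g x) \<le> norm_of ip f + norm_of ip g"
proof (rule power2_le_imp_le)
  have "Re (ip f g) \<le> norm_of ip f * norm_of ip g"
    using ip_Cauchy_Schwarz[OF assms] complex_Re_le_cmod[of "ip f g"] by linarith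
  then show "(norm_of ip (\<lambda>x. f x + g x))\<^sup>2 \<le> (norm_of ip f + norm_of ip g)\<^sup>2"
    using ip_quad[OF assms, of 1] ip_closed[OF assms, of 1] assms
    by (simp add: norm_of_sq power2_sum)
qed (simp add: assms norm_of_nonneg)

lemma norm_of_minus:
  assumes "f \<in> H"
  shows "norm_of ip (\<lambda>x. - f x) = norm_of ip f"
  using ip_quad[OF assms ip_zero, of "-1"] ip_zero_left[OF assms] ip_sym[OF assms ip_zero]
    ip_zero_left[OF ip_zero] by (simp add: norm_of_def)

text \<open>The locale \<open>Metric_space\<close> asks for nonnegativity and symmetry at all
  arguments, not just in \<open>H\<close>. If the difference of the arguments lies outside
  \<open>H\<close>, the assumption \<open>out\<close> makes the distance 0.\<close>

lemma ip_metric: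
  assumes out: "\<And>f g. f \<notin> H \<or> g \<notin> H \<Longrightarrow> ip f g = 0"
  shows "Metric_space H (\<lambda>f g. norm_of ip (\<lambda>x. f x - g x))"
proof
  show "0 \<le> norm_of ip (\<lambda>x. f x - g x)" for f g
    using norm_of_nonneg out by (cases "(\<lambda>x. f x - g x) \<in> H") (auto simp: norm_of_def)
  show "norm_of ip (\<lambda>x. f x - g x) = norm_of ip (\<lambda>x. g x - f x)" for f g
  proof (cases "(\<lambda>x. f x - g x) \<in> H")
    case True
    then show ?thesis using norm_of_minus[OF True] by simp
  next
    case False
    then have "(\<lambda>x. g x - f x) \<notin> H"
      using ip_scale_closed[of "\<lambda>x. g x - f x" "-1"] by auto
    then show ?thesis using False out by (simp add: norm_of_def)
  qed
  show "norm_of ip (\<lambda>x. f x - g x) = 0 \<longleftrightarrow> f = g" if "f \<in> H" "g \<in> H" for f g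
  proof
    assume "norm_of ip (\<lambda>x. f x - g x) = 0"
    then have "(\<lambda>x. f x - g x) = (\<lambda>_. 0)"
      using ip_definite[OF ip_diff_closed[OF that]] by (simp add: norm_of_def)
    then show "f = g" by (simp add: fun_eq_iff)
  next
    assume "f = g"
    then show "norm_of ip (\<lambda>x. f x - g x) = 0"
      using ip_zero_left[OF ip_zero] by (simp add: norm_of_def)
  qed
  show "norm_of ip (\<lambda>x. f x - h x) \<le> norm_of ip (\<lambda>x. f x - g x) + norm_of ip (\<lambda>x. g x - h x)"
    if "f \<in> H" "g \<in> H" "h \<in> H" for f g h
    using norm_of_triangle[of "\<lambda>x. f x - g x" "\<lambda>x. g x - h x"] that
    by (simp add: ip_diff_closed)
qed

lemma mcomplete_iff:
  assumes out: "\<And>f g. f \<notin> H \<or> g \<notin> H \<Longrightarrow> ip f g = 0"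
  shows "Metric_space.mcomplete H (\<lambda>f g. norm_of ip (\<lambda>x. f x - g x)) \<longleftrightarrow>
    (\<forall>\<sigma>. (\<forall>n. \<sigma> n \<in> H) \<longrightarrow>
      (\<forall>\<epsilon>>0. \<exists>N. \<forall>n m. N \<le> n \<longrightarrow> N \<le> m \<longrightarrow> norm_of ip (\<lambda>x. \<sigma> n x - \<sigma> m x) < \<epsilon>) \<longrightarrow>
      (\<exists>f\<in>H. (\<lambda>n. norm_of ip (\<lambda>x. \<sigma> n x - f x)) \<longlonglongrightarrow> 0))"
proof -
  interpret M: Metric_space H "\<lambda>f g. norm_of ip (\<lambda>x. f x - g x)"
    using ip_metric out by simp
  have C: "M.MCauchy \<sigma> \<longleftrightarrow> (\<forall>n. \<sigma> n \<in> H) \<and>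
      (\<forall>\<epsilon>>0. \<exists>N. \<forall>n m. N \<le> n \<longrightarrow> N \<le> m \<longrightarrow> norm_of ip (\<lambda>x. \<sigma> n x - \<sigma> m x) < \<epsilon>)" for \<sigma>
    unfolding M.MCauchy_def by (simp add: image_subset_iff)
  have L: "limitin M.mtopology \<sigma> f sequentially \<longleftrightarrow>
      f \<in> H \<and> (\<lambda>n. norm_of ip (\<lambda>x. \<sigma> n x - f x)) \<longlonglongrightarrow> 0" if "\<forall>n. \<sigma> n \<in> H" for \<sigma> f
    using that M.nonneg unfolding M.limit_metric_sequentially LIMSEQ_def by simp
  show ?thesis
    unfolding M.mcomplete_def C by (simp add: L imp_conjL Bex_def cong: imp_cong)
qed

end

text \<open>Polarization: the squared norms of all c f + g determine Re (c \<open>ip f g\<close>),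
  and the choices c = 1 and c = -i recover the real and the imaginary part.\<close>

lemma ip_eqI:
  assumes "inner_product_on H ip" "inner_product_on H ip'"
    and eq: "\<And>f. f \<in> H \<Longrightarrow> Re (ip f f) = Re (ip' f f)"
    and fg: "f \<in> H" "g \<in> H"
  shows "ip f g = ip' f g"
proof -
  have *: "Re (c * ip f g) = Re (c * ip' f g)" for c
    using ip_quad[OF assms(1) fg, of c] ip_quad[OF assms(2) fg, of c]
      eq[OF fg(1)] eq[OF fg(2)] eq[OF ip_closed[OF assms(1) fg, of c]] by simp
  show ?thesis
    using *[of 1] *[of "- \<i>"] by (simp add: complex_eq_iff)
qed

section \<open>The Hilbert space of a kernel\<close>

locale kernel_space =
  fixes \<Omega> :: "'a set" and K :: "'a \<Rightarrow> 'a \<Rightarrow> complex"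
  assumes kernel: "kernel_on \<Omega> K"
begin

text \<open>This is the inner product of \<open>comb \<Omega> K d\<close> and
  \<open>comb \<Omega> K c\<close> in the space still to be built; \<open>quad\<close> below is the
  corresponding squared norm.\<close>

definition gram :: "('a \<Rightarrow> complex) \<Rightarrow> ('a \<Rightarrow> complex) \<Rightarrow> complex" where
  "gram d c = pairing (comb \<Omega> K d) c"

definition quad :: "('a \<Rightarrow> complex) \<Rightarrow> real" where
  "quad c = Re (gram c c)"

lemma gram_self: "c \<in> finsupp \<Omega> \<Longrightarrow> 0 \<le> gram c c"
  using kernel unfolding kernel_on_iff gram_def by blast

lemma quad_nonneg: "c \<in> finsupp \<Omega> \<Longrightarrow> 0 \<le> quad c"
  using gram_self[of c] by (simp add: quad_def less_eq_complex_def)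

lemma gram_lin_left:
  assumes "c \<in> finsupp \<Omega>" "d \<in> finsupp \<Omega>"
  shows "gram (\<lambda>x. a * c x + d x) e = a * gram c e + gram d e"
  unfolding gram_def comb_lin[OF assms] by (rule pairing_lin_left)

lemma gram_lin_right:
  assumes "c \<in> finsupp \<Omega>" "d \<in> finsupp \<Omega>"
  shows "gram e (\<lambda>x. a * c x + d x) = cnj a * gram e c + gram e d"
  unfolding gram_def by (rule pairing_lin_right[OF assms])

lemma gram_lin:
  assumes "c \<in> finsupp \<Omega>" "d \<in> finsupp \<Omega>"
  shows "gram (\<lambda>x. a * c x + d x) (\<lambda>x. a * c x + d x)
       = (cmod a)\<^sup>2 * gram c c + (a * gram c d + cnj a * gram d c) + gram d d"
  unfolding gram_lin_left[OF assms] gram_lin_right[OF assms] complex_norm_square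
  by (simp add: algebra_simps)

text \<open>Symmetry is not assumed of a kernel. It follows because all values
  \<open>gram e e\<close> are real: expanding at a c + d with a = 1 compares the imaginary parts,
  with a = i the real parts.\<close>

lemma gram_hermitian:
  assumes "c \<in> finsupp \<Omega>" "d \<in> finsupp \<Omega>"
  shows "gram d c = cnj (gram c d)"
proof -
  have real: "Im (gram e e) = 0" if "e \<in> finsupp \<Omega>" for e
    using gram_self[OF that] by (simp add: less_eq_complex_def)
  have "Im (a * gram c d + cnj a * gram d c) = 0" for a
    using gram_lin[OF assms, of a] real[OF finsupp_lin[OF assms, of a]] real[OF assms(1)]
      real[OF assms(2)] by simp
  from this[of 1] this[of \<i>] show ?thesis
    by (simp add: complex_eq_iff)
qed

lemma quad_lin:
  assumes "c \<in> finsupp \<Omega>" "d \<in> finsupp \<Omega>"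
  shows "quad (\<lambda>x. a * c x + d x) = (cmod a)\<^sup>2 * quad c + 2 * Re (a * gram c d) + quad d"
  unfolding quad_def gram_lin[OF assms] by (simp add: gram_hermitian[OF assms])

lemma quad_zero: "quad (\<lambda>_. 0) = 0"
  by (simp add: quad_def gram_def pairing_zero_right)

lemma quad_scale:
  assumes "c \<in> finsupp \<Omega>"
  shows "quad (\<lambda>x. a * c x) = (cmod a)\<^sup>2 * quad c"
  using quad_lin[OF assms finsupp_zero, of a] by (simp add: quad_zero gram_def pairing_zero_right)

lemma quad_add:
  assumes "c \<in> finsupp \<Omega>" "d \<in> finsupp \<Omega>"
  shows "quad (\<lambda>x. c x + d x) = quad c + 2 * Re (gram d c) + quad d"
  using quad_lin[OF assms, of 1] by (simp add: gram_hermitian[OF assms])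

lemma quad_diff:
  assumes "c \<in> finsupp \<Omega>" "d \<in> finsupp \<Omega>"
  shows "quad (\<lambda>x. c x - d x) = quad c - 2 * Re (gram d c) + quad d"
  using quad_lin[OF assms(2,1), of "-1"] by simp

text \<open>The squared norm of \<open>f\<close> is the supremum of
  \<open>\<parallel>f\<parallel>\<^sup>2 - \<parallel>f - comb \<Omega> K c\<parallel>\<^sup>2\<close> over \<open>c\<close>, a quantity that needs only point evaluations of \<open>f\<close>. Hence
  density of the span of the kernel functions is built into the definition.\<close>

definition obj :: "('a \<Rightarrow> complex) \<Rightarrow> ('a \<Rightarrow> complex) \<Rightarrow> real" where
  "obj f c = 2 * Re (pairing f c) - quad c"

definition hspace :: "('a \<Rightarrow> complex) set" where
  "hspace = {f. (\<forall>x. x \<notin> \<Omega> \<longrightarrow> f x = 0) \<and> bdd_above (obj f ` finsupp \<Omega>)}"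

definition nrm2 :: "('a \<Rightarrow> complex) \<Rightarrow> real" where
  "nrm2 f = (SUP c\<in>finsupp \<Omega>. obj f c)"

abbreviation nrm :: "('a \<Rightarrow> complex) \<Rightarrow> real" where
  "nrm f \<equiv> sqrt (nrm2 f)"

lemma hspaceI:
  assumes "\<And>x. x \<notin> \<Omega> \<Longrightarrow> f x = 0" "\<And>c. c \<in> finsupp \<Omega> \<Longrightarrow> obj f c \<le> M"
  shows "f \<in> hspace"
  unfolding hspace_def using assms by (auto intro!: bdd_aboveI[of _ M])

lemma hspace_outside: "f \<in> hspace \<Longrightarrow> x \<notin> \<Omega> \<Longrightarrow> f x = 0"
  by (simp add: hspace_def)

lemma obj_le_nrm2: "f \<in> hspace \<Longrightarrow> c \<in> finsupp \<Omega> \<Longrightarrow> obj f c \<le> nrm2 f"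
  unfolding hspace_def nrm2_def by (intro cSUP_upper) auto

lemma nrm2_le:
  assumes "\<And>c. c \<in> finsupp \<Omega> \<Longrightarrow> obj f c \<le> M"
  shows "nrm2 f \<le> M"
  unfolding nrm2_def using assms finsupp_zero by (intro cSUP_least) auto

lemma nrm2_nonneg: "f \<in> hspace \<Longrightarrow> 0 \<le> nrm2 f"
  using obj_le_nrm2[OF _ finsupp_zero, of f] by (simp add: obj_def pairing_zero_right quad_zero)

lemma nrm_sq: "f \<in> hspace \<Longrightarrow> (nrm f)\<^sup>2 = nrm2 f"
  by (simp add: nrm2_nonneg)

lemma obj_shift:
  assumes "c \<in> finsupp \<Omega>" "d \<in> finsupp \<Omega>"
  shows "obj (\<lambda>x. f x - comb \<Omega> K d x) c = obj f (\<lambda>x. c x + d x) - obj f d"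
  using quad_add[OF assms] pairing_lin_right[OF assms, of f 1]
  by (simp add: obj_def pairing_diff_left gram_def)

text \<open>Subtracting a combination from \<open>f\<close> translates the variable of the objective
  and lowers it by the constant \<open>obj f d\<close>. The suprema therefore differ by exactly this
  constant, so \<open>obj f d\<close> measures how well \<open>comb \<Omega> K d\<close>
  approximates \<open>f\<close>.\<close>

lemma
  assumes "f \<in> hspace" "d \<in> finsupp \<Omega>"
  shows hspace_shift: "(\<lambda>x. f x - comb \<Omega> K d x) \<in> hspace"
    and nrm2_shift: "nrm2 (\<lambda>x. f x - comb \<Omega> K d x) = nrm2 f - obj f d"
proof -
  have le: "obj (\<lambda>x. f x - comb \<Omega> K d x) c \<le> nrm2 f - obj f d" if "c \<in> finsupp \<Omega>" for c
    using obj_shift[OF that assms(2)] obj_le_nrm2[OF assms(1) finsupp_add[OF that assms(2)]] by simp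
  show h: "(\<lambda>x. f x - comb \<Omega> K d x) \<in> hspace"
    using le by (intro hspaceI) (auto simp: comb_def hspace_outside[OF assms(1)])
  show "nrm2 (\<lambda>x. f x - comb \<Omega> K d x) = nrm2 f - obj f d"
  proof (rule antisym)
    have "nrm2 f \<le> nrm2 (\<lambda>x. f x - comb \<Omega> K d x) + obj f d"
    proof (rule nrm2_le)
      fix c assume c: "c \<in> finsupp \<Omega>"
      show "obj f c \<le> nrm2 (\<lambda>x. f x - comb \<Omega> K d x) + obj f d"
        using obj_le_nrm2[OF h finsupp_diff[OF c assms(2)]]
          obj_shift[OF finsupp_diff[OF c assms(2)] assms(2), of f] by simp
    qed
    then show "nrm2 f - obj f d \<le> nrm2 (\<lambda>x. f x - comb \<Omega> K d x)" by simp
  qed (use le in \<open>rule nrm2_le\<close>)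
qed

text \<open>Completing the square writes the objective of a combination as \<open>quad d\<close>
  minus the squared norm of the difference, so the supremum is attained at \<open>d\<close>
  itself.\<close>

lemma
  assumes "d \<in> finsupp \<Omega>"
  shows hspace_comb: "comb \<Omega> K d \<in> hspace" and nrm2_comb: "nrm2 (comb \<Omega> K d) = quad d"
proof -
  have eq: "obj (comb \<Omega> K d) c = quad d - quad (\<lambda>x. c x - d x)" if "c \<in> finsupp \<Omega>" for c
    using quad_diff[OF that assms] by (simp add: obj_def gram_def)
  have le: "obj (comb \<Omega> K d) c \<le> quad d" if "c \<in> finsupp \<Omega>" for c
    using eq[OF that] quad_nonneg[OF finsupp_diff[OF that assms]] by simp
  show h: "comb \<Omega> K d \<in> hspace"
    using le by (intro hspaceI) (auto simp: comb_def)
  show "nrm2 (comb \<Omega> K d) = quad d"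
    using nrm2_le[of "comb \<Omega> K d" "quad d"] le obj_le_nrm2[OF h assms] eq[OF assms] quad_zero
    by fastforce
qed

text \<open>Cauchy-Schwarz between a function known by its values and a combination. The multiples
  of \<open>c\<close> with phase aligned to \<open>pairing f c\<close> turn the bound on the
  objective into a real quadratic polynomial that is nonnegative everywhere.\<close>

lemma pairing_le:
  assumes "f \<in> hspace" "c \<in> finsupp \<Omega>"
  shows "cmod (pairing f c) \<le> nrm f * sqrt (quad c)"
proof -
  have "(cmod (pairing f c))\<^sup>2 \<le> nrm2 f * quad c"
  proof (cases "pairing f c = 0")
    case True
    then show ?thesis using nrm2_nonneg[OF assms(1)] quad_nonneg[OF assms(2)] by simp
  next
    case False
    show ?thesis
    proof (rule discriminant_le)
      fix t :: real
      define u where "u = t * sgn (pairing f c)"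
      have "cnj u * pairing f c = complex_of_real t * (cnj (sgn (pairing f c)) * pairing f c)"
        by (simp add: u_def)
      also have "\<dots> = complex_of_real (t * cmod (pairing f c))"
        by (simp only: cnj_sgn_mult of_real_mult)
      finally have "Re (cnj u * pairing f c) = t * cmod (pairing f c)" by simp
      moreover have "cmod u = \<bar>t\<bar>"
        using False by (simp add: u_def norm_mult norm_sgn)
      ultimately show "0 \<le> t\<^sup>2 * quad c - 2 * t * cmod (pairing f c) + nrm2 f"
        using obj_le_nrm2[OF assms(1) finsupp_mult[OF assms(2), of "\<lambda>_. u"]]
        by (simp add: obj_def quad_scale[OF assms(2)] pairing_scale_right[OF assms(2)])
    qed (rule quad_nonneg[OF assms(2)])
  qed
  then have "cmod (pairing f c) \<le> sqrt (nrm2 f * quad c)"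
    by (intro real_le_rsqrt)
  then show ?thesis by (simp add: real_sqrt_mult)
qed

text \<open>With M the right-hand side of the triangle inequality and s the norm of the test
  combination, Cauchy-Schwarz bounds the objective by 2 M s - s^2, which is at most M^2.\<close>

lemma
  assumes f: "f \<in> hspace" and h: "h \<in> hspace"
  shows hspace_lin: "(\<lambda>x. a * f x + h x) \<in> hspace"
    and nrm_lin: "nrm (\<lambda>x. a * f x + h x) \<le> cmod a * nrm f + nrm h"
proof -
  let ?M = "cmod a * nrm f + nrm h"
  have M: "0 \<le> ?M" using f h nrm2_nonneg by simp
  have le: "obj (\<lambda>x. a * f x + h x) c \<le> ?M\<^sup>2" if c: "c \<in> finsupp \<Omega>" for c
  proof -
    have "Re (pairing (\<lambda>x. a * f x + h x) c) \<le> cmod (a * pairing f c + pairing h c)"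
      by (metis complex_Re_le_cmod pairing_lin_left)
    also have "\<dots> \<le> cmod a * cmod (pairing f c) + cmod (pairing h c)"
      by (metis norm_mult norm_triangle_ineq)
    also have "\<dots> \<le> cmod a * (nrm f * sqrt (quad c)) + nrm h * sqrt (quad c)"
      by (intro add_mono mult_left_mono pairing_le f h c) auto
    finally have "Re (pairing (\<lambda>x. a * f x + h x) c) \<le> ?M * sqrt (quad c)"
      by (simp add: algebra_simps)
    moreover have "2 * (?M * sqrt (quad c)) \<le> ?M\<^sup>2 + (sqrt (quad c))\<^sup>2"
      using sum_squares_bound[of ?M "sqrt (quad c)"] by (simp only: mult.assoc)
    moreover have "(sqrt (quad c))\<^sup>2 = quad c"
      using quad_nonneg[OF c] by simp
    ultimately show ?thesis unfolding obj_def by linarith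
  qed
  show h: "(\<lambda>x. a * f x + h x) \<in> hspace"
    using le by (rule hspaceI[rotated]) (simp_all add: hspace_outside f h)
  have "nrm2 (\<lambda>x. a * f x + h x) \<le> ?M\<^sup>2" using le by (rule nrm2_le)
  then show "nrm (\<lambda>x. a * f x + h x) \<le> ?M"
    using M by (rule real_le_lsqrt[rotated 1, OF _])
qed

lemma hspace_zero: "(\<lambda>_. 0) \<in> hspace"
  using hspace_comb[OF finsupp_zero] by (simp add: comb_zero)

lemma hspace_diff: "f \<in> hspace \<Longrightarrow> h \<in> hspace \<Longrightarrow> (\<lambda>x. f x - h x) \<in> hspace"
  using hspace_lin[of h f "-1"] by simp

lemma nrm_diff_le: "f \<in> hspace \<Longrightarrow> h \<in> hspace \<Longrightarrow> nrm (\<lambda>x. f x - h x) \<le> nrm f + nrm h"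
  using nrm_lin[of h f "-1"] by simp

lemma nrm_comb_diff_le:
  assumes "f \<in> hspace" "c \<in> finsupp \<Omega>" "d \<in> finsupp \<Omega>"
  shows "sqrt (quad (\<lambda>x. c x - d x))
    \<le> nrm (\<lambda>x. f x - comb \<Omega> K c x) + nrm (\<lambda>x. f x - comb \<Omega> K d x)"
  using nrm_diff_le[OF hspace_shift[OF assms(1,3)] hspace_shift[OF assms(1,2)]]
    nrm2_comb[OF finsupp_diff[OF assms(2,3)]]
  by (simp add: comb_diff[OF assms(2,3)] algebra_simps)

lemma eval_le:
  assumes "f \<in> hspace"
  shows "cmod (f x) \<le> nrm f * sqrt (quad (single x))"
proof (cases "x \<in> \<Omega>")
  case True
  then show ?thesis using pairing_le[OF assms single_finsupp[OF True]] by (simp add: pairing_single)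
next
  case False
  have "quad (single x) = 0"
    by (simp add: quad_def gram_def pairing_single comb_def False)
  then show ?thesis using hspace_outside[OF assms False] by simp
qed

text \<open>A coefficient function whose objective comes within e^2 of the supremum gives a
  combination closer than e to \<open>f\<close>, by the distance formula
  \<open>nrm2_shift\<close>.\<close>

lemma comb_dense:
  assumes "f \<in> hspace" "0 < e"
  shows "\<exists>c\<in>finsupp \<Omega>. nrm (\<lambda>x. f x - comb \<Omega> K c x) < e"
proof -
  have "bdd_above (obj f ` finsupp \<Omega>)" "finsupp \<Omega> \<noteq> {}"
    using assms(1) finsupp_zero by (auto simp: hspace_def)
  moreover have "nrm2 f - e\<^sup>2 < nrm2 f" using assms(2) by simp
  ultimately obtain c where c: "c \<in> finsupp \<Omega>" "nrm2 f - e\<^sup>2 < obj f c"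
    unfolding nrm2_def using less_cSUP_iff[of "finsupp \<Omega>" "obj f"] by metis
  then have "nrm2 (\<lambda>x. f x - comb \<Omega> K c x) < e\<^sup>2"
    using nrm2_shift[OF assms(1) c(1)] by simp
  then show ?thesis
    using c(1) assms(2) real_less_lsqrt by (intro bexI[of _ c]) (auto intro: real_less_lsqrt)
qed

section \<open>The inner product as a limit along approximating combinations\<close>

definition approx :: "('a \<Rightarrow> complex) \<Rightarrow> nat \<Rightarrow> 'a \<Rightarrow> complex" where
  "approx f n = (SOME c. c \<in> finsupp \<Omega> \<and> nrm (\<lambda>x. f x - comb \<Omega> K c x) < inverse (real (Suc n)))"

lemma
  assumes "f \<in> hspace"
  shows approx_finsupp: "approx f n \<in> finsupp \<Omega>"
    and approx_less: "nrm (\<lambda>x. f x - comb \<Omega> K (approx f n) x) < inverse (real (Suc n))"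
proof -
  have "\<exists>c. c \<in> finsupp \<Omega> \<and> nrm (\<lambda>x. f x - comb \<Omega> K c x) < inverse (real (Suc n))"
    using comb_dense[OF assms, of "inverse (real (Suc n))"] by auto
  from someI_ex[OF this]
  show "approx f n \<in> finsupp \<Omega>"
    "nrm (\<lambda>x. f x - comb \<Omega> K (approx f n) x) < inverse (real (Suc n))"
    unfolding approx_def by auto
qed

lemma approx_tendsto:
  assumes "f \<in> hspace"
  shows "(\<lambda>n. nrm (\<lambda>x. f x - comb \<Omega> K (approx f n) x)) \<longlonglongrightarrow> 0"
proof (rule tendsto_sandwich[OF _ _ tendsto_const LIMSEQ_inverse_real_of_nat])
  show "\<forall>\<^sub>F n in sequentially. 0 \<le> nrm (\<lambda>x. f x - comb \<Omega> K (approx f n) x)"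
    using nrm2_nonneg hspace_shift[OF assms approx_finsupp[OF assms]] by simp
  show "\<forall>\<^sub>F n in sequentially. nrm (\<lambda>x. f x - comb \<Omega> K (approx f n) x) \<le> inverse (real (Suc n))"
    using approx_less[OF assms] less_imp_le by (intro always_eventually) blast
qed

text \<open>Since the inner product of \<open>f\<close> with a combination has to be the pairing,
  continuity in the second argument leaves only this limit. The value 0 elsewhere is the convention
  of \<open>is_rkhs\<close>.\<close>

definition hip :: "('a \<Rightarrow> complex) \<Rightarrow> ('a \<Rightarrow> complex) \<Rightarrow> complex" where
  "hip f g = (if f \<in> hspace \<and> g \<in> hspace then lim (\<lambda>n. pairing f (approx g n)) else 0)"

lemma pairing_diff_right:
  assumes "c \<in> finsupp \<Omega>" "d \<in> finsupp \<Omega>"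
  shows "pairing f (\<lambda>x. c x - d x) = pairing f c - pairing f d"
  using pairing_lin_right[OF assms(2,1), of f "-1"] by simp

lemma hip_tendsto:
  assumes f: "f \<in> hspace" and g: "g \<in> hspace"
  shows "(\<lambda>n. pairing f (approx g n)) \<longlonglongrightarrow> hip f g"
proof -
  have "Cauchy (\<lambda>n. pairing f (approx g n))"
  proof (rule metric_CauchyI)
    fix e :: real assume "0 < e"
    let ?e = "\<lambda>n. nrm (\<lambda>x. g x - comb \<Omega> K (approx g n) x)"
    have "(\<lambda>n. nrm f * ?e n) \<longlonglongrightarrow> 0"
      using tendsto_mult_left[OF approx_tendsto[OF g], of "nrm f"] by simp
    then obtain N where N: "\<And>n. n \<ge> N \<Longrightarrow> nrm f * ?e n < e / 2"
      using order_tendstoD(2)[of _ 0 sequentially "e / 2"] \<open>0 < e\<close>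
      unfolding eventually_sequentially by force
    have "dist (pairing f (approx g m)) (pairing f (approx g n)) < e" if "m \<ge> N" "n \<ge> N" for m n
    proof -
      have "dist (pairing f (approx g m)) (pairing f (approx g n))
          = cmod (pairing f (\<lambda>x. approx g m x - approx g n x))"
        by (simp add: dist_norm pairing_diff_right approx_finsupp g)
      also have "\<dots> \<le> nrm f * sqrt (quad (\<lambda>x. approx g m x - approx g n x))"
        by (intro pairing_le f finsupp_diff approx_finsupp g)
      also have "\<dots> \<le> nrm f * (?e m + ?e n)"
        using f by (intro mult_left_mono nrm_comb_diff_le approx_finsupp g) (simp add: nrm2_nonneg)
      also have "\<dots> < e" using N[OF that(1)] N[OF that(2)] by (simp add: distrib_left)
      finally show ?thesis .
    qed
    then show "\<exists>N. \<forall>m\<ge>N. \<forall>n\<ge>N. dist (pairing f (approx g m)) (pairing f (approx g n)) < e" by blast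
  qed
  then show ?thesis
    using f g by (simp add: hip_def Cauchy_convergent_iff convergent_LIMSEQ_iff)
qed

text \<open>The limit defining \<open>hip\<close> treats its arguments differently: linearity in the
  first one is immediate, symmetry is not. Replacing \<open>f\<close> by its approximants as well
  changes the pairing by a null sequence and gives a Hermitian expression.\<close>

lemma gram_approx_tendsto:
  assumes f: "f \<in> hspace" and g: "g \<in> hspace"
  shows "(\<lambda>n. gram (approx f n) (approx g n)) \<longlonglongrightarrow> hip f g"
proof -
  let ?e = "\<lambda>h n. nrm (\<lambda>x. h x - comb \<Omega> K (approx h n) x)"
  have "(\<lambda>n. pairing (\<lambda>x. f x - comb \<Omega> K (approx f n) x) (approx g n)) \<longlonglongrightarrow> 0"
  proof (rule Lim_null_comparison)
    show "(\<lambda>n. ?e f n * (nrm g + ?e g n)) \<longlonglongrightarrow> 0"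
      using tendsto_mult[OF approx_tendsto[OF f] tendsto_add[OF tendsto_const approx_tendsto[OF g]]]
      by simp
    have "cmod (pairing (\<lambda>x. f x - comb \<Omega> K (approx f n) x) (approx g n))
        \<le> ?e f n * (nrm g + ?e g n)" for n
    proof -
      have "sqrt (quad (approx g n)) \<le> nrm g + ?e g n"
        using nrm_diff_le[OF g hspace_shift[OF g approx_finsupp[OF g, of n]]]
          nrm2_comb[OF approx_finsupp[OF g, of n]] by simp
      then have "?e f n * sqrt (quad (approx g n)) \<le> ?e f n * (nrm g + ?e g n)"
        using nrm2_nonneg[OF hspace_shift[OF f approx_finsupp[OF f, of n]]]
        by (intro mult_left_mono) simp_all
      then show ?thesis
        using pairing_le[OF hspace_shift[OF f approx_finsupp[OF f, of n]] approx_finsupp[OF g, of n]]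
        by linarith
    qed
    then show "\<forall>\<^sub>F n in sequentially. cmod (pairing (\<lambda>x. f x - comb \<Omega> K (approx f n) x) (approx g n))
        \<le> ?e f n * (nrm g + ?e g n)" by simp
  qed
  from tendsto_diff[OF hip_tendsto[OF f g] this] show ?thesis
    by (simp add: gram_def pairing_diff_left)
qed

lemma hip_sym:
  assumes f: "f \<in> hspace" and g: "g \<in> hspace"
  shows "hip g f = cnj (hip f g)"
proof (rule LIMSEQ_unique[OF gram_approx_tendsto[OF g f]])
  have "gram (approx g n) (approx f n) = cnj (gram (approx f n) (approx g n))" for n
    by (rule gram_hermitian) (simp_all add: approx_finsupp f g)
  then show "(\<lambda>n. gram (approx g n) (approx f n)) \<longlonglongrightarrow> cnj (hip f g)"
    using tendsto_cnj[OF gram_approx_tendsto[OF f g]] by simp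
qed

lemma obj_approx_tendsto:
  assumes f: "f \<in> hspace"
  shows "(\<lambda>n. obj f (approx f n)) \<longlonglongrightarrow> nrm2 f"
proof -
  have "nrm2 f - (nrm (\<lambda>x. f x - comb \<Omega> K (approx f n) x))\<^sup>2 = obj f (approx f n)" for n
    using nrm_sq[OF hspace_shift[OF f approx_finsupp[OF f]], of n]
      nrm2_shift[OF f approx_finsupp[OF f], of n] by simp
  then show ?thesis
    using tendsto_diff[OF tendsto_const[of "nrm2 f"] tendsto_power[OF approx_tendsto[OF f], of 2]]
    by simp
qed

text \<open>Along the approximants of \<open>f\<close> the objective tends to its supremum
  \<open>nrm2 f\<close>. Its two terms tend to 2 Re (\<open>hip f f\<close>) and Re
  (\<open>hip f f\<close>), so their difference is the claim.\<close>

lemma hip_self: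
  assumes f: "f \<in> hspace"
  shows "hip f f = complex_of_real (nrm2 f)"
proof -
  have "(\<lambda>n. obj f (approx f n)) \<longlonglongrightarrow> 2 * Re (hip f f) - Re (hip f f)"
    unfolding obj_def quad_def
    by (intro tendsto_intros hip_tendsto gram_approx_tendsto f)
  then have "nrm2 f = Re (hip f f)"
    using LIMSEQ_unique[OF obj_approx_tendsto[OF f]] by simp
  moreover have "Im (hip f f) = 0"
    using hip_sym[OF f f] by (simp add: complex_eq_iff)
  ultimately show ?thesis by (simp add: complex_eq_iff)
qed

lemma hip_comb:
  assumes f: "f \<in> hspace" and c: "c \<in> finsupp \<Omega>"
  shows "hip f (comb \<Omega> K c) = pairing f c"
proof -
  let ?g = "comb \<Omega> K c"
  have g: "?g \<in> hspace" by (rule hspace_comb[OF c])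
  have "(\<lambda>n. pairing f (approx ?g n) - pairing f c) \<longlonglongrightarrow> 0"
  proof (rule Lim_null_comparison)
    show "(\<lambda>n. nrm f * nrm (\<lambda>x. ?g x - comb \<Omega> K (approx ?g n) x)) \<longlonglongrightarrow> 0"
      using tendsto_mult_left[OF approx_tendsto[OF g], of "nrm f"] by simp
    have "cmod (pairing f (approx ?g n) - pairing f c)
        \<le> nrm f * nrm (\<lambda>x. ?g x - comb \<Omega> K (approx ?g n) x)" for n
    proof -
      have "nrm2 (\<lambda>x. ?g x - ?g x) = 0"
        using nrm2_comb[OF finsupp_zero] by (simp add: comb_zero quad_zero)
      then have "nrm f * sqrt (quad (\<lambda>x. approx ?g n x - c x))
          \<le> nrm f * nrm (\<lambda>x. ?g x - comb \<Omega> K (approx ?g n) x)"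
        using nrm_comb_diff_le[OF g approx_finsupp[OF g] c, of n] nrm2_nonneg[OF f]
        by (intro mult_left_mono) simp_all
      then show ?thesis
        using pairing_le[OF f finsupp_diff[OF approx_finsupp[OF g] c], of n]
          pairing_diff_right[OF approx_finsupp[OF g] c, of f n] by simp
    qed
    then show "\<forall>\<^sub>F n in sequentially. cmod (pairing f (approx ?g n) - pairing f c)
        \<le> nrm f * nrm (\<lambda>x. ?g x - comb \<Omega> K (approx ?g n) x)" by simp
  qed
  then have "(\<lambda>n. pairing f (approx ?g n)) \<longlonglongrightarrow> pairing f c"
    using LIM_zero_iff by blast
  then show ?thesis using hip_tendsto[OF f g] LIMSEQ_unique by blast
qed

lemma hip_inner_product: "inner_product_on hspace hip"
  unfolding inner_product_on_def
proof (intro conjI ballI allI)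
  fix f g h c assume fgh: "f \<in> hspace" "g \<in> hspace" "h \<in> hspace"
  have "(\<lambda>n. pairing (\<lambda>x. c * f x + g x) (approx h n)) \<longlonglongrightarrow> c * hip f h + hip g h"
    unfolding pairing_lin_left by (intro tendsto_intros hip_tendsto fgh)
  then show "hip (\<lambda>x. c * f x + g x) h = c * hip f h + hip g h"
    using hip_tendsto[OF hspace_lin[OF fgh(1,2), of c] fgh(3)] LIMSEQ_unique by blast
next
  fix f assume f: "f \<in> hspace"
  then show "0 \<le> hip f f" by (simp add: hip_self nrm2_nonneg less_eq_complex_def)
  show "hip f f = 0 \<longrightarrow> f = (\<lambda>_. 0)"
    using eval_le[OF f] by (auto simp: hip_self[OF f])
next
  show "(\<lambda>_. 0) \<in> hspace" by (rule hspace_zero)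
next
  fix f g c assume "f \<in> hspace" "g \<in> hspace"
  then show "(\<lambda>x. c * f x + g x) \<in> hspace" by (rule hspace_lin)
next
  fix f g assume "f \<in> hspace" "g \<in> hspace"
  then show "hip g f = cnj (hip f g)" by (rule hip_sym)
qed

section \<open>Completeness\<close>

lemma norm_of_hip: "f \<in> hspace \<Longrightarrow> norm_of hip f = nrm f"
  by (simp add: norm_of_def hip_self)

text \<open>Point evaluations are bounded, so a Cauchy sequence converges pointwise. For a fixed
  \<open>c\<close> the objective involves only finitely many values and passes to the pointwise
  limit; a bound uniform in \<open>c\<close> then bounds the norm of the tail.\<close>

lemma hspace_complete: "Metric_space.mcomplete hspace (\<lambda>f g. norm_of hip (\<lambda>x. f x - g x))"
proof (subst mcomplete_iff[OF hip_inner_product])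
  show "hip f g = 0" if "f \<notin> hspace \<or> g \<notin> hspace" for f g using that by (auto simp: hip_def)
  show "\<forall>\<sigma>. (\<forall>n. \<sigma> n \<in> hspace) \<longrightarrow>
      (\<forall>\<epsilon>>0. \<exists>N. \<forall>n m. N \<le> n \<longrightarrow> N \<le> m \<longrightarrow> norm_of hip (\<lambda>x. \<sigma> n x - \<sigma> m x) < \<epsilon>) \<longrightarrow>
      (\<exists>f\<in>hspace. (\<lambda>n. norm_of hip (\<lambda>x. \<sigma> n x - f x)) \<longlonglongrightarrow> 0)"
  proof (intro allI impI)
    fix \<sigma> :: "nat \<Rightarrow> 'a \<Rightarrow> complex"
    assume \<sigma>: "\<forall>n. \<sigma> n \<in> hspace"
      and "\<forall>\<epsilon>>0. \<exists>N. \<forall>n m. N \<le> n \<longrightarrow> N \<le> m \<longrightarrow> norm_of hip (\<lambda>x. \<sigma> n x - \<sigma> m x) < \<epsilon>"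
    then have C: "\<exists>N. \<forall>n m. N \<le> n \<longrightarrow> N \<le> m \<longrightarrow> nrm (\<lambda>x. \<sigma> n x - \<sigma> m x) < \<epsilon>" if "0 < \<epsilon>" for \<epsilon>
      using that by (simp add: norm_of_hip hspace_diff)
    have "Cauchy (\<lambda>n. \<sigma> n x)" for x
    proof (rule metric_CauchyI)
      fix e :: real assume "0 < e"
      \<comment> \<open>The added 1 keeps the divisor in \<open>e / q\<close> positive when the
        kernel vanishes at (x, x).\<close>
      define q where "q = sqrt (quad (single x)) + 1"
      have q: "0 < q" "sqrt (quad (single x)) \<le> q"
      proof -
        have "0 \<le> quad (single x)"
        proof (cases "x \<in> \<Omega>")
          case True
          then show ?thesis by (simp add: quad_nonneg single_finsupp)
        qed (simp add: quad_def gram_def pairing_single comb_def)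
        then show "0 < q" "sqrt (quad (single x)) \<le> q" by (simp_all add: q_def add_nonneg_pos)
      qed
      obtain N where N: "\<And>n m. N \<le> n \<Longrightarrow> N \<le> m \<Longrightarrow> nrm (\<lambda>x. \<sigma> n x - \<sigma> m x) < e / q"
        using C[of "e / q"] \<open>0 < e\<close> q by auto
      have "dist (\<sigma> m x) (\<sigma> n x) < e" if "N \<le> m" "N \<le> n" for m n
      proof -
        have d: "(\<lambda>x. \<sigma> m x - \<sigma> n x) \<in> hspace" using \<sigma> by (simp add: hspace_diff)
        have "cmod (\<sigma> m x - \<sigma> n x) \<le> nrm (\<lambda>x. \<sigma> m x - \<sigma> n x) * sqrt (quad (single x))"
          using eval_le[OF d, of x] by simp
        also have "\<dots> \<le> nrm (\<lambda>x. \<sigma> m x - \<sigma> n x) * q"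
          using q nrm2_nonneg[OF d] by (intro mult_left_mono) auto
        also have "\<dots> < e" using N[OF that] q by (simp add: field_simps)
        finally show ?thesis by (simp add: dist_norm)
      qed
      then show "\<exists>M. \<forall>m\<ge>M. \<forall>n\<ge>M. dist (\<sigma> m x) (\<sigma> n x) < e" by blast
    qed
    then have "\<forall>x. \<exists>l. (\<lambda>n. \<sigma> n x) \<longlonglongrightarrow> l"
      by (simp add: Cauchy_convergent_iff convergent_def)
    then obtain f where f: "\<And>x. (\<lambda>n. \<sigma> n x) \<longlonglongrightarrow> f x" by metis
    have f0: "f x = 0" if "x \<notin> \<Omega>" for x
      using f[of x] \<sigma> that by (simp add: hspace_outside LIMSEQ_const_iff)
    have tail: "(\<lambda>x. \<sigma> n x - f x) \<in> hspace \<and> nrm (\<lambda>x. \<sigma> n x - f x) \<le> e"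
      if "0 < e" and N: "\<And>m. N \<le> m \<Longrightarrow> nrm (\<lambda>x. \<sigma> n x - \<sigma> m x) < e" for n N e
    proof -
      have le: "obj (\<lambda>x. \<sigma> n x - f x) c \<le> e\<^sup>2" if c: "c \<in> finsupp \<Omega>" for c
      proof (rule LIMSEQ_le_const2)
        show "(\<lambda>m. obj (\<lambda>x. \<sigma> n x - \<sigma> m x) c) \<longlonglongrightarrow> obj (\<lambda>x. \<sigma> n x - f x) c"
          unfolding obj_def pairing_def by (intro tendsto_intros f)
        have "obj (\<lambda>x. \<sigma> n x - \<sigma> m x) c \<le> e\<^sup>2" if "N \<le> m" for m
        proof -
          have d: "(\<lambda>x. \<sigma> n x - \<sigma> m x) \<in> hspace" using \<sigma> by (simp add: hspace_diff)
          have "(nrm (\<lambda>x. \<sigma> n x - \<sigma> m x))\<^sup>2 \<le> e\<^sup>2"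
            using N[OF that] nrm2_nonneg[OF d] by (intro power_mono) auto
          then show ?thesis using obj_le_nrm2[OF d c] nrm_sq[OF d] by linarith
        qed
        then show "\<exists>N. \<forall>m\<ge>N. obj (\<lambda>x. \<sigma> n x - \<sigma> m x) c \<le> e\<^sup>2" by blast
      qed
      have "nrm2 (\<lambda>x. \<sigma> n x - f x) \<le> e\<^sup>2" using le by (rule nrm2_le)
      then have "nrm (\<lambda>x. \<sigma> n x - f x) \<le> e"
        using \<open>0 < e\<close> by (simp add: real_le_lsqrt)
      moreover have "(\<lambda>x. \<sigma> n x - f x) \<in> hspace"
      proof (rule hspaceI)
        show "\<sigma> n x - f x = 0" if "x \<notin> \<Omega>" for x
          using f0[OF that] hspace_outside[OF \<sigma>[rule_format] that] by simp
      qed (rule le)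
      ultimately show ?thesis by blast
    qed
    obtain N where "\<And>n m. N \<le> n \<Longrightarrow> N \<le> m \<Longrightarrow> nrm (\<lambda>x. \<sigma> n x - \<sigma> m x) < 1"
      using C[of 1] by auto
    then have "(\<lambda>x. \<sigma> N x - f x) \<in> hspace" using tail[of 1 N N] by simp
    then have fh: "f \<in> hspace"
      using hspace_diff[of "\<sigma> N" "\<lambda>x. \<sigma> N x - f x"] \<sigma> by simp
    have "(\<lambda>n. norm_of hip (\<lambda>x. \<sigma> n x - f x)) \<longlonglongrightarrow> 0"
    proof (rule LIMSEQ_I)
      fix r :: real assume "0 < r"
      obtain N where N: "\<And>n m. N \<le> n \<Longrightarrow> N \<le> m \<Longrightarrow> nrm (\<lambda>x. \<sigma> n x - \<sigma> m x) < r / 2"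
        using C[of "r / 2"] \<open>0 < r\<close> by auto
      have "norm (norm_of hip (\<lambda>x. \<sigma> n x - f x) - 0) < r" if "N \<le> n" for n
      proof -
        have d: "(\<lambda>x. \<sigma> n x - f x) \<in> hspace" using \<sigma> fh by (simp add: hspace_diff)
        have "nrm (\<lambda>x. \<sigma> n x - f x) \<le> r / 2"
          using tail[of "r / 2" N n] N[OF that] \<open>0 < r\<close> by simp
        then show ?thesis
          using nrm2_nonneg[OF d] \<open>0 < r\<close> by (simp add: norm_of_hip[OF d])
      qed
      then show "\<exists>N. \<forall>n\<ge>N. norm (norm_of hip (\<lambda>x. \<sigma> n x - f x) - 0) < r" by blast
    qed
    with fh show "\<exists>f\<in>hspace. (\<lambda>n. norm_of hip (\<lambda>x. \<sigma> n x - f x)) \<longlonglongrightarrow> 0" by blast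
  qed
qed

section \<open>Identification with the space given by \<open>rkhs\<close>\<close>

lemma is_rkhs_hspace: "is_rkhs \<Omega> K hspace hip"
  unfolding is_rkhs_def
proof (intro conjI ballI allI impI)
  show "hip f g = 0" if "f \<notin> hspace \<or> g \<notin> hspace" for f g using that by (auto simp: hip_def)
  fix y assume y: "y \<in> \<Omega>"
  show "(\<lambda>x. if x \<in> \<Omega> then K x y else 0) \<in> hspace"
    using hspace_comb[OF single_finsupp[OF y]] by (simp add: comb_single)
  show "hip f (\<lambda>x. if x \<in> \<Omega> then K x y else 0) = f y" if "f \<in> hspace" for f
    using hip_comb[OF that single_finsupp[OF y]] by (simp add: comb_single pairing_single)
qed (simp_all add: hspace_outside hip_inner_product hspace_complete)

text \<open>In any reproducing kernel Hilbert space the squared distance from \<open>f\<close> to a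
  combination is the squared norm of \<open>f\<close> minus \<open>obj f c\<close>. Its positivity
  bounds the objective, so \<open>H\<close> lies in \<open>hspace\<close>. Conversely, combinations
  have the same norm in both spaces, so the approximants of an element of \<open>hspace\<close> are
  Cauchy in \<open>H\<close>, and continuity of evaluation identifies their limit there. Equal norms
  give equal inner products by polarization.\<close>

theorem rkhs_unique:
  assumes rk: "is_rkhs \<Omega> K H ip"
  shows "H = hspace" and "ip = hip"
proof -
  note rk' = rk[unfolded is_rkhs_def]
  have out: "ip f g = 0" if "f \<notin> H \<or> g \<notin> H" for f g
    using that rk'[THEN conjunct2, THEN conjunct1] by blast
  have H0: "f x = 0" if "f \<in> H" "x \<notin> \<Omega>" for f x
    using that rk'[THEN conjunct1] by blast
  have IP: "inner_product_on H ip"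
    by (rule rk'[THEN conjunct2, THEN conjunct2, THEN conjunct1])
  have cpl: "Metric_space.mcomplete H (\<lambda>f g. norm_of ip (\<lambda>x. f x - g x))"
    by (rule rk'[THEN conjunct2, THEN conjunct2, THEN conjunct2, THEN conjunct1])
  have kmem: "comb \<Omega> K (single y) \<in> H" if "y \<in> \<Omega>" for y
    unfolding comb_single using that rk'[THEN conjunct2, THEN conjunct2, THEN conjunct2, THEN conjunct2]
    by blast
  have krep: "ip f (comb \<Omega> K (single y)) = f y" if "y \<in> \<Omega>" "f \<in> H" for y f
    unfolding comb_single using that rk'[THEN conjunct2, THEN conjunct2, THEN conjunct2, THEN conjunct2]
    by blast
  have comb: "comb \<Omega> K c \<in> H \<and> (\<forall>f\<in>H. ip f (comb \<Omega> K c) = pairing f c)"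
    if c: "c \<in> finsupp \<Omega>" for c
  proof -
    have "finite S \<Longrightarrow> S \<subseteq> \<Omega> \<Longrightarrow> (\<And>x. x \<notin> S \<Longrightarrow> c x = 0) \<Longrightarrow> ?thesis" for S
    proof (induction S arbitrary: c rule: finite_induct)
      case empty
      then have "c = (\<lambda>_. 0)" by auto
      moreover have "ip f (\<lambda>_. 0) = 0" if "f \<in> H" for f
        using ip_sym[OF IP ip_zero[OF IP] that] ip_zero_left[OF IP that] by simp
      ultimately show ?case
        using ip_zero[OF IP] by (simp add: comb_zero pairing_zero_right)
    next
      case (insert y S)
      define d where "d = c(y := 0)"
      have d: "d \<in> finsupp \<Omega>"
        using insert by (intro finsuppI[of S]) (auto simp: d_def)
      have IH: "comb \<Omega> K d \<in> H \<and> (\<forall>f\<in>H. ip f (comb \<Omega> K d) = pairing f d)"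
        using insert by (intro insert.IH) (auto simp: d_def)
      have y: "y \<in> \<Omega>" using insert by simp
      have ceq: "c = (\<lambda>x. c y * single y x + d x)"
        by (auto simp: d_def single_def)
      have ccomb: "comb \<Omega> K c = (\<lambda>x. c y * comb \<Omega> K (single y) x + comb \<Omega> K d x)"
        by (subst ceq) (rule comb_lin[OF single_finsupp[OF y] d])
      have "ip f (comb \<Omega> K c) = pairing f c" if "f \<in> H" for f
      proof -
        have "pairing f c = cnj (c y) * pairing f (single y) + pairing f d"
          by (subst ceq) (rule pairing_lin_right[OF single_finsupp[OF y] d])
        then show ?thesis
          using ip_lin_right[OF IP kmem[OF y] conjunct1[OF IH] that, of "c y"] IH krep[OF y that] that
          by (simp add: ccomb pairing_single)
      qed
      then show ?case
        using ip_closed[OF IP kmem[OF y] conjunct1[OF IH], of "c y"] by (simp add: ccomb)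
    qed
    from this[OF finsupp_finite[OF c] finsupp_subset[OF c]] show ?thesis by simp
  qed
  have dist: "Re (ip (\<lambda>x. f x - comb \<Omega> K c x) (\<lambda>x. f x - comb \<Omega> K c x)) = Re (ip f f) - obj f c"
    if "f \<in> H" "c \<in> finsupp \<Omega>" for f c
    using ip_diff_quad[OF IP that(1) conjunct1[OF comb[OF that(2)]]] comb[OF that(2)] that(1)
    by (simp add: obj_def quad_def gram_def)
  have sub: "f \<in> hspace" if f: "f \<in> H" for f
  proof (rule hspaceI)
    fix c assume c: "c \<in> finsupp \<Omega>"
    show "obj f c \<le> Re (ip f f)"
      using dist[OF f c] ip_pos[OF IP ip_diff_closed[OF IP f conjunct1[OF comb[OF c]]]] by simp
  qed (rule H0[OF f])
  have sup: "f \<in> H" "Re (ip f f) \<le> nrm2 f" if f: "f \<in> hspace" for f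
  proof -
    let ?s = "\<lambda>n. comb \<Omega> K (approx f n)"
    let ?e = "\<lambda>n. nrm (\<lambda>x. f x - ?s n x)"
    note ap = approx_finsupp[OF f]
    have sH: "?s n \<in> H" for n using comb[OF ap] by blast
    have "norm_of ip (\<lambda>x. ?s n x - ?s m x) \<le> ?e n + ?e m" for n m
      using nrm_comb_diff_le[OF f ap ap, of n m] comb[OF finsupp_diff[OF ap[of n] ap[of m]]]
      by (simp add: norm_of_def quad_def gram_def comb_diff[OF ap ap])
    moreover have "\<exists>N. \<forall>n m. N \<le> n \<longrightarrow> N \<le> m \<longrightarrow> ?e n + ?e m < \<epsilon>" if "0 < \<epsilon>" for \<epsilon>
    proof -
      have "\<forall>\<^sub>F n in sequentially. ?e n < \<epsilon> / 2"
        by (rule order_tendstoD(2)[OF approx_tendsto[OF f]]) (use that in simp)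
      then obtain N where N: "\<And>n. n \<ge> N \<Longrightarrow> ?e n < \<epsilon> / 2"
        unfolding eventually_sequentially by blast
      have "?e n + ?e m < \<epsilon>" if "N \<le> n" "N \<le> m" for n m
        using N[OF that(1)] N[OF that(2)] by simp
      then show ?thesis by blast
    qed
    ultimately have cau: "\<forall>\<epsilon>>0. \<exists>N. \<forall>n m. N \<le> n \<longrightarrow> N \<le> m \<longrightarrow> norm_of ip (\<lambda>x. ?s n x - ?s m x) < \<epsilon>"
      by (meson order_le_less_trans)
    from mp[OF mp[OF spec[OF iffD1[OF mcomplete_iff[OF IP out] cpl]] allI[OF sH]] cau]
    obtain g where g: "g \<in> H" and lim: "(\<lambda>n. norm_of ip (\<lambda>x. ?s n x - g x)) \<longlonglongrightarrow> 0"
      by blast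
    have "f x = g x" for x
    proof (cases "x \<in> \<Omega>")
      case True
      have "(\<lambda>n. ?s n x - g x) \<longlonglongrightarrow> 0"
      proof (rule Lim_null_comparison)
        let ?k = "comb \<Omega> K (single x)"
        show "(\<lambda>n. norm_of ip (\<lambda>x. ?s n x - g x) * norm_of ip ?k) \<longlonglongrightarrow> 0"
          using tendsto_mult_right[OF lim, of "norm_of ip ?k"] by simp
        have "cmod (?s n x - g x) \<le> norm_of ip (\<lambda>x. ?s n x - g x) * norm_of ip ?k" for n
          using ip_Cauchy_Schwarz[OF IP ip_diff_closed[OF IP sH[of n] g] kmem[OF True]]
            krep[OF True ip_diff_closed[OF IP sH[of n] g]] by simp
        then show "\<forall>\<^sub>F n in sequentially. cmod (?s n x - g x)
            \<le> norm_of ip (\<lambda>x. ?s n x - g x) * norm_of ip ?k" by simp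
      qed
      then have 1: "(\<lambda>n. ?s n x) \<longlonglongrightarrow> g x" using LIM_zero_iff by blast
      have "(\<lambda>n. f x - ?s n x) \<longlonglongrightarrow> 0"
      proof (rule Lim_null_comparison)
        show "(\<lambda>n. ?e n * sqrt (quad (single x))) \<longlonglongrightarrow> 0"
          using tendsto_mult_right[OF approx_tendsto[OF f], of "sqrt (quad (single x))"] by simp
        show "\<forall>\<^sub>F n in sequentially. cmod (f x - ?s n x) \<le> ?e n * sqrt (quad (single x))"
          using eval_le[OF hspace_shift[OF f ap]] by simp
      qed
      then have "(\<lambda>n. ?s n x) \<longlonglongrightarrow> f x"
        using tendsto_diff[OF tendsto_const, of _ 0 sequentially "f x"] by fastforce
      then show ?thesis using 1 LIMSEQ_unique by blast
    next
      case False
      then show ?thesis using hspace_outside[OF f] H0[OF g] by simp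
    qed
    then have "f = g" by blast
    then show fH: "f \<in> H" using g by simp
    \<comment> \<open>The right-hand side tends to 0, while the objective never exceeds
      \<open>nrm2 f\<close>. This gives the bound for the norm of \<open>H\<close> opposite to the
      one that follows from \<open>dist\<close>.\<close>
    have "Re (ip f f) - obj f (approx f n) = (norm_of ip (\<lambda>x. ?s n x - f x))\<^sup>2" for n
      using dist[OF fH ap, of n] ip_diff_quad[OF IP fH sH, of n] ip_diff_quad[OF IP sH fH, of n]
        ip_sym[OF IP fH sH, of n] norm_of_sq[OF IP ip_diff_closed[OF IP sH fH], of n] by simp
    moreover have "Re (ip f f) - obj f (approx f n) \<ge> Re (ip f f) - nrm2 f" for n
      using obj_le_nrm2[OF f ap, of n] by simp
    ultimately have "Re (ip f f) - nrm2 f \<le> (norm_of ip (\<lambda>x. ?s n x - f x))\<^sup>2" for n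
      by metis
    moreover have "(\<lambda>n. (norm_of ip (\<lambda>x. ?s n x - f x))\<^sup>2) \<longlonglongrightarrow> 0"
      using tendsto_power[OF lim, of 2] \<open>f = g\<close> by simp
    ultimately show "Re (ip f f) \<le> nrm2 f"
      using LIMSEQ_le_const[of _ 0 "Re (ip f f) - nrm2 f"] by fastforce
  qed
  show eq: "H = hspace" using sub sup by blast
  have self: "Re (ip f f) = Re (hip f f)" if f: "f \<in> H" for f
  proof -
    have fh: "f \<in> hspace" using f eq by simp
    have "obj f c \<le> Re (ip f f)" if c: "c \<in> finsupp \<Omega>" for c
      using dist[OF f c] ip_pos[OF IP ip_diff_closed[OF IP f conjunct1[OF comb[OF c]]]] by simp
    then have "nrm2 f \<le> Re (ip f f)" by (rule nrm2_le)
    moreover have "Re (ip f f) \<le> nrm2 f" by (rule sup(2)[OF fh])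
    ultimately show ?thesis by (simp add: hip_self[OF fh])
  qed
  show "ip = hip"
  proof (intro ext)
    fix f g
    show "ip f g = hip f g"
    proof (cases "f \<in> H \<and> g \<in> H")
      case True
      then show ?thesis
        using ip_eqI[OF IP, of hip f g] hip_inner_product self by (simp add: eq)
    next
      case False
      then show ?thesis using out by (auto simp: hip_def eq)
    qed
  qed
qed

lemma rkhs_eq: "rkhs \<Omega> K = (hspace, hip)"
  unfolding rkhs_def
proof (rule the_equality)
  show "case (hspace, hip) of (H, ip) \<Rightarrow> is_rkhs \<Omega> K H ip" by (simp add: is_rkhs_hspace)
  show "p = (hspace, hip)" if "case p of (H, ip) \<Rightarrow> is_rkhs \<Omega> K H ip" for p
    using that rkhs_unique by (cases p) auto
qed

lemma rkhs_space_eq: "rkhs_space \<Omega> K = hspace"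
  by (simp add: rkhs_space_def rkhs_eq)

lemma rkhs_norm_eq: "f \<in> hspace \<Longrightarrow> rkhs_norm \<Omega> K f = nrm f"
  by (simp add: rkhs_norm_def rkhs_eq norm_of_hip)

end

section \<open>Multipliers and positivity\<close>

context kernel_space
begin

lemma obj_zero: "obj f (\<lambda>_. 0) = 0"
  by (simp add: obj_def pairing_zero_right quad_zero)

text \<open>The adjoint of a contractive multiplication operator is a contraction, and it acts on
  combinations by multiplying coefficients by conjugates. In place of an adjoint operator, the
  operator is applied to the vector \<open>comb \<Omega> K d\<close> that the adjoint would produce
  from \<open>c\<close>.\<close>

lemma quad_multiplier_le:
  assumes \<Phi>: "contractive_matrix_multiplier \<Omega> K 1 1 \<Phi>" and c: "c \<in> finsupp \<Omega>"
  shows "quad (\<lambda>x. cnj (\<Phi> x $$ (0, 0)) * c x) \<le> quad c"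
proof -
  define \<phi> where "\<phi> x = \<Phi> x $$ (0, 0)" for x
  define d where "d = (\<lambda>x. cnj (\<phi> x) * c x)"
  have d: "d \<in> finsupp \<Omega>" unfolding d_def by (rule finsupp_mult[OF c])
  let ?v = "comb \<Omega> K d"
  have v: "?v \<in> hspace" by (rule hspace_comb[OF d])
  have "(\<lambda>x. \<phi> x * ?v x) \<in> hspace
      \<and> (rkhs_norm \<Omega> K (\<lambda>x. \<phi> x * ?v x))\<^sup>2 \<le> (rkhs_norm \<Omega> K ?v)\<^sup>2"
    using \<Phi> v unfolding contractive_matrix_multiplier_def \<phi>_def rkhs_space_eq
    by (elim conjE allE[of _ "\<lambda>_. ?v"]) simp
  then have \<phi>v: "(\<lambda>x. \<phi> x * ?v x) \<in> hspace" "nrm2 (\<lambda>x. \<phi> x * ?v x) \<le> quad d"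
    using v nrm_sq nrm2_comb[OF d] by (auto simp: rkhs_norm_eq nrm2_nonneg quad_nonneg d)
  have "pairing (\<lambda>x. \<phi> x * ?v x) c = pairing ?v d"
    unfolding pairing_eq[of "{x. c x \<noteq> 0}" d, OF finsupp_finite[OF c]] pairing_def
    by (subst pairing_eq[of "{x. c x \<noteq> 0}" d, OF finsupp_finite[OF c], unfolded pairing_def])
      (auto simp: d_def mult_ac)
  \<comment> \<open>The left-hand side is the objective of the product at \<open>c\<close>; it is at
    most the squared norm of the product, hence at most \<open>quad d\<close>.\<close>
  then have "2 * quad d - quad c \<le> quad d"
    using obj_le_nrm2[OF \<phi>v(1) c] \<phi>v(2) by (simp add: obj_def quad_def gram_def)
  then show ?thesis by (simp add: d_def \<phi>_def)
qed

text \<open>The converse passage, from the adjoint on combinations to the multiplier. Pairings move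
  \<Phi> from the functions to the coefficients, so the total objective of the image is at most the
  total objective of the original tuple, and suprema give the norms.\<close>

lemma contractive_matrix_multiplierI:
  assumes car: "\<And>x. x \<in> \<Omega> \<Longrightarrow> \<Phi> x \<in> carrier_mat m n"
    and le: "\<And>c. (\<And>i. i < m \<Longrightarrow> c i \<in> finsupp \<Omega>) \<Longrightarrow>
      (\<Sum>j<n. quad (\<lambda>x. \<Sum>i<m. cnj (\<Phi> x $$ (i, j)) * c i x)) \<le> (\<Sum>i<m. quad (c i))"
  shows "contractive_matrix_multiplier \<Omega> K m n \<Phi>"
  unfolding contractive_matrix_multiplier_def rkhs_space_eq
proof (intro conjI ballI allI impI)
  fix F :: "nat \<Rightarrow> 'a \<Rightarrow> complex"
  assume F: "\<forall>j<n. F j \<in> hspace"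
  define g where "g i = (\<lambda>x. \<Sum>j<n. \<Phi> x $$ (i, j) * F j x)" for i
  let ?M = "\<Sum>j<n. nrm2 (F j)"
  have key: "(\<Sum>i<m. obj (g i) (c i)) \<le> ?M" if c: "\<And>i. i < m \<Longrightarrow> c i \<in> finsupp \<Omega>" for c
  proof -
    define d where "d j = (\<lambda>x. \<Sum>i<m. cnj (\<Phi> x $$ (i, j)) * c i x)" for j
    have d: "d j \<in> finsupp \<Omega>" for j
      unfolding d_def by (intro finsupp_sum finsupp_mult c) simp
    define S where "S = (\<Union>i<m. {x. c i x \<noteq> 0})"
    have S: "finite S" "\<And>i x. i < m \<Longrightarrow> x \<notin> S \<Longrightarrow> c i x = 0"
      using c by (auto simp: S_def finsupp_def)
    have S': "d j x = 0" if "x \<notin> S" for j x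
      unfolding d_def using S(2)[OF _ that] by (intro sum.neutral) simp
    have "(\<Sum>i<m. pairing (g i) (c i)) = (\<Sum>i<m. \<Sum>x\<in>S. cnj (c i x) * g i x)"
      using S by (intro sum.cong refl pairing_eq) auto
    also have "\<dots> = (\<Sum>i<m. \<Sum>x\<in>S. \<Sum>j<n. cnj (c i x) * \<Phi> x $$ (i, j) * F j x)"
      by (simp add: g_def sum_distrib_left mult.assoc)
    also have "\<dots> = (\<Sum>i<m. \<Sum>j<n. \<Sum>x\<in>S. cnj (c i x) * \<Phi> x $$ (i, j) * F j x)"
      by (intro sum.cong refl sum.swap)
    also have "\<dots> = (\<Sum>j<n. \<Sum>i<m. \<Sum>x\<in>S. cnj (c i x) * \<Phi> x $$ (i, j) * F j x)"
      by (rule sum.swap)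
    also have "\<dots> = (\<Sum>j<n. \<Sum>x\<in>S. \<Sum>i<m. cnj (c i x) * \<Phi> x $$ (i, j) * F j x)"
      by (intro sum.cong refl sum.swap)
    also have "\<dots> = (\<Sum>j<n. \<Sum>x\<in>S. cnj (d j x) * F j x)"
      unfolding d_def cnj_sum sum_distrib_right by (simp add: mult_ac)
    also have "\<dots> = (\<Sum>j<n. pairing (F j) (d j))"
      using S S' by (intro sum.cong refl pairing_eq[symmetric]) auto
    finally have "(\<Sum>i<m. obj (g i) (c i)) = 2 * Re (\<Sum>j<n. pairing (F j) (d j)) - (\<Sum>i<m. quad (c i))"
      by (simp add: obj_def sum_subtractf flip: sum_distrib_left Re_sum)
    also have "\<dots> \<le> 2 * Re (\<Sum>j<n. pairing (F j) (d j)) - (\<Sum>j<n. quad (d j))"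
      using le[OF c] by (simp add: d_def)
    also have "\<dots> = (\<Sum>j<n. obj (F j) (d j))"
      by (simp add: obj_def sum_subtractf sum_distrib_left)
    also have "\<dots> \<le> ?M"
      using F d by (intro sum_mono obj_le_nrm2) auto
    finally show ?thesis .
  qed
  have g: "g i \<in> hspace" if i: "i < m" for i
  proof (rule hspaceI)
    show "g i x = 0" if "x \<notin> \<Omega>" for x
      using F that by (auto simp: g_def hspace_outside intro!: sum.neutral)
    fix c assume c: "c \<in> finsupp \<Omega>"
    \<comment> \<open>A tuple with a single nonzero entry isolates one component and shows that it
      belongs to the space.\<close>
    have "(\<Sum>k<m. obj (g k) (if k = i then c else (\<lambda>_. 0))) \<le> ?M"
      using c finsupp_zero by (intro key) auto
    moreover have "(\<Sum>k<m. obj (g k) (if k = i then c else (\<lambda>_. 0)))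
        = (\<Sum>k<m. if k = i then obj (g i) c else 0)"
      by (intro sum.cong) (auto simp: obj_zero)
    ultimately show "obj (g i) c \<le> ?M" using i by simp
  qed
  then show "(\<lambda>x. \<Sum>j<n. \<Phi> x $$ (i, j) * F j x) \<in> hspace" if "i < m" for i
    using that by (simp add: g_def)
  have "(\<Sum>i<m. nrm2 (g i)) \<le> ?M"
  \<comment> \<open>The bound holds for tuples of coefficient functions; approximating all
    components at once brings every summand to its own supremum.\<close>
  proof (rule LIMSEQ_le_const2)
    show "(\<lambda>N. \<Sum>i<m. obj (g i) (approx (g i) N)) \<longlonglongrightarrow> (\<Sum>i<m. nrm2 (g i))"
      using g by (intro tendsto_sum obj_approx_tendsto) auto
    show "\<exists>N. \<forall>k\<ge>N. (\<Sum>i<m. obj (g i) (approx (g i) k)) \<le> ?M"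
      by (intro exI[of _ 0] allI impI key approx_finsupp g)
  qed
  moreover have "(rkhs_norm \<Omega> K f)\<^sup>2 = nrm2 f" if "f \<in> hspace" for f
    using that by (simp add: rkhs_norm_eq nrm2_nonneg)
  ultimately show "(\<Sum>i<m. (rkhs_norm \<Omega> K (\<lambda>x. \<Sum>j<n. \<Phi> x $$ (i, j) * F j x))\<^sup>2)
      \<le> (\<Sum>j<n. (rkhs_norm \<Omega> K (F j))\<^sup>2)"
    using g F by (simp add: g_def)
qed (rule car)

section \<open>Schur complements and factorization of finite kernels\<close>

lemma kernel_hermitian: "x \<in> \<Omega> \<Longrightarrow> y \<in> \<Omega> \<Longrightarrow> K y x = cnj (K x y)"
  using gram_hermitian[OF single_finsupp single_finsupp, of x y]
  by (simp add: gram_def pairing_single comb_single)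

lemma quad_single: "x \<in> \<Omega> \<Longrightarrow> quad (single x) = Re (K x x)"
  by (simp add: quad_def gram_def pairing_single comb_single)

lemma kernel_diag: "x \<in> \<Omega> \<Longrightarrow> 0 \<le> Re (K x x) \<and> K x x = complex_of_real (Re (K x x))"
  using kernel_hermitian[of x x] quad_single[of x] quad_nonneg[OF single_finsupp, of x]
  by (simp add: complex_eq_iff)

lemma kernel_Cauchy_Schwarz:
  assumes "x \<in> \<Omega>" "y \<in> \<Omega>"
  shows "(cmod (K x y))\<^sup>2 \<le> Re (K x x) * Re (K y y)"
proof -
  have "cmod (K x y) \<le> sqrt (Re (K y y) * Re (K x x))"
    using eval_le[OF hspace_comb[OF single_finsupp[OF assms(2)]], of x] assms
    nrm2_comb[OF single_finsupp[OF assms(2)]]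
    by (simp add: quad_single comb_single real_sqrt_mult)
  then have "(cmod (K x y))\<^sup>2 \<le> (sqrt (Re (K y y) * Re (K x x)))\<^sup>2"
    by (intro power_mono) auto
  then show ?thesis using kernel_diag assms by (simp add: mult.commute)
qed

text \<open>The reproducing kernel of the functions that vanish at \<open>a\<close>, that is, of the
  orthogonal complement of the kernel function at \<open>a\<close>. If K(a,a) = 0, division by 0
  leaves K unchanged, which is right because the kernel function at \<open>a\<close> is then
  zero.\<close>

definition schur :: "'a \<Rightarrow> 'a \<Rightarrow> 'a \<Rightarrow> complex" where
  "schur a x y = K x y - K x a * K a y / K a a"

lemma pairing_schur:
  assumes "a \<in> \<Omega>" and c: "c \<in> finsupp \<Omega>"
  shows "pairing (comb \<Omega> (schur a) c) c
    = gram c c - complex_of_real ((cmod (comb \<Omega> K c a))\<^sup>2 / Re (K a a))"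
proof -
  let ?S = "{x. c x \<noteq> 0}"
  note S = finsupp_finite[OF c] finsupp_subset[OF c]
  let ?f = "comb \<Omega> K c a"
  have f: "?f = (\<Sum>y\<in>?S. c y * K a y)" using assms by (simp add: comb_def)
  have cf: "cnj ?f = (\<Sum>x\<in>?S. cnj (c x) * K x a)"
    unfolding f cnj_sum using S assms by (intro sum.cong refl) (auto simp: kernel_hermitian[of a])
  have Kaa: "K a a = complex_of_real (Re (K a a))"
    using kernel_diag[OF assms(1)] by auto
  have "pairing (comb \<Omega> (schur a) c) c
      = (\<Sum>x\<in>?S. \<Sum>y\<in>?S. cnj (c x) * c y * K x y)
      - (\<Sum>x\<in>?S. \<Sum>y\<in>?S. (cnj (c x) * K x a) * (c y * K a y)) / K a a"
    using S by (subst pairing_comb[of ?S])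
      (auto simp: schur_def algebra_simps sum_subtractf sum_divide_distrib)
  also have "\<dots> = gram c c - cnj ?f * ?f / K a a"
    unfolding gram_def cf using S by (subst pairing_comb[of ?S]) (auto simp: f sum_product)
  also have "\<dots> = gram c c - complex_of_real ((cmod ?f)\<^sup>2 / Re (K a a))"
    by (subst Kaa) (simp add: complex_norm_square mult.commute del: of_real_power)
  finally show ?thesis .
qed

lemma kernel_schur:
  assumes "a \<in> \<Omega>"
  shows "kernel_on \<Omega> (schur a)"
  unfolding kernel_on_iff
proof
  fix c assume c: "c \<in> finsupp \<Omega>"
  let ?f = "comb \<Omega> K c a"
  have Kaa: "0 \<le> Re (K a a)" using kernel_diag[OF assms] by auto
  have "cmod ?f \<le> sqrt (quad c) * sqrt (Re (K a a))"
    using eval_le[OF hspace_comb[OF c], of a] by (simp add: nrm2_comb[OF c] quad_single[OF assms])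
  then have "(cmod ?f)\<^sup>2 \<le> (sqrt (quad c) * sqrt (Re (K a a)))\<^sup>2"
    by (intro power_mono) auto
  also have "\<dots> = quad c * Re (K a a)"
    using quad_nonneg[OF c] Kaa by (simp add: power_mult_distrib)
  finally have "(cmod ?f)\<^sup>2 \<le> quad c * Re (K a a)" .
  then have "(cmod ?f)\<^sup>2 / Re (K a a) \<le> quad c"
    using Kaa quad_nonneg[OF c] by (cases "Re (K a a) = 0") (auto simp: field_simps)
  then show "0 \<le> pairing (comb \<Omega> (schur a) c) c"
    unfolding pairing_schur[OF assms c] using gram_self[OF c] by (simp add: less_eq_complex_def quad_def)
qed

end

lemma kernel_on_subset: "kernel_on \<Omega> K \<Longrightarrow> A \<subseteq> \<Omega> \<Longrightarrow> kernel_on A K"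
  unfolding kernel_on_def by blast

text \<open>Cholesky factorization: each point splits off the rank-one part that its Schur
  complement removes, and the complement is factored on the remaining points.\<close>

lemma kernel_factor:
  assumes "finite S" "kernel_on S K"
  shows "\<exists>(r::nat) g. \<forall>x\<in>S. \<forall>y\<in>S. K x y = (\<Sum>l<r. g x l * cnj (g y l))"
  using assms
proof (induction S arbitrary: K rule: finite_induct)
  case empty
  then show ?case by simp
next
  case (insert a S)
  interpret kernel_space "insert a S" K by unfold_locales (rule insert.prems)
  obtain r g where g: "\<forall>x\<in>S. \<forall>y\<in>S. schur a x y = (\<Sum>l<(r::nat). g x l * cnj (g y l))"
    using insert.IH[OF kernel_on_subset[OF kernel_schur[of a], of S]] by blast
  let ?q = "Re (K a a)"
  have q: "0 \<le> ?q" "K a a = complex_of_real ?q" using kernel_diag[of a] by auto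
  \<comment> \<open>The induction hypothesis says nothing about \<open>g\<close> at
    \<open>a\<close>, so the old columns are set to 0 there. Column \<open>r\<close> is new; for
    K(a,a) = 0 division by 0 makes it zero, in accordance with Cauchy-Schwarz.\<close>
  define h where "h x l = (if l < r then if x = a then 0 else g x l else K x a / complex_of_real (sqrt ?q))" for x l
  have "K x y = (\<Sum>l<Suc r. h x l * cnj (h y l))" if xy: "x \<in> insert a S" "y \<in> insert a S" for x y
  proof -
    have ya: "cnj (K y a) = K a y" using kernel_hermitian[of a y] kernel_hermitian[of y a] xy by simp
    have "complex_of_real (sqrt ?q) * complex_of_real (sqrt ?q) = K a a"
      using q by (simp flip: of_real_mult)
    then have last: "h x r * cnj (h y r) = K x a * K a y / K a a"
      by (simp add: h_def ya)
    have zero: "K a z = 0 \<and> K z a = 0" if "K a a = 0" "z \<in> insert a S" for z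
      using kernel_Cauchy_Schwarz[of a z] kernel_Cauchy_Schwarz[of z a] that by simp
    consider "x = a" | "y = a" | "x \<in> S" "y \<in> S" "x \<noteq> a" "y \<noteq> a" using xy by blast
    then show ?thesis
    proof cases
      case 1
      then have "(\<Sum>l<r. h x l * cnj (h y l)) = 0" by (simp add: h_def)
      then show ?thesis using last zero[of y] xy 1 by (cases "K a a = 0") auto
    next
      case 2
      then have "(\<Sum>l<r. h x l * cnj (h y l)) = 0" by (simp add: h_def)
      then show ?thesis using last zero[of x] xy 2 by (cases "K a a = 0") auto
    next
      case 3
      then have "(\<Sum>l<r. h x l * cnj (h y l)) = schur a x y"
        using g by (simp add: h_def)
      then show ?thesis using last by (simp add: schur_def)
    qed
  qed
  then show ?case by blast
qed

section \<open>Contractive realizations\<close>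

text \<open>Orthogonal projection onto the span of the vectors \<open>a p\<close>, which may be
  linearly dependent. The new vector is first freed of its projection onto the old span; the
  component along what remains is then removed as well.\<close>

lemma projection_exists:
  fixes a :: "'p \<Rightarrow> 'i \<Rightarrow> complex"
  assumes "finite P"
  shows "\<exists>c. \<forall>q\<in>P. (\<Sum>i\<in>I. (v i - (\<Sum>p\<in>P. c p * a p i)) * cnj (a q i)) = 0"
  using assms
proof (induction P arbitrary: v rule: finite_induct)
  case empty
  then show ?case by simp
next
  case (insert s P)
  obtain c where c: "\<And>q. q \<in> P \<Longrightarrow> (\<Sum>i\<in>I. (v i - (\<Sum>p\<in>P. c p * a p i)) * cnj (a q i)) = 0"
    using insert.IH[of v] by blast
  obtain d where d: "\<And>q. q \<in> P \<Longrightarrow> (\<Sum>i\<in>I. (a s i - (\<Sum>p\<in>P. d p * a p i)) * cnj (a q i)) = 0"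
    using insert.IH[of "a s"] by blast
  define r where "r i = v i - (\<Sum>p\<in>P. c p * a p i)" for i
  define e where "e i = a s i - (\<Sum>p\<in>P. d p * a p i)" for i
  \<comment> \<open>If the remainder \<open>e\<close> vanishes, the denominator is 0 and t = 0, so
    nothing is removed.\<close>
  define t where "t = (\<Sum>i\<in>I. r i * cnj (e i)) / (\<Sum>i\<in>I. e i * cnj (e i))"
  have orth: "(\<Sum>i\<in>I. (r i - t * e i) * cnj (a q i)) = 0" if "q \<in> P" for q
    using c[OF that] d[OF that]
    by (simp add: r_def[symmetric] e_def[symmetric] left_diff_distrib sum_subtractf mult.assoc
        flip: sum_distrib_left)
  have orth_e: "(\<Sum>i\<in>I. (r i - t * e i) * cnj (e i)) = 0"
  proof (cases "(\<Sum>i\<in>I. e i * cnj (e i)) = 0")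
    case True
    have "(\<Sum>i\<in>I. e i * cnj (e i)) = complex_of_real (\<Sum>i\<in>I. (cmod (e i))\<^sup>2)"
      by (simp only: complex_norm_square of_real_sum)
    then have "(\<Sum>i\<in>I. (cmod (e i))\<^sup>2) = 0" using True by (metis of_real_eq_0_iff)
    then have "\<forall>i\<in>I. e i = 0 \<or> infinite I"
      using sum_nonneg_eq_0_iff[of I "\<lambda>i. (cmod (e i))\<^sup>2"] by auto
    then show ?thesis by (cases "finite I") auto
  next
    case False
    have "(\<Sum>i\<in>I. (r i - t * e i) * cnj (e i))
        = (\<Sum>i\<in>I. r i * cnj (e i)) - t * (\<Sum>i\<in>I. e i * cnj (e i))"
      by (simp add: left_diff_distrib sum_subtractf sum_distrib_left mult.assoc)
    then show ?thesis using False by (simp add: t_def)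
  qed
  define c' where "c' p = (if p = s then t else c p - t * d p)" for p
  have c': "v i - (\<Sum>p\<in>insert s P. c' p * a p i) = r i - t * e i" for i
  proof -
    have "(\<Sum>p\<in>P. c' p * a p i) = (\<Sum>p\<in>P. (c p - t * d p) * a p i)"
      using insert.hyps by (intro sum.cong) (auto simp: c'_def)
    then show ?thesis
      using insert.hyps
      by (simp add: r_def e_def c'_def algebra_simps sum_subtractf sum_distrib_left)
  qed
  have "(\<Sum>i\<in>I. (r i - t * e i) * cnj (a s i)) = 0"
  proof -
    have "cnj (a s i) = cnj (e i) + (\<Sum>p\<in>P. cnj (d p) * cnj (a p i))" for i
      by (simp add: e_def)
    then have "(\<Sum>i\<in>I. (r i - t * e i) * cnj (a s i))
        = (\<Sum>i\<in>I. (r i - t * e i) * cnj (e i))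
        + (\<Sum>i\<in>I. \<Sum>p\<in>P. cnj (d p) * ((r i - t * e i) * cnj (a p i)))"
      by (simp add: distrib_left sum.distrib sum_distrib_left mult_ac)
    also have "(\<Sum>i\<in>I. \<Sum>p\<in>P. cnj (d p) * ((r i - t * e i) * cnj (a p i)))
        = (\<Sum>p\<in>P. cnj (d p) * (\<Sum>i\<in>I. (r i - t * e i) * cnj (a p i)))"
      unfolding sum_distrib_left by (rule sum.swap)
    finally show ?thesis using orth orth_e by simp
  qed
  then show ?case
    using orth by (intro exI[of _ c']) (simp add: c' del: sum.insert)
qed

text \<open>Equal Gram matrices make the linear map sending each \<open>a p\<close> to
  \<open>b p\<close> isometric, hence well defined even if the vectors are dependent.\<close>

lemma sum_cmod_sq_comb:
  assumes "\<And>p q. p \<in> P \<Longrightarrow> q \<in> P \<Longrightarrow>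
    (\<Sum>i\<in>I. a p i * cnj (a q i)) = (\<Sum>j\<in>J. b p j * cnj (b q j))"
  shows "(\<Sum>i\<in>I. (cmod (\<Sum>p\<in>P. u p * a p i))\<^sup>2) = (\<Sum>j\<in>J. (cmod (\<Sum>p\<in>P. u p * b p j))\<^sup>2)"
proof -
  have "complex_of_real (\<Sum>i\<in>I. (cmod (\<Sum>p\<in>P. u p * a p i))\<^sup>2)
      = (\<Sum>p\<in>P. \<Sum>q\<in>P. u p * cnj (u q) * (\<Sum>i\<in>I. a p i * cnj (a q i)))"
    for I :: "'z set" and a
  proof -
    have "complex_of_real (\<Sum>i\<in>I. (cmod (\<Sum>p\<in>P. u p * a p i))\<^sup>2)
        = (\<Sum>i\<in>I. \<Sum>p\<in>P. \<Sum>q\<in>P. u p * cnj (u q) * (a p i * cnj (a q i)))"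
      unfolding of_real_sum complex_norm_square cnj_sum sum_product by (simp add: mult_ac)
    also have "\<dots> = (\<Sum>p\<in>P. \<Sum>i\<in>I. \<Sum>q\<in>P. u p * cnj (u q) * (a p i * cnj (a q i)))"
      by (rule sum.swap)
    also have "\<dots> = (\<Sum>p\<in>P. \<Sum>q\<in>P. \<Sum>i\<in>I. u p * cnj (u q) * (a p i * cnj (a q i)))"
      by (intro sum.cong refl sum.swap)
    finally show ?thesis by (simp only: sum_distrib_left)
  qed
  note this[of a I] this[of b J]
  moreover have "(\<Sum>p\<in>P. \<Sum>q\<in>P. u p * cnj (u q) * (\<Sum>i\<in>I. a p i * cnj (a q i)))
      = (\<Sum>p\<in>P. \<Sum>q\<in>P. u p * cnj (u q) * (\<Sum>j\<in>J. b p j * cnj (b q j)))"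
    using assms by (intro sum.cong refl) simp
  ultimately have "complex_of_real (\<Sum>i\<in>I. (cmod (\<Sum>p\<in>P. u p * a p i))\<^sup>2)
      = complex_of_real (\<Sum>j\<in>J. (cmod (\<Sum>p\<in>P. u p * b p j))\<^sup>2)" by metis
  then show ?thesis using of_real_eq_iff by blast
qed

text \<open>\<open>T\<close> projects orthogonally onto the span of the \<open>a p\<close> and then
  applies the isometry that sends \<open>a p\<close> to \<open>b p\<close>. Setting it to 0 on the
  complement gives a contraction at once, with no condition on dimensions as a unitary extension
  would need.\<close>

lemma lurking_isometry:
  fixes a :: "'p \<Rightarrow> 'i \<Rightarrow> complex" and b :: "'p \<Rightarrow> 'j \<Rightarrow> complex"
  assumes fin: "finite P" "finite I" "finite J"
    and gram: "\<And>p q. p \<in> P \<Longrightarrow> q \<in> P \<Longrightarrow>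
      (\<Sum>i\<in>I. a p i * cnj (a q i)) = (\<Sum>j\<in>J. b p j * cnj (b q j))"
  shows "\<exists>T. (\<forall>p\<in>P. \<forall>j\<in>J. (\<Sum>i\<in>I. T j i * a p i) = b p j)
    \<and> (\<forall>v. (\<Sum>j\<in>J. (cmod (\<Sum>i\<in>I. T j i * v i))\<^sup>2) \<le> (\<Sum>i\<in>I. (cmod (v i))\<^sup>2))"
proof -
  \<comment> \<open>The coefficients \<open>C k\<close> describe the projections of the unit
    vectors, from which \<open>T\<close> is read off as a matrix.\<close>
  have "\<forall>k. \<exists>c. \<forall>q\<in>P. (\<Sum>i\<in>I. ((if i = k then 1 else 0) - (\<Sum>p\<in>P. c p * a p i)) * cnj (a q i)) = 0"
    by (intro allI projection_exists fin(1))
  from choice[OF this] obtain C where C: "\<forall>k. \<forall>q\<in>P.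
      (\<Sum>i\<in>I. ((if i = k then 1 else 0) - (\<Sum>p\<in>P. C k p * a p i)) * cnj (a q i)) = 0" ..
  define T where "T j k = (\<Sum>p\<in>P. C k p * b p j)" for j k
  define c where "c v p = (\<Sum>k\<in>I. v k * C k p)" for v p
  have lin: "(\<Sum>p\<in>P. c v p * z p) = (\<Sum>k\<in>I. v k * (\<Sum>p\<in>P. C k p * z p))" for v z
    unfolding c_def sum_distrib_left sum_distrib_right mult.assoc by (rule sum.swap)
  have T: "(\<Sum>k\<in>I. T j k * v k) = (\<Sum>p\<in>P. c v p * b p j)" for j v
    unfolding lin T_def by (intro sum.cong refl mult.commute)
  define w where "w v i = (\<Sum>p\<in>P. c v p * a p i)" for v i
  have orth: "(\<Sum>i\<in>I. (v i - w v i) * cnj (a q i)) = 0" if "q \<in> P" for v q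
  proof -
    have "v i - w v i = (\<Sum>k\<in>I. v k * ((if i = k then 1 else 0) - (\<Sum>p\<in>P. C k p * a p i)))"
      if "i \<in> I" for i
    proof -
      have "v k * ((if i = k then 1 else 0) - (\<Sum>p\<in>P. C k p * a p i))
          = (if k = i then v k else 0) - v k * (\<Sum>p\<in>P. C k p * a p i)" for k
        by (simp add: algebra_simps)
      then show ?thesis
        using that fin(2) by (simp add: w_def lin sum_subtractf sum.delta)
    qed
    then have "(\<Sum>i\<in>I. (v i - w v i) * cnj (a q i))
        = (\<Sum>i\<in>I. \<Sum>k\<in>I. v k * (((if i = k then 1 else 0) - (\<Sum>p\<in>P. C k p * a p i)) * cnj (a q i)))"
      by (simp add: sum_distrib_right mult.assoc cong: sum.cong)
    also have "\<dots> = (\<Sum>k\<in>I. v k * (\<Sum>i\<in>I. ((if i = k then 1 else 0) - (\<Sum>p\<in>P. C k p * a p i)) * cnj (a q i)))"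
      unfolding sum_distrib_left by (rule sum.swap)
    also have "\<dots> = 0" using C[rule_format, OF that] by simp
    finally show ?thesis .
  qed
  have orth_w: "(\<Sum>i\<in>I. (v i - w v i) * cnj (\<Sum>p\<in>P. u p * a p i)) = 0" for u v
  proof -
    have "(\<Sum>i\<in>I. (v i - w v i) * cnj (\<Sum>p\<in>P. u p * a p i))
        = (\<Sum>i\<in>I. \<Sum>p\<in>P. cnj (u p) * ((v i - w v i) * cnj (a p i)))"
      by (simp add: sum_distrib_left mult_ac)
    also have "\<dots> = (\<Sum>p\<in>P. cnj (u p) * (\<Sum>i\<in>I. (v i - w v i) * cnj (a p i)))"
      unfolding sum_distrib_left by (rule sum.swap)
    finally show ?thesis using orth by simp
  qed
  have sq: "complex_of_real (\<Sum>i\<in>I. (cmod (f i))\<^sup>2) = (\<Sum>i\<in>I. f i * cnj (f i))"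
    for f :: "'i \<Rightarrow> complex"
    by (simp only: of_real_sum complex_norm_square)
  have contr: "(\<Sum>j\<in>J. (cmod (\<Sum>i\<in>I. T j i * v i))\<^sup>2) \<le> (\<Sum>i\<in>I. (cmod (v i))\<^sup>2)" for v
  proof -
    have "complex_of_real (\<Sum>i\<in>I. (cmod (v i))\<^sup>2)
        = (\<Sum>i\<in>I. (v i - w v i) * cnj (v i - w v i)) + (\<Sum>i\<in>I. w v i * cnj (w v i))
        + ((\<Sum>i\<in>I. (v i - w v i) * cnj (w v i)) + cnj (\<Sum>i\<in>I. (v i - w v i) * cnj (w v i)))"
      unfolding sq cnj_sum sum.distrib[symmetric] by (intro sum.cong) (auto simp: algebra_simps)
    also have "(\<Sum>i\<in>I. (v i - w v i) * cnj (w v i)) = 0"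
      using orth_w[of v "c v"] by (simp add: w_def)
    finally have "complex_of_real (\<Sum>i\<in>I. (cmod (v i))\<^sup>2)
        = complex_of_real ((\<Sum>i\<in>I. (cmod (v i - w v i))\<^sup>2) + (\<Sum>i\<in>I. (cmod (w v i))\<^sup>2))"
      unfolding of_real_add sq by simp
    then have "(\<Sum>i\<in>I. (cmod (v i))\<^sup>2)
        = (\<Sum>i\<in>I. (cmod (v i - w v i))\<^sup>2) + (\<Sum>i\<in>I. (cmod (w v i))\<^sup>2)"
      by (simp only: of_real_eq_iff)
    moreover have "0 \<le> (\<Sum>i\<in>I. (cmod (v i - w v i))\<^sup>2)" by (intro sum_nonneg) simp
    ultimately show ?thesis
      unfolding T using sum_cmod_sq_comb[OF gram, where u="c v"] by (simp add: w_def)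
  qed
  have interp: "(\<Sum>i\<in>I. T j i * a q i) = b q j" if q: "q \<in> P" and j: "j \<in> J" for q j
  proof -
    \<comment> \<open>These coefficients combine the \<open>a p\<close> to \<open>a q\<close> minus
      its projection, a vector orthogonal to itself and so zero. By equality of the Gram matrices
      they also annihilate the \<open>b p\<close>, which settles dependent families.\<close>
    define u where "u p = (if p = q then 1 else 0) - c (a q) p" for p
    have u: "(\<Sum>p\<in>P. u p * z p) = z q - (\<Sum>p\<in>P. c (a q) p * z p)" for z
    proof -
      have "u p * z p = (if p = q then z q else 0) - c (a q) p * z p" for p
        by (simp add: u_def algebra_simps)
      then show ?thesis using q fin(1) by (simp add: sum_subtractf sum.delta)
    qed
    have "(\<Sum>i\<in>I. (a q i - w (a q) i) * cnj (a q i - w (a q) i)) = 0"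
      using orth_w[of "a q" u] by (simp only: u) (simp add: w_def)
    then have "(\<Sum>i\<in>I. (cmod (\<Sum>p\<in>P. u p * a p i))\<^sup>2) = 0"
      unfolding u by (simp only: sq[symmetric] of_real_eq_0_iff w_def)
    then have "(\<Sum>j\<in>J. (cmod (\<Sum>p\<in>P. u p * b p j))\<^sup>2) = 0"
      using sum_cmod_sq_comb[OF gram, where u=u] by simp
    then have "\<forall>j\<in>J. (cmod (\<Sum>p\<in>P. u p * b p j))\<^sup>2 = 0"
      by (subst (asm) sum_nonneg_eq_0_iff[OF fin(3)]) auto
    then have "(\<Sum>p\<in>P. u p * b p j) = 0" using j by simp
    then show ?thesis unfolding T u by simp
  qed
  show ?thesis using contr interp by blast
qed

text \<open>Invertibility of I - \<zeta> D without a Neumann series: the residual \<rho> of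
  projecting \<open>h\<close> onto the range is orthogonal to (I - \<zeta> D) \<rho>, hence its
  squared norm is at most |\<zeta>| times itself and vanishes. Uniqueness is the same estimate for a
  difference of solutions.\<close>

lemma contraction_resolvent:
  fixes D :: "'l \<Rightarrow> 'l \<Rightarrow> complex"
  assumes fin: "finite R"
    and D: "\<And>v. (\<Sum>l\<in>R. (cmod (\<Sum>k\<in>R. D l k * v k))\<^sup>2) \<le> (\<Sum>l\<in>R. (cmod (v l))\<^sup>2)"
    and \<zeta>: "cmod \<zeta> < 1"
  shows "\<exists>g. \<forall>l\<in>R. g l = h l + \<zeta> * (\<Sum>k\<in>R. D l k * g k)"
    and "\<lbrakk>\<And>l. l \<in> R \<Longrightarrow> g l = h l + \<zeta> * (\<Sum>k\<in>R. D l k * g k);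
      \<And>l. l \<in> R \<Longrightarrow> g' l = h l + \<zeta> * (\<Sum>k\<in>R. D l k * g' k)\<rbrakk> \<Longrightarrow> \<forall>l\<in>R. g l = g' l"
proof -
  have vanish: "\<forall>l\<in>R. v l = 0"
    if "(\<Sum>l\<in>R. (cmod (v l))\<^sup>2) \<le> cmod \<zeta> * (\<Sum>l\<in>R. (cmod (v l))\<^sup>2)" for v
  proof -
    have s0: "0 \<le> (\<Sum>l\<in>R. (cmod (v l))\<^sup>2)" by (intro sum_nonneg) simp
    have "(1 - cmod \<zeta>) * (\<Sum>l\<in>R. (cmod (v l))\<^sup>2) \<le> 0" using that by (simp add: algebra_simps)
    then have "(\<Sum>l\<in>R. (cmod (v l))\<^sup>2) = 0"
      using \<zeta> s0 by (simp add: mult_le_0_iff)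
    then show ?thesis by (subst (asm) sum_nonneg_eq_0_iff[OF fin]) auto
  qed
  \<comment> \<open>The vector \<open>a p\<close> is column p of I - \<zeta> D, so combinations of
    these vectors are the range.\<close>
  define a where "a p l = (if l = p then 1 else 0) - \<zeta> * D l p" for p l
  have a: "(\<Sum>p\<in>R. u p * a p l) = u l - \<zeta> * (\<Sum>k\<in>R. D l k * u k)" if "l \<in> R" for u l
  proof -
    have "u p * a p l = (if p = l then u p else 0) - \<zeta> * (D l p * u p)" for p
      by (simp add: a_def algebra_simps)
    then show ?thesis
      using that fin by (simp add: sum_subtractf sum.delta flip: sum_distrib_left)
  qed
  obtain c where c: "\<And>q. q \<in> R \<Longrightarrow> (\<Sum>i\<in>R. (h i - (\<Sum>p\<in>R. c p * a p i)) * cnj (a q i)) = 0"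
    using projection_exists[OF fin, where I=R and v=h and a=a] by blast
  define \<rho> where "\<rho> i = h i - (\<Sum>p\<in>R. c p * a p i)" for i
  define \<eta> where "\<eta> l = (\<Sum>k\<in>R. D l k * \<rho> k)" for l
  have "(\<Sum>i\<in>R. \<rho> i * cnj (\<rho> i - \<zeta> * \<eta> i)) = (\<Sum>i\<in>R. \<rho> i * cnj (\<Sum>q\<in>R. \<rho> q * a q i))"
    by (intro sum.cong) (auto simp: a \<eta>_def)
  also have "\<dots> = (\<Sum>i\<in>R. \<Sum>q\<in>R. cnj (\<rho> q) * (\<rho> i * cnj (a q i)))"
    by (simp add: sum_distrib_left mult_ac)
  also have "\<dots> = (\<Sum>q\<in>R. cnj (\<rho> q) * (\<Sum>i\<in>R. \<rho> i * cnj (a q i)))"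
    unfolding sum_distrib_left by (rule sum.swap)
  also have "\<dots> = 0" using c by (simp add: \<rho>_def)
  finally have "(\<Sum>i\<in>R. \<rho> i * cnj (\<rho> i)) = (\<Sum>i\<in>R. \<rho> i * cnj (\<zeta> * \<eta> i))"
    by (simp add: right_diff_distrib sum_subtractf)
  then have "complex_of_real (\<Sum>i\<in>R. (cmod (\<rho> i))\<^sup>2) = (\<Sum>i\<in>R. \<rho> i * cnj (\<zeta> * \<eta> i))"
    by (simp only: of_real_sum complex_norm_square)
  then have "(\<Sum>i\<in>R. (cmod (\<rho> i))\<^sup>2) = Re (\<Sum>i\<in>R. \<rho> i * cnj (\<zeta> * \<eta> i))"
    by (metis Re_complex_of_real)
  also have "\<dots> \<le> (\<Sum>i\<in>R. cmod \<zeta> * (((cmod (\<rho> i))\<^sup>2 + (cmod (\<eta> i))\<^sup>2) / 2))"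
    unfolding Re_sum
  proof (intro sum_mono)
    fix i
    have "Re (\<rho> i * cnj (\<zeta> * \<eta> i)) \<le> cmod (\<rho> i * cnj (\<zeta> * \<eta> i))" by (rule complex_Re_le_cmod)
    also have "\<dots> = cmod \<zeta> * (cmod (\<rho> i) * cmod (\<eta> i))" by (simp add: norm_mult)
    also have "\<dots> \<le> cmod \<zeta> * (((cmod (\<rho> i))\<^sup>2 + (cmod (\<eta> i))\<^sup>2) / 2)"
      using sum_squares_bound[of "cmod (\<rho> i)" "cmod (\<eta> i)"] by (intro mult_left_mono) auto
    finally show "Re (\<rho> i * cnj (\<zeta> * \<eta> i)) \<le> cmod \<zeta> * (((cmod (\<rho> i))\<^sup>2 + (cmod (\<eta> i))\<^sup>2) / 2)" .
  qed
  also have "\<dots> = cmod \<zeta> * (((\<Sum>i\<in>R. (cmod (\<rho> i))\<^sup>2) + (\<Sum>i\<in>R. (cmod (\<eta> i))\<^sup>2)) / 2)"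
    by (simp add: sum_distrib_left sum.distrib sum_divide_distrib distrib_left add_divide_distrib)
  also have "\<dots> \<le> cmod \<zeta> * (\<Sum>i\<in>R. (cmod (\<rho> i))\<^sup>2)"
    using D[of \<rho>] by (intro mult_left_mono) (auto simp: \<eta>_def)
  finally have "\<forall>l\<in>R. \<rho> l = 0" by (rule vanish)
  then have "\<forall>l\<in>R. c l = h l + \<zeta> * (\<Sum>k\<in>R. D l k * c k)"
    using a[of _ c] by (simp add: \<rho>_def)
  then show "\<exists>g. \<forall>l\<in>R. g l = h l + \<zeta> * (\<Sum>k\<in>R. D l k * g k)" by blast
  assume g: "\<And>l. l \<in> R \<Longrightarrow> g l = h l + \<zeta> * (\<Sum>k\<in>R. D l k * g k)"
    "\<And>l. l \<in> R \<Longrightarrow> g' l = h l + \<zeta> * (\<Sum>k\<in>R. D l k * g' k)"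
  define v where "v l = g l - g' l" for l
  have "v l = \<zeta> * (\<Sum>k\<in>R. D l k * v k)" if "l \<in> R" for l
    unfolding v_def g(1)[OF that] g(2)[OF that]
    by (simp add: right_diff_distrib sum_subtractf)
  then have "(\<Sum>l\<in>R. (cmod (v l))\<^sup>2) = (\<Sum>l\<in>R. (cmod (\<zeta> * (\<Sum>k\<in>R. D l k * v k)))\<^sup>2)"
    by (intro sum.cong refl arg_cong[where f="\<lambda>z. (cmod z)\<^sup>2"])
  also have "\<dots> = (cmod \<zeta>)\<^sup>2 * (\<Sum>l\<in>R. (cmod (\<Sum>k\<in>R. D l k * v k))\<^sup>2)"
    by (simp only: norm_mult power_mult_distrib flip: sum_distrib_left)
  also have "\<dots> \<le> (cmod \<zeta>)\<^sup>2 * (\<Sum>l\<in>R. (cmod (v l))\<^sup>2)"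
    using D[of v] by (intro mult_left_mono) auto
  also have "\<dots> \<le> cmod \<zeta> * (\<Sum>l\<in>R. (cmod (v l))\<^sup>2)"
    using \<zeta> power_decreasing[of 1 2 "cmod \<zeta>"] by (intro mult_right_mono sum_nonneg) auto
  finally show "\<forall>l\<in>R. g l = g' l" using vanish[of v] by (simp add: v_def)
qed

section \<open>Matrix interpolation for the Szegoe kernel\<close>

definition szego_form :: "complex set \<Rightarrow> (complex \<Rightarrow> complex) \<Rightarrow> complex" where
  "szego_form S c = (\<Sum>x\<in>S. \<Sum>y\<in>S. cnj (c x) * c y / (1 - x * cnj y))"

text \<open>The sums over x of \<open>cnj x ^ N * c x\<close> are the Taylor coefficients of the
  combination of Szegoe kernels given by \<open>c\<close>, and the form is its squared norm in the
  Hardy space.\<close>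

lemma szego_form_sums:
  assumes "S \<subseteq> unit_disc"
  shows "(\<lambda>N. (cmod (\<Sum>x\<in>S. cnj x ^ N * c x))\<^sup>2) sums Re (szego_form S c)"
    and "0 \<le> szego_form S c"
proof -
  have eq: "complex_of_real ((cmod (\<Sum>x\<in>S. cnj x ^ N * c x))\<^sup>2)
      = (\<Sum>x\<in>S. \<Sum>y\<in>S. cnj (c x) * c y * (x * cnj y) ^ N)" for N
  proof -
    have "complex_of_real ((cmod (\<Sum>x\<in>S. cnj x ^ N * c x))\<^sup>2)
        = cnj (\<Sum>x\<in>S. cnj x ^ N * c x) * (\<Sum>y\<in>S. cnj y ^ N * c y)"
      by (simp only: complex_norm_square mult.commute)
    also have "\<dots> = (\<Sum>x\<in>S. \<Sum>y\<in>S. (x ^ N * cnj (c x)) * (cnj y ^ N * c y))"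
      by (simp add: sum_product)
    finally show ?thesis by (simp add: power_mult_distrib mult_ac)
  qed
  have "(\<lambda>N. \<Sum>x\<in>S. \<Sum>y\<in>S. cnj (c x) * c y * (x * cnj y) ^ N) sums szego_form S c"
    unfolding szego_form_def
  proof (intro sums_sum)
    fix x y assume "x \<in> S" "y \<in> S"
    then have "cmod x < 1" "cmod y < 1" using assms by auto
    then have "cmod x * cmod y < 1 * 1" by (intro mult_strict_mono) auto
    then have "cmod (x * cnj y) < 1" by (simp add: norm_mult)
    from sums_mult[OF geometric_sums[OF this], of "cnj (c x) * c y"]
    show "(\<lambda>N. cnj (c x) * c y * (x * cnj y) ^ N) sums (cnj (c x) * c y / (1 - x * cnj y))"
      by simp
  qed
  then have s: "(\<lambda>N. complex_of_real ((cmod (\<Sum>x\<in>S. cnj x ^ N * c x))\<^sup>2)) sums szego_form S c"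
    by (simp only: eq)
  from sums_Re[OF s] show sRe: "(\<lambda>N. (cmod (\<Sum>x\<in>S. cnj x ^ N * c x))\<^sup>2) sums Re (szego_form S c)"
    by (simp only: Re_complex_of_real)
  have "Im (szego_form S c) = 0"
    using sums_unique[OF sums_Im[OF s]] by simp
  moreover have "0 \<le> Re (szego_form S c)"
    using sums_le[OF _ sums_zero sRe] by simp
  ultimately show "0 \<le> szego_form S c" by (simp add: less_eq_complex_def)
qed

lemma sum_weighted_swap:
  fixes T :: "'i \<Rightarrow> complex"
  shows "(\<Sum>i\<in>I. T i * (\<Sum>x\<in>S. w x * (\<Sum>a\<in>A. c a x * h x a i)))
    = (\<Sum>x\<in>S. w x * (\<Sum>a\<in>A. c a x * (\<Sum>i\<in>I. T i * h x a i)))"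
proof -
  have "(\<Sum>i\<in>I. T i * (\<Sum>x\<in>S. w x * (\<Sum>a\<in>A. c a x * h x a i)))
      = (\<Sum>i\<in>I. \<Sum>x\<in>S. \<Sum>a\<in>A. w x * (c a x * (T i * h x a i)))"
    by (simp add: sum_distrib_left mult_ac)
  also have "\<dots> = (\<Sum>x\<in>S. \<Sum>i\<in>I. \<Sum>a\<in>A. w x * (c a x * (T i * h x a i)))"
    by (rule sum.swap)
  also have "\<dots> = (\<Sum>x\<in>S. \<Sum>a\<in>A. \<Sum>i\<in>I. w x * (c a x * (T i * h x a i)))"
    by (intro sum.cong refl sum.swap)
  finally show ?thesis by (simp only: sum_distrib_left)
qed

text \<open>The contraction \<open>T\<close> is the system matrix of a discrete-time linear system with transfer
  function \<open>\<Phi>\<close>; contractivity of \<open>\<Phi>\<close> is the energy balance of the system, summed over time.\<close>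

lemma szego_interpolation:
  fixes x :: "nat \<Rightarrow> complex" and W G :: "nat \<Rightarrow> nat \<Rightarrow> nat \<Rightarrow> complex"
  assumes x: "\<And>i. i < k \<Longrightarrow> x i \<in> unit_disc"
    and G: "\<And>i j a b. i < k \<Longrightarrow> j < k \<Longrightarrow> a < m \<Longrightarrow> b < m \<Longrightarrow>
      (if a = b then 1 else 0) - (\<Sum>s<n. W i a s * cnj (W j b s))
      = (1 - x i * cnj (x j)) * (\<Sum>l<r. G i a l * cnj (G j b l))"
  shows "\<exists>\<Phi> :: complex \<Rightarrow> nat \<Rightarrow> nat \<Rightarrow> complex.
    (\<forall>i<k. \<forall>a<m. \<forall>s<n. \<Phi> (x i) a s = W i a s) \<and>
    (\<forall>S c. finite S \<longrightarrow> S \<subseteq> unit_disc \<longrightarrow>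
      (\<Sum>s<n. Re (szego_form S (\<lambda>z. \<Sum>a<m. cnj (\<Phi> z a s) * c a z)))
      \<le> (\<Sum>a<m. Re (szego_form S (c a))))"
proof -
  \<comment> \<open>Moving both negative terms of the hypothesis to the other side makes each side a
    Gram matrix: identity plus x-weighted G against W plus G. The conjugates appear because
    \<open>T\<close> models the adjoint, which acts on kernel functions.\<close>
  define A where "A p = (case_sum (\<lambda>a. if a = snd p then 1 else 0)
    (\<lambda>l. cnj (x (fst p)) * cnj (G (fst p) (snd p) l)))" for p :: "nat \<times> nat"
  define B where "B p = (case_sum (\<lambda>s. cnj (W (fst p) (snd p) s))
    (\<lambda>l. cnj (G (fst p) (snd p) l)))" for p :: "nat \<times> nat"
  have plus: "(\<Sum>i\<in>{..<u} <+> {..<v}. f i) = (\<Sum>i<u. f (Inl i)) + (\<Sum>i<v. f (Inr i))"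
    for u v :: nat and f :: "nat + nat \<Rightarrow> 'z::comm_monoid_add"
    by (simp add: sum.Plus)
  have "\<exists>T. (\<forall>p\<in>{..<k} \<times> {..<m}. \<forall>j\<in>{..<n} <+> {..<r}. (\<Sum>i\<in>{..<m} <+> {..<r}. T j i * A p i) = B p j)
    \<and> (\<forall>v. (\<Sum>j\<in>{..<n} <+> {..<r}. (cmod (\<Sum>i\<in>{..<m} <+> {..<r}. T j i * v i))\<^sup>2)
        \<le> (\<Sum>i\<in>{..<m} <+> {..<r}. (cmod (v i))\<^sup>2))"
  proof (rule lurking_isometry)
    fix p q assume "p \<in> {..<k} \<times> {..<m}" "q \<in> {..<k} \<times> {..<m}"
    then obtain i j a b where pq: "p = (i, a)" "q = (j, b)" "i < k" "j < k" "a < m" "b < m" by auto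
    have "(\<Sum>e<m. (if e = a then 1 else 0) * cnj (if e = b then 1 else 0))
        = (\<Sum>e<m. if e = a then (if a = b then 1 else 0) else (0::complex))"
      by (intro sum.cong) auto
    then have d: "(\<Sum>e<m. (if e = a then 1 else 0) * cnj (if e = b then 1 else 0))
        = (if a = b then 1 else (0::complex))"
      using pq by simp
    have "(if a = b then 1 else 0) - (\<Sum>s<n. cnj (W i a s) * W j b s)
        = (1 - cnj (x i) * x j) * (\<Sum>l<r. cnj (G i a l) * G j b l)"
      using arg_cong[OF G[OF pq(3-6)], of cnj] by (simp split: if_splits)
    then show "(\<Sum>i\<in>{..<m} <+> {..<r}. A p i * cnj (A q i)) = (\<Sum>j\<in>{..<n} <+> {..<r}. B p j * cnj (B q j))"
      unfolding plus A_def B_def pq using d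
      by (simp add: algebra_simps sum_distrib_left sum_subtractf)
  qed auto
  then obtain T where TA: "\<And>i a j. i < k \<Longrightarrow> a < m \<Longrightarrow> j \<in> {..<n} <+> {..<r} \<Longrightarrow>
        (\<Sum>e<m. T j (Inl e) * A (i, a) (Inl e)) + (\<Sum>l<r. T j (Inr l) * A (i, a) (Inr l)) = B (i, a) j"
    and Tc: "\<And>v. (\<Sum>s<n. (cmod ((\<Sum>e<m. T (Inl s) (Inl e) * v (Inl e)) + (\<Sum>l<r. T (Inl s) (Inr l) * v (Inr l))))\<^sup>2)
        + (\<Sum>h<r. (cmod ((\<Sum>e<m. T (Inr h) (Inl e) * v (Inl e)) + (\<Sum>l<r. T (Inr h) (Inr l) * v (Inr l))))\<^sup>2)
        \<le> (\<Sum>e<m. (cmod (v (Inl e)))\<^sup>2) + (\<Sum>l<r. (cmod (v (Inr l)))\<^sup>2)"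
    unfolding plus by auto
  \<comment> \<open>The equation T A = B at a node. Its \<open>Inr\<close> rows say that the
    conjugate of \<open>G\<close> solves the state equation there, and its \<open>Inl\<close> rows
    then return the conjugate of \<open>W\<close>; with uniqueness of the state this is the
    interpolation property.\<close>
  have node: "T j (Inl a) + cnj (x i) * (\<Sum>l<r. T j (Inr l) * cnj (G i a l)) = B (i, a) j"
    if "i < k" "a < m" "j \<in> {..<n} <+> {..<r}" for i a j
  proof -
    have "T j (Inl e) * A (i, a) (Inl e) = (if e = a then T j (Inl a) else 0)" for e
      by (simp add: A_def)
    then show ?thesis
      using TA[OF that] that(2) by (simp add: A_def sum_distrib_left mult_ac)
  qed
  have D: "(\<Sum>h<r. (cmod (\<Sum>l<r. T (Inr h) (Inr l) * v l))\<^sup>2) \<le> (\<Sum>l<r. (cmod (v l))\<^sup>2)" for v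
  proof -
    have "0 \<le> (\<Sum>s<n. (cmod (\<Sum>l<r. T (Inl s) (Inr l) * v l))\<^sup>2)" by (intro sum_nonneg) simp
    then show ?thesis using Tc[of "case_sum (\<lambda>_. 0) v"] by simp
  qed
  note resolvent = contraction_resolvent[where D="\<lambda>h l. T (Inr h) (Inr l)" and R="{..<r}", OF finite_lessThan D]
  have "\<exists>\<gamma>. \<forall>z\<in>unit_disc. \<forall>a. \<forall>h\<in>{..<r}.
      \<gamma> z a h = T (Inr h) (Inl a) + cnj z * (\<Sum>l<r. T (Inr h) (Inr l) * \<gamma> z a l)"
  proof -
    have "\<forall>z. \<forall>a. \<exists>g. z \<in> unit_disc \<longrightarrow> (\<forall>h\<in>{..<r}.
      g h = T (Inr h) (Inl a) + cnj z * (\<Sum>l<r. T (Inr h) (Inr l) * g l))"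
    proof (intro allI)
      fix z a
      show "\<exists>g. z \<in> unit_disc \<longrightarrow> (\<forall>h\<in>{..<r}.
          g h = T (Inr h) (Inl a) + cnj z * (\<Sum>l<r. T (Inr h) (Inr l) * g l))"
        using resolvent(1)[of "cnj z" "\<lambda>h. T (Inr h) (Inl a)"] by (cases "z \<in> unit_disc") auto
    qed
    then have "\<exists>\<gamma>. \<forall>z a. z \<in> unit_disc \<longrightarrow> (\<forall>h\<in>{..<r}.
      \<gamma> z a h = T (Inr h) (Inl a) + cnj z * (\<Sum>l<r. T (Inr h) (Inr l) * \<gamma> z a l))"
      unfolding choice_iff .
    then show ?thesis by blast
  qed
  then obtain \<gamma> where \<gamma>': "\<forall>z\<in>unit_disc. \<forall>a. \<forall>h\<in>{..<r}.
      \<gamma> z a h = T (Inr h) (Inl a) + cnj z * (\<Sum>l<r. T (Inr h) (Inr l) * \<gamma> z a l)" ..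
  have \<gamma>: "\<gamma> z a h = T (Inr h) (Inl a) + cnj z * (\<Sum>l<r. T (Inr h) (Inr l) * \<gamma> z a l)"
    if "z \<in> unit_disc" "h < r" for z a h
    using \<gamma>' that by blast
  define \<Phi> where "\<Phi> z a s = cnj (T (Inl s) (Inl a) + cnj z * (\<Sum>l<r. T (Inl s) (Inr l) * \<gamma> z a l))" for z a s
  have "\<Phi> (x i) a s = W i a s" if ias: "i < k" "a < m" "s < n" for i a s
  proof -
    have "\<forall>h\<in>{..<r}. \<gamma> (x i) a h = cnj (G i a h)"
    proof (rule resolvent(2))
      show "cmod (cnj (x i)) < 1" using x[OF ias(1)] by simp
      show "\<gamma> (x i) a h = T (Inr h) (Inl a) + cnj (x i) * (\<Sum>l<r. T (Inr h) (Inr l) * \<gamma> (x i) a l)"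
        if "h \<in> {..<r}" for h
        using \<gamma>[OF x[OF ias(1)], of h a] that by simp
      show "cnj (G i a h) = T (Inr h) (Inl a) + cnj (x i) * (\<Sum>l<r. T (Inr h) (Inr l) * cnj (G i a l))"
        if "h \<in> {..<r}" for h
        using node[OF ias(1,2) InrI[OF that]] by (simp add: B_def)
    qed
    then have "\<Phi> (x i) a s = cnj (T (Inl s) (Inl a) + cnj (x i) * (\<Sum>l<r. T (Inl s) (Inr l) * cnj (G i a l)))"
      by (simp add: \<Phi>_def)
    also have "\<dots> = W i a s"
      using node[OF ias(1,2), of "Inl s"] ias(3) by (simp add: B_def InlI)
    finally show ?thesis .
  qed
  moreover have "(\<Sum>s<n. Re (szego_form S (\<lambda>z. \<Sum>a<m. cnj (\<Phi> z a s) * c a z)))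
      \<le> (\<Sum>a<m. Re (szego_form S (c a)))"
    if S: "finite S" "S \<subseteq> unit_disc" for S c
  proof -
    \<comment> \<open>Taylor coefficients of order N of input, state and output. Time runs
      backwards: \<beta> (Suc N) is the incoming state and \<beta> N the outgoing one.\<close>
    define \<alpha> where "\<alpha> N a = (\<Sum>z\<in>S. cnj z ^ N * c a z)" for N a
    define \<beta> where "\<beta> N l = (\<Sum>z\<in>S. cnj z ^ N * (\<Sum>a<m. c a z * \<gamma> z a l))" for N l
    define \<delta> where "\<delta> N s = (\<Sum>z\<in>S. cnj z ^ N * (\<Sum>a<m. cnj (\<Phi> z a s) * c a z))" for N s
    have comb: "(\<Sum>e<m. T j (Inl e) * \<alpha> N e) + (\<Sum>l<r. T j (Inr l) * \<beta> (Suc N) l)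
        = (\<Sum>z\<in>S. cnj z ^ N * (\<Sum>a<m. c a z * (T j (Inl a) + cnj z * (\<Sum>l<r. T j (Inr l) * \<gamma> z a l))))"
      for j N
    proof -
      have "(\<Sum>e<m. T j (Inl e) * \<alpha> N e) = (\<Sum>z\<in>S. cnj z ^ N * (\<Sum>a<m. c a z * T j (Inl a)))"
        unfolding \<alpha>_def sum_distrib_left by (subst sum.swap) (simp add: mult_ac)
      moreover have "(\<Sum>l<r. T j (Inr l) * \<beta> (Suc N) l)
          = (\<Sum>z\<in>S. cnj z ^ Suc N * (\<Sum>a<m. c a z * (\<Sum>l<r. T j (Inr l) * \<gamma> z a l)))"
        unfolding \<beta>_def by (rule sum_weighted_swap)
      ultimately show ?thesis
        by (simp add: distrib_left sum.distrib sum_distrib_left mult_ac)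
    qed
    have Dl: "(\<Sum>e<m. T (Inl s) (Inl e) * \<alpha> N e) + (\<Sum>l<r. T (Inl s) (Inr l) * \<beta> (Suc N) l) = \<delta> N s" for N s
      unfolding comb \<delta>_def \<Phi>_def by (simp add: mult.commute)
    have Dr: "(\<Sum>e<m. T (Inr h) (Inl e) * \<alpha> N e) + (\<Sum>l<r. T (Inr h) (Inr l) * \<beta> (Suc N) l) = \<beta> N h"
      if "h < r" for N h
    proof -
      have "T (Inr h) (Inl a) + cnj z * (\<Sum>l<r. T (Inr h) (Inr l) * \<gamma> z a l) = \<gamma> z a h"
        if "z \<in> S" for z a
        using \<gamma>[of z h a] S(2) \<open>z \<in> S\<close> \<open>h < r\<close> by (simp add: subset_iff)
      then show ?thesis
        unfolding comb by (simp add: \<beta>_def cong: sum.cong)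
    qed
    have step: "(\<Sum>s<n. (cmod (\<delta> N s))\<^sup>2) + (\<Sum>l<r. (cmod (\<beta> N l))\<^sup>2)
        \<le> (\<Sum>a<m. (cmod (\<alpha> N a))\<^sup>2) + (\<Sum>l<r. (cmod (\<beta> (Suc N) l))\<^sup>2)" for N
      using Tc[of "case_sum (\<alpha> N) (\<beta> (Suc N))"] by (simp add: Dl Dr)
    have total: "(\<Sum>N<M. \<Sum>s<n. (cmod (\<delta> N s))\<^sup>2) + (\<Sum>l<r. (cmod (\<beta> 0 l))\<^sup>2)
        \<le> (\<Sum>N<M. \<Sum>a<m. (cmod (\<alpha> N a))\<^sup>2) + (\<Sum>l<r. (cmod (\<beta> M l))\<^sup>2)" for M
    proof (induction M)
      case (Suc M)
      then show ?case using step[of M] by simp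
    qed simp
    have "(\<lambda>M. \<beta> M l) \<longlonglongrightarrow> (\<Sum>z\<in>S. 0 * (\<Sum>a<m. c a z * \<gamma> z a l))" for l
      unfolding \<beta>_def using S(2)
      by (intro tendsto_intros LIMSEQ_power_zero) (auto simp: subset_iff)
    then have "(\<lambda>M. \<beta> M l) \<longlonglongrightarrow> 0" for l by simp
    then have \<beta>0: "(\<lambda>M. \<Sum>l<r. (cmod (\<beta> M l))\<^sup>2) \<longlonglongrightarrow> (\<Sum>l<r. (cmod 0)\<^sup>2)"
      by (intro tendsto_intros)
    have \<alpha>s: "(\<lambda>N. \<Sum>a<m. (cmod (\<alpha> N a))\<^sup>2) sums (\<Sum>a<m. Re (szego_form S (c a)))"
      unfolding \<alpha>_def by (intro sums_sum szego_form_sums S)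
    have \<delta>s: "(\<lambda>N. \<Sum>s<n. (cmod (\<delta> N s))\<^sup>2)
        sums (\<Sum>s<n. Re (szego_form S (\<lambda>z. \<Sum>a<m. cnj (\<Phi> z a s) * c a z)))"
      unfolding \<delta>_def by (intro sums_sum szego_form_sums S)
    have "(\<lambda>M. (\<Sum>N<M. \<Sum>a<m. (cmod (\<alpha> N a))\<^sup>2) + (\<Sum>l<r. (cmod (\<beta> M l))\<^sup>2))
        \<longlonglongrightarrow> (\<Sum>a<m. Re (szego_form S (c a)))"
      using tendsto_add[OF \<alpha>s[unfolded sums_def] \<beta>0] by simp
    moreover have "(\<Sum>N<M. \<Sum>s<n. (cmod (\<delta> N s))\<^sup>2)
        \<le> (\<Sum>N<M. \<Sum>a<m. (cmod (\<alpha> N a))\<^sup>2) + (\<Sum>l<r. (cmod (\<beta> M l))\<^sup>2)" for M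
    proof -
      have "0 \<le> (\<Sum>l<r. (cmod (\<beta> 0 l))\<^sup>2)" by (intro sum_nonneg) simp
      then show ?thesis using total[of M] by linarith
    qed
    ultimately show ?thesis
      using LIMSEQ_le[OF \<delta>s[unfolded sums_def]] by blast
  qed
  ultimately show ?thesis by blast
qed

lemma adjoint_block_index:
  assumes "V \<in> carrier_mat m n" "U \<in> carrier_mat m n" "a < m" "b < m"
  shows "(1\<^sub>m m - V * mat_adjoint U) $$ (a, b)
    = (if a = b then 1 else 0) - (\<Sum>s<n. V $$ (a, s) * cnj (U $$ (b, s)))"
  using assms
  by (auto simp: mat_adjoint_def mat_of_rows_def scalar_prod_def atLeast0LessThan
      conjugate_complex_def cols_def)

section \<open>Rescalings of the Szegoe kernel\<close>

lemma comb_rescaled_szego: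
  assumes K: "\<And>x y. x \<in> unit_disc \<Longrightarrow> y \<in> unit_disc \<Longrightarrow> K x y = \<delta> x * cnj (\<delta> y) / (1 - x * cnj y)"
    and S: "finite S" "S \<subseteq> unit_disc" "\<And>x. x \<notin> S \<Longrightarrow> c x = 0"
  shows "pairing (comb unit_disc K c) c = szego_form S (\<lambda>x. cnj (\<delta> x) * c x)"
proof -
  have "pairing (comb unit_disc K c) c = (\<Sum>x\<in>S. \<Sum>y\<in>S. cnj (c x) * c y * K x y)"
    using S by (intro pairing_comb) auto
  also have "\<dots> = szego_form S (\<lambda>x. cnj (\<delta> x) * c x)"
    unfolding szego_form_def
  proof (intro sum.cong refl)
    fix x y assume "x \<in> S" "y \<in> S"
    then have "K x y = \<delta> x * cnj (\<delta> y) / (1 - x * cnj y)"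
      using S(2) by (intro K) auto
    then show "cnj (c x) * c y * K x y
        = cnj (cnj (\<delta> x) * c x) * (cnj (\<delta> y) * c y) / (1 - x * cnj y)"
      by (simp add: mult_ac)
  qed
  finally show ?thesis .
qed

text \<open>The zero-free factor \<delta> is absorbed into coefficients: test coefficients are
  multiplied by its conjugate and the factors of the Pick matrix are divided by it. Both the data
  and the interpolants are then those of the Szegoe kernel.\<close>

theorem rescaled_szego_cnp:
  assumes K: "\<And>x y. x \<in> unit_disc \<Longrightarrow> y \<in> unit_disc \<Longrightarrow> K x y = \<delta> x * cnj (\<delta> y) / (1 - x * cnj y)"
    and \<delta>: "\<And>x. x \<in> unit_disc \<Longrightarrow> \<delta> x \<noteq> 0"
  shows "cnp_kernel unit_disc K"
proof -
  have ker: "kernel_on unit_disc K"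
    unfolding kernel_on_iff
  proof
    fix c assume c: "c \<in> finsupp unit_disc"
    note S = finsupp_finite[OF c] finsupp_subset[OF c]
    show "0 \<le> pairing (comb unit_disc K c) c"
      using comb_rescaled_szego[OF K S] szego_form_sums(2)[OF S(2)] by simp
  qed
  interpret kernel_space unit_disc K by unfold_locales (rule ker)
  have quad: "quad c = Re (szego_form S (\<lambda>x. cnj (\<delta> x) * c x))"
    if "finite S" "S \<subseteq> unit_disc" "\<And>x. x \<notin> S \<Longrightarrow> c x = 0" for S c
    using comb_rescaled_szego[OF K that] by (simp add: quad_def gram_def)
  show ?thesis
    unfolding cnp_kernel_def
  proof (intro conjI allI impI ker)
    fix m n k :: nat and x :: "nat \<Rightarrow> complex" and W :: "nat \<Rightarrow> complex mat"
    assume "0 < m" and x: "x ` {..<k} \<subseteq> unit_disc"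
      and W: "\<forall>i<k. W i \<in> carrier_mat m n" and P: "psd_mat (pick_matrix K m k x W)"
    have xi: "x i \<in> unit_disc" if "i < k" for i using x that by blast
    \<comment> \<open>The block matrix is read as a kernel on its row indices, so that the
      factorization of finite kernels applies to it; index i m + a stands for row a of block
      i.\<close>
    define Q where "Q p q = (1\<^sub>m m - W (p div m) * mat_adjoint (W (q div m))) $$ (p mod m, q mod m)
      * K (x (p div m)) (x (q div m))" for p q
    have psd: "0 \<le> (\<Sum>p<k * m. \<Sum>q<k * m. cnj (v p) * v q * Q p q)" for v
      using P unfolding pick_matrix_def psd_mat_iff Let_def Q_def by simp
    have "kernel_on {..<k * m} Q"
      unfolding kernel_on_iff
    proof
      fix c assume c: "c \<in> finsupp {..<k * m}"
      have "pairing (comb {..<k * m} Q c) c = (\<Sum>p<k * m. \<Sum>q<k * m. cnj (c p) * c q * Q p q)"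
        using finsupp_subset[OF c] by (intro pairing_comb) auto
      then show "0 \<le> pairing (comb {..<k * m} Q c) c" using psd[of c] by simp
    qed
    then obtain r g where g: "\<forall>p\<in>{..<k * m}. \<forall>q\<in>{..<k * m}. Q p q = (\<Sum>l<(r::nat). g p l * cnj (g q l))"
      using kernel_factor[of "{..<k * m}" Q] by blast
    define G where "G i a l = g (i * m + a) l / \<delta> (x i)" for i a l
    have "\<exists>\<Phi> :: complex \<Rightarrow> nat \<Rightarrow> nat \<Rightarrow> complex.
      (\<forall>i<k. \<forall>a<m. \<forall>s<n. \<Phi> (x i) a s = W i $$ (a, s)) \<and>
      (\<forall>S c. finite S \<longrightarrow> S \<subseteq> unit_disc \<longrightarrow>
        (\<Sum>s<n. Re (szego_form S (\<lambda>z. \<Sum>a<m. cnj (\<Phi> z a s) * c a z)))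
        \<le> (\<Sum>a<m. Re (szego_form S (c a))))"
    proof (rule szego_interpolation[OF xi])
      fix i j a b assume ij: "i < k" "j < k" and ab: "a < m" "b < m"
      have lt: "i * m + a < k * m" if "i < k" "a < m" for i a
      proof -
        have "i * m + a < Suc i * m" using that by simp
        also have "\<dots> \<le> k * m" using that by (intro mult_le_mono1) simp
        finally show ?thesis .
      qed
      let ?D = "(if a = b then 1 else 0) - (\<Sum>s<n. W i $$ (a, s) * cnj (W j $$ (b, s)))"
      let ?d = "\<delta> (x i) * cnj (\<delta> (x j))"
      have "?D * K (x i) (x j) = Q (i * m + a) (j * m + b)"
        using ab by (simp add: Q_def adjoint_block_index[OF W[rule_format, OF ij(1)] W[rule_format, OF ij(2)] ab])
      also have "\<dots> = (\<Sum>l<r. g (i * m + a) l * cnj (g (j * m + b) l))"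
        using g lt ij ab by simp
      also have "\<dots> = ?d * (\<Sum>l<r. G i a l * cnj (G j b l))"
        using \<delta>[OF xi[OF ij(1)]] \<delta>[OF xi[OF ij(2)]] unfolding sum_distrib_left G_def
        by (intro sum.cong) auto
      finally have eq: "?D * K (x i) (x j) = ?d * (\<Sum>l<r. G i a l * cnj (G j b l))" .
      have "cmod (x i) * cmod (x j) < 1 * 1"
        using xi[OF ij(1)] xi[OF ij(2)] by (intro mult_strict_mono) auto
      then have ne: "1 - x i * cnj (x j) \<noteq> 0"
        using norm_mult[of "x i" "cnj (x j)"] by auto
      have "?D * ?d = (1 - x i * cnj (x j)) * (?D * K (x i) (x j))"
        unfolding K[OF xi[OF ij(1)] xi[OF ij(2)]] using ne by simp
      also have "\<dots> = ((1 - x i * cnj (x j)) * (\<Sum>l<r. G i a l * cnj (G j b l))) * ?d"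
        unfolding eq by (simp only: mult_ac)
      finally show "?D = (1 - x i * cnj (x j)) * (\<Sum>l<r. G i a l * cnj (G j b l))"
        using \<delta>[OF xi[OF ij(1)]] \<delta>[OF xi[OF ij(2)]] by simp
    qed
    then obtain \<Phi> :: "complex \<Rightarrow> nat \<Rightarrow> nat \<Rightarrow> complex"
      where \<Phi>: "\<And>i a s. i < k \<Longrightarrow> a < m \<Longrightarrow> s < n \<Longrightarrow> \<Phi> (x i) a s = W i $$ (a, s)"
        and le: "\<And>S c. finite S \<Longrightarrow> S \<subseteq> unit_disc \<Longrightarrow>
          (\<Sum>s<n. Re (szego_form S (\<lambda>z. \<Sum>a<m. cnj (\<Phi> z a s) * c a z)))
          \<le> (\<Sum>a<m. Re (szego_form S (c a)))"
      by blast
    define \<Psi> where "\<Psi> z = mat m n (\<lambda>(a, s). \<Phi> z a s)" for z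
    have "contractive_matrix_multiplier unit_disc K m n \<Psi>"
    proof (rule contractive_matrix_multiplierI)
      fix c :: "nat \<Rightarrow> complex \<Rightarrow> complex"
      assume c: "\<And>i. i < m \<Longrightarrow> c i \<in> finsupp unit_disc"
      define S where "S = (\<Union>i<m. {z. c i z \<noteq> 0})"
      have S: "finite S" "S \<subseteq> unit_disc" "\<And>i z. i < m \<Longrightarrow> z \<notin> S \<Longrightarrow> c i z = 0"
        using c finsupp_finite finsupp_subset unfolding S_def by blast+
      have "quad (\<lambda>z. \<Sum>i<m. cnj (\<Psi> z $$ (i, j)) * c i z)
          = Re (szego_form S (\<lambda>z. \<Sum>i<m. cnj (\<Phi> z i j) * (cnj (\<delta> z) * c i z)))" if "j < n" for j
      proof -
        have "quad (\<lambda>z. \<Sum>i<m. cnj (\<Psi> z $$ (i, j)) * c i z)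
            = Re (szego_form S (\<lambda>z. cnj (\<delta> z) * (\<Sum>i<m. cnj (\<Psi> z $$ (i, j)) * c i z)))"
          by (rule quad[OF S(1,2)]) (simp add: S(3))
        also have "(\<lambda>z. cnj (\<delta> z) * (\<Sum>i<m. cnj (\<Psi> z $$ (i, j)) * c i z))
            = (\<lambda>z. \<Sum>i<m. cnj (\<Phi> z i j) * (cnj (\<delta> z) * c i z))"
          using that by (simp add: \<Psi>_def sum_distrib_left mult_ac)
        finally show ?thesis .
      qed
      moreover have "quad (c i) = Re (szego_form S (\<lambda>z. cnj (\<delta> z) * c i z))" if "i < m" for i
        using S(3)[OF that] by (rule quad[OF S(1,2)])
      ultimately show "(\<Sum>j<n. quad (\<lambda>z. \<Sum>i<m. cnj (\<Psi> z $$ (i, j)) * c i z)) \<le> (\<Sum>i<m. quad (c i))"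
        using le[OF S(1,2), of "\<lambda>i z. cnj (\<delta> z) * c i z"] by simp
    qed (simp add: \<Psi>_def)
    moreover have "\<Psi> (x i) = W i" if "i < k" for i
      using W[rule_format, OF that] \<Phi>[OF that] by (intro eq_matI) (auto simp: \<Psi>_def)
    ultimately show "\<exists>\<Phi>. contractive_matrix_multiplier unit_disc K m n \<Phi> \<and> (\<forall>i<k. \<Phi> (x i) = W i)"
      by blast
  qed
qed

section \<open>A necessary condition for complete Nevanlinna--Pick kernels\<close>

text \<open>The data \<open>0\<close> and \<open>w\<close> at \<open>z1\<close> and \<open>z2\<close> make the Pick matrix singular, of the form
  \<open>a\<^sub>i a\<^sub>j\<^sup>*\<close>. Since the interpolant is a contraction on the span of the
  kernel functions at \<open>z0, z1, z2\<close>, so is its compression to the complement of the kernel function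
  at \<open>z0\<close>.\<close>

lemma cnp_two_point:
  assumes cnp: "cnp_kernel \<Omega> K"
    and z: "z0 \<in> \<Omega>" "z1 \<in> \<Omega>" "z2 \<in> \<Omega>" "z0 \<noteq> z1" "z0 \<noteq> z2" "z1 \<noteq> z2"
    and nz: "K z0 z0 \<noteq> 0" "K z1 z1 \<noteq> 0" "K z2 z2 \<noteq> 0" "K z1 z2 \<noteq> 0"
    and F: "\<And>x y. F x y = 1 - K x z0 * K z0 y / (K x y * K z0 z0)"
  shows "0 \<le> (cmod v1)\<^sup>2 * Re (F z1 z1) + (cmod v2)\<^sup>2 * Re (F z2 z2) + 2 * Re (v1 * cnj v2 * F z1 z2)"
proof -
  interpret kernel_space \<Omega> K by unfold_locales (use cnp in \<open>simp add: cnp_kernel_def\<close>)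
  interpret S: kernel_space \<Omega> "schur z0" by unfold_locales (rule kernel_schur[OF z(1)])
  define k11 k22 where "k11 = Re (K z1 z1)" and "k22 = Re (K z2 z2)"
  have k11: "K z1 z1 = complex_of_real k11" "0 < k11"
    using kernel_diag[OF z(2)] nz by (auto simp: k11_def complex_eq_iff order_less_le)
  have k22: "K z2 z2 = complex_of_real k22" "0 < k22"
    using kernel_diag[OF z(3)] nz by (auto simp: k22_def complex_eq_iff order_less_le)
  have k21: "K z2 z1 = cnj (K z1 z2)" by (rule kernel_hermitian[OF z(2,3)])
  define \<kappa> where "\<kappa> = (cmod (K z1 z2))\<^sup>2 / (k11 * k22)"
  \<comment> \<open>The largest value at z2 compatible with 0 at z1: (1 - w^2) K(z2,z2) equals
    |K(z1,z2)|^2 / K(z1,z1), the value for which the determinant of the Pick matrix is zero.\<close>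
  define w where "w = sqrt (1 - \<kappa>)"
  have "\<kappa> \<le> 1"
    using kernel_Cauchy_Schwarz[OF z(2,3)] k11 k22 by (simp add: \<kappa>_def)
  then have w2: "w * w = 1 - \<kappa>" by (simp add: w_def)
  define x where "x i = (if i = 0 then z1 else z2)" for i :: nat
  define W where "W i = mat 1 1 (\<lambda>_. if i = (0::nat) then 0 else complex_of_real w)" for i
  have psd: "psd_mat (pick_matrix K 1 2 x W)"
  proof -
    have entry: "(1\<^sub>m 1 - W p * mat_adjoint (W q)) $$ (0, 0) * K (x p) (x q)
        = (if p = 0 then if q = 0 then K z1 z1 else K z1 z2
           else if q = 0 then K z2 z1 else complex_of_real \<kappa> * K z2 z2)" for p q
    proof -
      have "(1\<^sub>m 1 - W p * mat_adjoint (W q)) $$ (0, 0) = 1 - W p $$ (0, 0) * cnj (W q $$ (0, 0))"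
        by (subst adjoint_block_index[of _ 1 1]) (auto simp: W_def)
      then show ?thesis
        using w2 by (auto simp: W_def x_def simp flip: of_real_mult of_real_diff)
          (metis of_real_1 of_real_diff diff_diff_eq2 add_diff_cancel_left')
    qed
    show ?thesis
      unfolding pick_matrix_def psd_mat_iff
    proof
      fix v :: "nat \<Rightarrow> complex"
      have "complex_of_real \<kappa> * K z2 z2 = K z1 z2 * cnj (K z1 z2) / k11"
        using k11 k22 by (simp add: \<kappa>_def complex_norm_square del: of_real_power)
      then have "(\<Sum>i<2. \<Sum>j<2. cnj (v i) * v j * (if i = 0 then if j = 0 then K z1 z1 else K z1 z2
           else if j = 0 then K z2 z1 else complex_of_real \<kappa> * K z2 z2))
        = (k11 * v 0 + K z1 z2 * v 1) * cnj (k11 * v 0 + K z1 z2 * v 1) / k11"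
        using k11 by (simp add: numeral_2_eq_2 k21 field_simps)
      also have "\<dots> = complex_of_real ((cmod (k11 * v 0 + K z1 z2 * v 1))\<^sup>2 / k11)"
        by (simp add: complex_norm_square del: of_real_power)
      finally have "0 \<le> (\<Sum>i<2. \<Sum>j<(2::nat). cnj (v i) * v j * (if i = 0 then if j = 0 then K z1 z1 else K z1 z2
           else if j = 0 then K z2 z1 else complex_of_real \<kappa> * K z2 z2))"
        using k11 by (simp add: less_eq_complex_def)
      then show "0 \<le> (\<Sum>i<2 * 1. \<Sum>j<2 * 1. cnj (v i) * v j * (case (i, j) of (p, q) \<Rightarrow>
          let i = p div 1; j = q div 1
          in (1\<^sub>m 1 - W i * mat_adjoint (W j)) $$ (p mod 1, q mod 1) * K (x i) (x j)))"
        by (simp only: div_by_1 mod_by_1 Let_def prod.case entry mult_1_right)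
    qed
  qed
  have one: "(0::nat) < 1" by simp
  have inj: "inj_on x {..<2}" using z(6) by (auto simp: inj_on_def x_def)
  have sub: "x ` {..<2} \<subseteq> \<Omega>" using z by (auto simp: x_def)
  have car: "\<forall>i<2. W i \<in> carrier_mat 1 1" by (simp add: W_def)
  note cnp[unfolded cnp_kernel_def, THEN conjunct2, THEN spec, of 1, THEN spec, of 1, THEN spec, of 2,
      THEN spec, of x, THEN spec, of W, THEN mp, OF one, THEN mp, OF one]
  from this[THEN mp, OF inj, THEN mp, OF sub, THEN mp, OF car, THEN mp, OF psd]
  obtain \<Phi> where \<Phi>: "contractive_matrix_multiplier \<Omega> K 1 1 \<Phi>" "\<forall>i<2. \<Phi> (x i) = W i"
    by blast
  have \<phi>: "\<Phi> z1 $$ (0, 0) = 0" "\<Phi> z2 $$ (0, 0) = w"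
    using \<Phi>(2)[rule_format, of 0] \<Phi>(2)[rule_format, of 1] by (auto simp: x_def W_def)
  \<comment> \<open>Scaled so that |A|^2 K(z1,z1) = |v1|^2, \<kappa> |B|^2 K(z2,z2) = |v2|^2 and cnj
    A B K(z1,z2) = v1 cnj v2; these turn the final inequality into one for \<open>F\<close>.\<close>
  define A where "A = cnj v1 / sqrt k11"
  define B where "B = cnj v2 * sqrt k11 / K z1 z2"
  \<comment> \<open>This coefficient makes the combination vanish at z0, so for \<open>c\<close> the
    passage to the Schur complement loses nothing. For \<open>d\<close> it can only decrease the
    form, and that is the direction needed.\<close>
  let ?C = "- (A * K z0 z1 + B * K z0 z2) / K z0 z0"
  define c where "c y = (if y = z1 then A else if y = z2 then B else if y = z0 then ?C else 0)" for y
  have c: "c \<in> finsupp \<Omega>"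
    using z by (intro finsuppI[of "{z0, z1, z2}"]) (auto simp: c_def)
  define d where "d = (\<lambda>y. cnj (\<Phi> y $$ (0, 0)) * c y)"
  have d: "d \<in> finsupp \<Omega>" unfolding d_def by (rule finsupp_mult[OF c])
  have "comb \<Omega> K c z0 = 0"
    using z nz by (subst comb_eq[of "{z0, z1, z2}"]) (auto simp: c_def)
  then have "quad c = S.quad c"
    using pairing_schur[OF z(1) c] by (simp add: quad_def S.quad_def S.gram_def)
  moreover have "S.quad d \<le> quad d"
  proof -
    have "S.quad d = quad d - (cmod (comb \<Omega> K d z0))\<^sup>2 / Re (K z0 z0)"
      unfolding S.quad_def S.gram_def pairing_schur[OF z(1) d] quad_def minus_complex.sel
        Re_complex_of_real ..
    then show ?thesis using kernel_diag[OF z(1)] by simp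
  qed
  moreover have "quad d \<le> quad c"
    unfolding d_def by (rule quad_multiplier_le[OF \<Phi>(1) c])
  ultimately have le: "S.quad d \<le> S.quad c" by simp
  have schur0: "schur z0 y z0 = 0" "schur z0 z0 y = 0" for y
    using nz by (simp_all add: schur_def)
  let ?s = "schur z0"
  have expand: "S.quad e = (cmod (e z1))\<^sup>2 * Re (?s z1 z1) + (cmod (e z2))\<^sup>2 * Re (?s z2 z2)
      + 2 * Re (cnj (e z1) * e z2 * ?s z1 z2)"
    if "\<And>y. y \<notin> {z0, z1, z2} \<Longrightarrow> e y = 0" for e
  proof -
    have "pairing (comb \<Omega> ?s e) e = (\<Sum>x\<in>{z0, z1, z2}. \<Sum>y\<in>{z0, z1, z2}. cnj (e x) * e y * ?s x y)"
      using z that by (intro pairing_comb) auto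
    also have "\<dots> = (e z1 * cnj (e z1)) * ?s z1 z1 + (e z2 * cnj (e z2)) * ?s z2 z2
        + (cnj (e z1) * e z2 * ?s z1 z2 + cnj (cnj (e z1) * e z2 * ?s z1 z2))"
      using z S.kernel_hermitian[OF z(2,3)] by (simp add: schur0 algebra_simps)
    finally show ?thesis
      unfolding S.quad_def S.gram_def complex_norm_square[symmetric]
      by (simp add: algebra_simps del: of_real_power)
  qed
  have vals: "d z1 = 0" "d z2 = w * B" "c z1 = A" "c z2 = B"
    using z by (auto simp: d_def c_def \<phi>)
  have supp: "c y = 0" "d y = 0" if "y \<notin> {z0, z1, z2}" for y
    using that by (simp_all add: c_def d_def)
  have "S.quad d = w * w * (cmod B)\<^sup>2 * Re (?s z2 z2)"
    by (rule trans[OF expand], erule supp(2)) (simp add: vals norm_mult power2_eq_square)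
  moreover have "S.quad c = (cmod A)\<^sup>2 * Re (?s z1 z1) + (cmod B)\<^sup>2 * Re (?s z2 z2)
      + 2 * Re (cnj A * B * ?s z1 z2)"
    by (rule trans[OF expand], erule supp(1)) (simp only: vals)
  ultimately have "w * w * (cmod B)\<^sup>2 * Re (?s z2 z2)
      \<le> (cmod A)\<^sup>2 * Re (?s z1 z1) + (cmod B)\<^sup>2 * Re (?s z2 z2) + 2 * Re (cnj A * B * ?s z1 z2)"
    using le by simp
  \<comment> \<open>Only 1 - w^2 = \<kappa> survives as the weight at z2, and the value 0 at z1
    leaves no cross term on the side of \<open>d\<close>.\<close>
  then have main: "0 \<le> (cmod A)\<^sup>2 * Re (?s z1 z1) + \<kappa> * (cmod B)\<^sup>2 * Re (?s z2 z2)
      + 2 * Re (cnj A * B * ?s z1 z2)"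
    unfolding w2 by (simp add: algebra_simps)
  have F': "?s x y = K x y * F x y" if "K x y \<noteq> 0" for x y
    using that nz by (simp add: schur_def F field_simps)
  have "(cmod A)\<^sup>2 * Re (?s z1 z1) = (cmod v1)\<^sup>2 * Re (F z1 z1)"
    using k11 nz by (simp add: A_def F' norm_divide power_divide)
  moreover have "\<kappa> * (cmod B)\<^sup>2 * Re (?s z2 z2) = (cmod v2)\<^sup>2 * Re (F z2 z2)"
    using k11 k22 nz
    by (simp add: B_def F' \<kappa>_def norm_divide norm_mult power_divide power_mult_distrib)
  moreover have "cnj A * B * ?s z1 z2 = v1 * cnj v2 * F z1 z2"
    using k11 nz by (simp add: A_def B_def F')
  ultimately show ?thesis using main by simp
qed

section \<open>Subspaces of the Bergman space\<close>

lemma cmod_mult_cnj_less: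
  assumes "cmod x < 1" "cmod y < 1"
  shows "cmod (x * cnj y) < 1" and "1 - x * cnj y \<noteq> 0"
proof -
  have "cmod x * cmod y < 1 * 1" using assms by (intro mult_strict_mono) auto
  then show "cmod (x * cnj y) < 1" by (simp add: norm_mult)
  then show "1 - x * cnj y \<noteq> 0" by auto
qed

text \<open>The Schwarz-Pick identity for a disc automorphism contains the factor 1 - x cnj y, which
  cancels one of the two such factors in the Bergman kernel; the unimodular constant drops
  out.\<close>

lemma dbr_bergman_disc_aut:
  assumes \<phi>: "\<And>z. z \<in> unit_disc \<Longrightarrow> \<phi> z = c * disc_aut \<mu> z"
    and c: "cmod c = 1" and \<mu>: "cmod \<mu> < 1"
    and xy: "x \<in> unit_disc" "y \<in> unit_disc"
  defines "\<delta> \<equiv> \<lambda>z. complex_of_real (sqrt (1 - (cmod \<mu>)\<^sup>2)) / (1 - cnj \<mu> * z)"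
  shows "dbr_kernel bergman_kernel \<phi> x y = \<delta> x * cnj (\<delta> y) / (1 - x * cnj y)"
proof -
  have x: "1 - cnj \<mu> * x \<noteq> 0" and y: "1 - \<mu> * cnj y \<noteq> 0" and xy0: "1 - x * cnj y \<noteq> 0"
    using cmod_mult_cnj_less(2)[of x \<mu>] cmod_mult_cnj_less(2)[of \<mu> y] cmod_mult_cnj_less(2)[of x y] \<mu> xy
    by (auto simp: mult.commute)
  have "(cmod \<mu>)\<^sup>2 \<le> 1" using \<mu> by (simp add: power_le_one)
  then have s: "complex_of_real (sqrt (1 - (cmod \<mu>)\<^sup>2)) * complex_of_real (sqrt (1 - (cmod \<mu>)\<^sup>2)) = 1 - \<mu> * cnj \<mu>"
    by (simp flip: of_real_mult complex_norm_square)
  have cc: "c * cnj c = 1" using c by (simp flip: complex_norm_square)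
  have "1 - \<phi> x * cnj (\<phi> y) = 1 - (c * cnj c) * ((x - \<mu>) * (cnj y - cnj \<mu>)) / ((1 - cnj \<mu> * x) * (1 - \<mu> * cnj y))"
    unfolding \<phi>[OF xy(1)] \<phi>[OF xy(2)] disc_aut_def by (simp add: mult_ac)
  also have "\<dots> = ((1 - cnj \<mu> * x) * (1 - \<mu> * cnj y) - (x - \<mu>) * (cnj y - cnj \<mu>)) / ((1 - cnj \<mu> * x) * (1 - \<mu> * cnj y))"
    unfolding cc using x y by (simp add: diff_divide_distrib)
  also have "(1 - cnj \<mu> * x) * (1 - \<mu> * cnj y) - (x - \<mu>) * (cnj y - cnj \<mu>) = (1 - \<mu> * cnj \<mu>) * (1 - x * cnj y)"
    by (simp add: algebra_simps)
  finally have 1: "1 - \<phi> x * cnj (\<phi> y) = (1 - \<mu> * cnj \<mu>) * (1 - x * cnj y) / ((1 - cnj \<mu> * x) * (1 - \<mu> * cnj y))" .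
  have 2: "\<delta> x * cnj (\<delta> y) = (1 - \<mu> * cnj \<mu>) / ((1 - cnj \<mu> * x) * (1 - \<mu> * cnj y))"
    using s by (simp add: \<delta>_def)
  show ?thesis
    unfolding dbr_kernel_def bergman_kernel_def 1 2 using xy0 by (simp add: power2_eq_square)
qed

text \<open>The strict bound keeps the kernel free of zeros, which lets \<open>cnp_two_point\<close>
  be used with base point 0 at any two distinct nonzero points of the disc.\<close>

lemma dbr_bergman_cnp_imp_disc_aut:
  fixes \<phi> :: "complex \<Rightarrow> complex"
  assumes hol: "\<phi> holomorphic_on unit_disc" and bd: "\<And>z. z \<in> unit_disc \<Longrightarrow> cmod (\<phi> z) < 1"
    and cnp: "cnp_kernel unit_disc (dbr_kernel bergman_kernel \<phi>)"
  shows "\<exists>c \<in> sphere (0::complex) 1. \<exists>\<mu> \<in> unit_disc. \<forall>z \<in> unit_disc. \<phi> z = c * disc_aut \<mu> z"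
proof -
  define p where "p = \<phi> 0"
  have p: "cmod p < 1" unfolding p_def by (rule bd) simp
  let ?K = "dbr_kernel bergman_kernel \<phi>"
  have K: "?K x y = (1 - \<phi> x * cnj (\<phi> y)) / (1 - x * cnj y)\<^sup>2" for x y
    by (simp add: dbr_kernel_def bergman_kernel_def)
  have nz1: "1 - \<phi> x * cnj (\<phi> y) \<noteq> 0" if "x \<in> unit_disc" "y \<in> unit_disc" for x y
    using that bd by (intro cmod_mult_cnj_less)
  have nz2: "1 - x * cnj y \<noteq> 0" if "x \<in> unit_disc" "y \<in> unit_disc" for x y
    using that by (intro cmod_mult_cnj_less) auto
  have Knz: "?K x y \<noteq> 0" if "x \<in> unit_disc" "y \<in> unit_disc" for x y
    using nz1[OF that] nz2[OF that] by (simp add: K)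
  have nzp: "1 - cnj p * \<phi> x \<noteq> 0" "1 - p * cnj (\<phi> x) \<noteq> 0" if "x \<in> unit_disc" for x
    using nz1[OF that, of 0] nz1[OF _ that, of 0] by (auto simp: p_def mult.commute)
  have pp: "1 - p * cnj p \<noteq> 0" by (rule cmod_mult_cnj_less[OF p p])
  define \<psi> where "\<psi> z = (\<phi> z - p) / (1 - cnj p * \<phi> z)" for z
  have \<psi>\<psi>: "1 - \<psi> x * cnj (\<psi> y) = (1 - p * cnj p) * (1 - \<phi> x * cnj (\<phi> y))
      / ((1 - cnj p * \<phi> x) * (1 - p * cnj (\<phi> y)))"
    if "x \<in> unit_disc" "y \<in> unit_disc" for x y
  proof -
    have "1 - \<psi> x * cnj (\<psi> y) = 1 - (\<phi> x - p) * (cnj (\<phi> y) - cnj p)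
        / ((1 - cnj p * \<phi> x) * (1 - p * cnj (\<phi> y)))"
      by (simp add: \<psi>_def)
    also have "\<dots> = ((1 - cnj p * \<phi> x) * (1 - p * cnj (\<phi> y)) - (\<phi> x - p) * (cnj (\<phi> y) - cnj p))
        / ((1 - cnj p * \<phi> x) * (1 - p * cnj (\<phi> y)))"
      using nzp(1)[OF that(1)] nzp(2)[OF that(2)] by (simp add: diff_divide_distrib)
    also have "(1 - cnj p * \<phi> x) * (1 - p * cnj (\<phi> y)) - (\<phi> x - p) * (cnj (\<phi> y) - cnj p)
        = (1 - p * cnj p) * (1 - \<phi> x * cnj (\<phi> y))"
      by (simp add: algebra_simps)
    finally show ?thesis .
  qed
  have \<psi>1: "cmod (\<psi> x) < 1" if x: "x \<in> unit_disc" for x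
  proof -
    have "complex_of_real (1 - (cmod (\<psi> x))\<^sup>2)
        = complex_of_real ((1 - (cmod p)\<^sup>2) * (1 - (cmod (\<phi> x))\<^sup>2) / (cmod (1 - cnj p * \<phi> x))\<^sup>2)"
      using \<psi>\<psi>[OF x x] by (simp add: complex_norm_square del: of_real_power)
    then have "1 - (cmod (\<psi> x))\<^sup>2 = (1 - (cmod p)\<^sup>2) * (1 - (cmod (\<phi> x))\<^sup>2) / (cmod (1 - cnj p * \<phi> x))\<^sup>2"
      by (simp only: of_real_eq_iff)
    also have "\<dots> > 0"
      using p bd[OF x] nzp(1)[OF x]
      by (intro divide_pos_pos mult_pos_pos) (simp_all add: abs_square_less_1)
    finally show ?thesis by (simp add: abs_square_less_1)
  qed
  define F where "F x y = 1 - ?K x 0 * ?K 0 y / (?K x y * ?K 0 0)" for x y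
  have F: "F x y = 1 - (1 - x * cnj y)\<^sup>2 / (1 - \<psi> x * cnj (\<psi> y))"
    if xy: "x \<in> unit_disc" "y \<in> unit_disc" for x y
    unfolding F_def \<psi>\<psi>[OF xy]
    using nz1[OF xy] nz2[OF xy] nzp(1)[OF xy(1)] nzp(2)[OF xy(2)] pp
    by (simp add: K p_def[symmetric] field_simps)
  \<comment> \<open>At 0 this has the default value 0 instead of the derivative of \<psi>. The
    values used are those at nonzero points, together with the limit \<open>g0\<close> at 0.\<close>
  define g where "g z = \<psi> z / z" for z
  define L where "L x y = (2 - x * cnj y - g x * cnj (g y)) / (1 - \<psi> x * cnj (\<psi> y))" for x y
  have FL: "F x y = x * cnj y * L x y" if "x \<in> unit_disc" "y \<in> unit_disc" "x \<noteq> 0" "y \<noteq> 0" for x y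
  proof -
    have ne: "1 - \<psi> x * cnj (\<psi> y) \<noteq> 0"
      using that \<psi>1 by (intro cmod_mult_cnj_less)
    have "\<psi> x * cnj (\<psi> y) = x * cnj y * (g x * cnj (g y))"
      using that by (simp add: g_def)
    then have "(1 - \<psi> x * cnj (\<psi> y)) - (1 - x * cnj y)\<^sup>2 = x * cnj y * (2 - x * cnj y - g x * cnj (g y))"
      by (simp add: power2_eq_square algebra_simps)
    then show ?thesis
      unfolding F[OF that(1,2)] L_def using ne by (simp add: field_simps)
  qed
  have Lpos: "0 \<le> Re (L z z) + Re (L t t) - 2 * Re (L z t)"
    if zt: "z \<in> unit_disc" "t \<in> unit_disc" "z \<noteq> 0" "t \<noteq> 0" "z \<noteq> t" for z t
  proof -
    have diag: "(cmod (1 / x))\<^sup>2 * Re (F x x) = Re (L x x)" if "x \<in> unit_disc" "x \<noteq> 0" for x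
    proof -
      have "F x x = complex_of_real ((cmod x)\<^sup>2) * L x x"
        using FL[OF that(1) that(1) that(2) that(2)] by (simp add: complex_norm_square del: of_real_power)
      then have "Re (F x x) = (cmod x)\<^sup>2 * Re (L x x)" by (simp del: of_real_power)
      then show ?thesis using that(2) by (simp add: norm_divide power_divide)
    qed
    have off: "1 / z * cnj (- 1 / t) * F z t = - L z t"
      using FL[OF zt(1-4)] zt by simp
    \<comment> \<open>The weights 1/z and -1/t cancel the factor by which \<open>F\<close> and
      \<open>L\<close> differ, so the vector becomes (1, -1) for \<open>L\<close>.\<close>
    have "0 \<le> (cmod (1 / z))\<^sup>2 * Re (F z z) + (cmod (- 1 / t))\<^sup>2 * Re (F t t)
        + 2 * Re (1 / z * cnj (- 1 / t) * F z t)"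
      by (rule cnp_two_point[OF cnp]) (use zt Knz in \<open>auto simp: F_def\<close>)
    then show ?thesis
      using diag[OF zt(1,3)] diag[OF zt(2,4)] unfolding off by (simp add: norm_divide)
  qed
  have hol\<psi>: "\<psi> holomorphic_on unit_disc"
    unfolding \<psi>_def using nzp by (intro holomorphic_intros hol) auto
  then have "\<psi> field_differentiable at 0"
    using holomorphic_on_imp_differentiable_at[of \<psi> unit_disc 0] by simp
  then obtain g0 where "(\<psi> has_field_derivative g0) (at 0)"
    unfolding field_differentiable_def by blast
  moreover have \<psi>0: "\<psi> 0 = 0" by (simp add: \<psi>_def p_def)
  ultimately have g_lim: "(g \<longlongrightarrow> g0) (at 0)" and \<psi>_lim: "(\<psi> \<longlongrightarrow> 0) (at 0)"
    using DERIV_isCont[of \<psi> g0 0] by (auto simp: has_field_derivative_iff g_def[abs_def] isCont_def)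
  have rigid: "g z = g0 \<and> cmod g0 = 1" if z: "z \<in> unit_disc" "z \<noteq> 0" for z
  proof -
    have lim: "((\<lambda>t. Re (L z z) + Re (L t t) - 2 * Re (L z t)) \<longlongrightarrow>
        Re (L z z) + Re ((2 - 0 * cnj 0 - g0 * cnj g0) / (1 - 0 * cnj 0))
        - 2 * Re ((2 - z * cnj 0 - g z * cnj g0) / (1 - \<psi> z * cnj 0))) (at 0)"
      unfolding L_def by (intro tendsto_intros g_lim \<psi>_lim) auto
    have ev: "\<forall>\<^sub>F t in at 0. 0 \<le> Re (L z z) + Re (L t t) - 2 * Re (L z t)"
    proof -
      have "\<forall>\<^sub>F t in at 0. t \<in> unit_disc - {z}"
        using z by (intro eventually_at_in_open') auto
      moreover have "\<forall>\<^sub>F t in at 0. t \<noteq> (0::complex)" by (rule eventually_neq_at_within)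
      ultimately show ?thesis
      proof eventually_elim
        case (elim t)
        then show ?case using z by (intro Lpos) auto
      qed
    qed
    have "0 \<le> Re (L z z) + Re (2 - g0 * cnj g0) - 2 * Re (2 - g z * cnj g0)"
      using tendsto_lowerbound[OF lim ev] by simp
    moreover have "Re (g0 * cnj g0) = (cmod g0)\<^sup>2"
      by (metis Re_complex_of_real complex_norm_square)
    moreover have "(cmod (g z - g0))\<^sup>2 = (cmod (g z))\<^sup>2 + (cmod g0)\<^sup>2 - 2 * Re (g z * cnj g0)"
      unfolding cmod_power2 by (simp add: power2_eq_square algebra_simps)
    moreover define s u where "s = (cmod z)\<^sup>2" and "u = (cmod (g z))\<^sup>2"
    moreover have \<psi>z: "(cmod (\<psi> z))\<^sup>2 = s * u"
      using z(2) by (simp add: s_def u_def g_def norm_divide power_divide)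
    have "Re (L z z) = (2 - s - u) / (1 - s * u)"
    proof -
      have "L z z = complex_of_real ((2 - s - u) / (1 - (cmod (\<psi> z))\<^sup>2))"
        by (simp add: L_def s_def u_def complex_norm_square del: of_real_power)
      then show ?thesis by (simp only: \<psi>z Re_complex_of_real)
    qed
    ultimately have "(cmod (g z - g0))\<^sup>2 \<le> (2 - s - u) / (1 - s * u) - 2 + u"
      by simp
    moreover have su: "0 < 1 - s * u"
      using \<psi>1[OF z(1)] by (simp flip: \<psi>z add: abs_square_less_1)
    \<comment> \<open>Over the common denominator the numerator is (2 - s - u) - (2 - u)(1 - s u) =
      -s (1 - u)^2. Together with the square of g(z) - g0 this exhibits two nonnegative terms with
      nonpositive sum; s > 0 then forces u = 1.\<close>
    moreover have "(2 - s - u) / (1 - s * u) - 2 + u = - (s * (1 - u)\<^sup>2 / (1 - s * u))"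
      using su by (simp add: field_simps power2_eq_square)
    ultimately have le: "(cmod (g z - g0))\<^sup>2 + s * (1 - u)\<^sup>2 / (1 - s * u) \<le> 0" by simp
    have s: "0 < s" using z(2) by (simp add: s_def)
    have "0 \<le> s * (1 - u)\<^sup>2 / (1 - s * u)" using s su by simp
    then have "(cmod (g z - g0))\<^sup>2 = 0" "s * (1 - u)\<^sup>2 / (1 - s * u) = 0"
      using le zero_le_power2[of "cmod (g z - g0)"] by linarith+
    then have "g z = g0" "u = 1" using s su by auto
    then show ?thesis by (simp add: u_def abs_square_eq_1)
  qed
  have g0: "cmod g0 = 1"
    using rigid[of "1/2"] by (simp add: norm_divide)
  have \<psi>z: "\<psi> z = g0 * z" if "z \<in> unit_disc" for z
    using rigid[OF that] \<psi>0 by (cases "z = 0") (auto simp: g_def field_simps)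
  \<comment> \<open>Solving \<psi>(z) = g0 z for \<phi> gives (g0 z + p) / (1 + cnj p g0 z).
    Factoring g0 out of the numerator moves the zero to -p cnj g0.\<close>
  define \<mu> where "\<mu> = - p * cnj g0"
  have g00: "g0 * cnj g0 = 1" using g0 by (simp flip: complex_norm_square)
  have "\<phi> z = g0 * disc_aut \<mu> z" if z: "z \<in> unit_disc" for z
  proof -
    have "g0 * z * (1 - cnj p * \<phi> z) = \<phi> z - p"
      using \<psi>z[OF z] nzp(1)[OF z] by (simp add: \<psi>_def field_simps)
    then have eq: "\<phi> z * (1 + cnj p * g0 * z) = g0 * z + p"
      by (simp add: algebra_simps)
    have "cmod (cnj p * g0 * z) < 1"
      using cmod_mult_cnj_less(1)[of z p] p z g0 by (simp add: norm_mult mult.commute)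
    then have "1 + cnj p * g0 * z \<noteq> 0"
      by (metis add_eq_0_iff less_irrefl norm_minus_cancel norm_one)
    then have "\<phi> z = (g0 * z + p) / (1 + cnj p * g0 * z)"
      using eq by (simp add: field_simps)
    also have "\<dots> = (g0 * z + (g0 * cnj g0) * p) / (1 + cnj p * g0 * z)"
      unfolding g00 by simp
    also have "\<dots> = g0 * disc_aut \<mu> z"
      by (simp add: disc_aut_def \<mu>_def algebra_simps)
    finally show ?thesis .
  qed
  moreover have "\<mu> \<in> unit_disc" using p g0 by (simp add: \<mu>_def norm_mult)
  moreover have "g0 \<in> sphere 0 1" using g0 by simp
  ultimately show ?thesis by blast
qed

theorem corollary4p6:
  fixes \<phi> :: "complex \<Rightarrow> complex"
  assumes "\<phi> \<in> H_inf_1"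
    and "\<not> \<phi> constant_on unit_disc"
    and "\<phi> \<in> contractive_multipliers unit_disc bergman_kernel"
  shows "cnp_kernel unit_disc (dbr_kernel bergman_kernel \<phi>) \<longleftrightarrow>
    (\<exists>c \<in> sphere (0::complex) 1. \<exists>\<mu> \<in> unit_disc. \<forall>z \<in> unit_disc. \<phi> z = c * disc_aut \<mu> z)"
proof
  assume cnp: "cnp_kernel unit_disc (dbr_kernel bergman_kernel \<phi>)"
  have hol: "\<phi> holomorphic_on unit_disc" and le: "\<And>z. z \<in> unit_disc \<Longrightarrow> cmod (\<phi> z) \<le> 1"
    using assms(1) by (auto simp: H_inf_1_def)
  have "cmod (\<phi> z) < 1" if z: "z \<in> unit_disc" for z
  proof (rule ccontr)
    assume "\<not> cmod (\<phi> z) < 1"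
    \<comment> \<open>A value of modulus 1 would be an interior maximum of the modulus, against
      nonconstancy.\<close>
    then have "cmod (\<phi> y) \<le> cmod (\<phi> z)" if "y \<in> unit_disc" for y using le[OF that] by simp
    then have "\<phi> constant_on unit_disc"
      using maximum_modulus_principle[OF hol, of unit_disc z] z by simp
    then show False using assms(2) by simp
  qed
  then show "\<exists>c \<in> sphere (0::complex) 1. \<exists>\<mu> \<in> unit_disc. \<forall>z \<in> unit_disc. \<phi> z = c * disc_aut \<mu> z"
    by (rule dbr_bergman_cnp_imp_disc_aut[OF hol _ cnp])
next
  assume "\<exists>c \<in> sphere (0::complex) 1. \<exists>\<mu> \<in> unit_disc. \<forall>z \<in> unit_disc. \<phi> z = c * disc_aut \<mu> z"
  then obtain c \<mu> where c: "cmod c = 1" and \<mu>: "cmod \<mu> < 1"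
    and \<phi>: "\<And>z. z \<in> unit_disc \<Longrightarrow> \<phi> z = c * disc_aut \<mu> z" by auto
  show "cnp_kernel unit_disc (dbr_kernel bergman_kernel \<phi>)"
  \<comment> \<open>Unification takes the rescaling function from
    \<open>dbr_bergman_disc_aut\<close>; what is left is that it has no zeros, and |\<mu>| < 1 keeps
    its numerator positive.\<close>
  proof (rule rescaled_szego_cnp[OF dbr_bergman_disc_aut[OF \<phi> c \<mu>]])
    fix z :: complex assume "z \<in> unit_disc"
    moreover have "(cmod \<mu>)\<^sup>2 < 1" using \<mu> by (simp add: abs_square_less_1)
    ultimately show "complex_of_real (sqrt (1 - (cmod \<mu>)\<^sup>2)) / (1 - cnj \<mu> * z) \<noteq> 0"
      using cmod_mult_cnj_less(2)[of z \<mu>] \<mu> by (auto simp: mult.commute)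
  qed
qed

end
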